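(* For every splittable stationary random process $X=(X_t)_{t\in\mathbb R}$ there exists $\sigma\in[0,\infty)$ such that for every compactly supported continuous function $f:\mathbb R\to\mathbb R$, $$\lim_{r\to\infty,\ \lambda\to0,\ \lambda\log r\to0}\ \frac1{r\lambda^2}\ln \mathbb E\exp\Big(\lambda\int_{-\infty}^\infty f\Big(\frac tr\Big)X_t\,dt\Big)=\frac{\sigma^2}{2}\,\|f\|_{L_2(\mathbb R)}^2 .$$
   Context: A random process is a (jointly) measurable map $X:\mathbb R\times\Omega\to\mathbb R$ on a probability space; two such maps that agree almost surely at every $t\in\mathbb R$ are identified. Processes (possibly on different probability spaces) are identically distributed if they have the same finite-dimensional distributions; processes on the same probability space are independent if all their finite-dimensional vectors are independent. $X$ is stationary if for every $s\in\mathbb R$ the shifted process $(X_{s+t})_t$ is distributed like $X$. A stationary random process $X$ is *splittable* if $\mathbb E\exp|X_0|<\infty$, $\mathbb E X_0=0$, and there exists (on some probability space) a triple of random processes $X^0,X^-,X^+$ such that: (a) $X^-$ and $X^+$ are independent; (b) the four processes $X,X^0,X^-,X^+$ are identically distributed; (c) $\mathbb E\exp\big(\int_{-\infty}^0|X^-_t-X^0_t|\,dt+\int_0^\infty|X^+_t-X^0_t|\,dt\big)<\infty$. The limit means: for every $\varepsilon>0$ there exist $R$ and $\delta>0$ such that the expression is within $\varepsilon$ of the right-hand side for all $r\ge R$ and all $\lambda\ne0$ (of either sign) with $|\lambda|\log r\le\delta$. *)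

theory Defs
  imports "HOL-Probability.Probability"
begin

(* Processes that are modifications of each other are not formally identified.
   Every notion below, as well as the law of any time integral of a jointly measurable
   process, is invariant under passing to a (jointly measurable) modification, so
   quantifying over representatives is the same as quantifying over equivalence classes. *)

definition random_process :: "'a measure \<Rightarrow> (real \<Rightarrow> 'a \<Rightarrow> real) \<Rightarrow> bool" where
  "random_process M X \<longleftrightarrow>
     prob_space M \<and> (\<lambda>(t, \<omega>). X t \<omega>) \<in> borel_measurable (borel \<Otimes>\<^sub>M M)"

definition fd_vector :: "real set \<Rightarrow> (real \<Rightarrow> 'a \<Rightarrow> real) \<Rightarrow> 'a \<Rightarrow> real \<Rightarrow> real" where
  "fd_vector J X \<omega> = (\<lambda>t\<in>J. X t \<omega>)"

definition identically_distributed ::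
    "'a measure \<Rightarrow> (real \<Rightarrow> 'a \<Rightarrow> real) \<Rightarrow> 'b measure \<Rightarrow> (real \<Rightarrow> 'b \<Rightarrow> real) \<Rightarrow> bool" where
  "identically_distributed M X N Y \<longleftrightarrow>
     (\<forall>J. finite J \<longrightarrow>
        distr M (\<Pi>\<^sub>M t\<in>J. borel) (fd_vector J X) = distr N (\<Pi>\<^sub>M t\<in>J. borel) (fd_vector J Y))"

definition independent_processes ::
    "'a measure \<Rightarrow> (real \<Rightarrow> 'a \<Rightarrow> real) \<Rightarrow> (real \<Rightarrow> 'a \<Rightarrow> real) \<Rightarrow> bool" where
  "independent_processes M X Y \<longleftrightarrow>
     (\<forall>J K. finite J \<longrightarrow> finite K \<longrightarrow>
        prob_space.indep_var M (\<Pi>\<^sub>M t\<in>J. borel) (fd_vector J X) (\<Pi>\<^sub>M t\<in>K. borel) (fd_vector K Y))"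

definition stationary :: "'a measure \<Rightarrow> (real \<Rightarrow> 'a \<Rightarrow> real) \<Rightarrow> bool" where
  "stationary M X \<longleftrightarrow> (\<forall>s. identically_distributed M (\<lambda>t. X (s + t)) M X)"

(* The time integrals in condition (c) of splittability are a priori [0,\<infinity>]-valued;
   with exp \<infinity> = \<infinity>, finiteness of the expectation forces them to be finite almost surely. *)
definition exp_ennreal :: "ennreal \<Rightarrow> ennreal" where
  "exp_ennreal x = (if x = \<infinity> then \<infinity> else ennreal (exp (enn2real x)))"

(* HOL cannot quantify existentially over the type of points of the auxiliary probability
   space, so that type is a parameter.  A theorem assuming splittable TYPE('b) M X with 'b
   a type variable covers auxiliary spaces over every type. *)
definition splittable :: "'b itself \<Rightarrow> 'a measure \<Rightarrow> (real \<Rightarrow> 'a \<Rightarrow> real) \<Rightarrow> bool" where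
  "splittable (_ :: 'b itself) M X \<longleftrightarrow>
     random_process M X \<and> stationary M X \<and>
     integrable M (\<lambda>\<omega>. exp \<bar>X 0 \<omega>\<bar>) \<and> (LINT \<omega>|M. X 0 \<omega>) = 0 \<and>
     (\<exists>(N :: 'b measure) X0 Xm Xp.
        random_process N X0 \<and> random_process N Xm \<and> random_process N Xp \<and>
        independent_processes N Xm Xp \<and>
        identically_distributed M X N X0 \<and>
        identically_distributed M X N Xm \<and>
        identically_distributed M X N Xp \<and>
        (\<integral>\<^sup>+\<omega>. exp_ennreal
            ((\<integral>\<^sup>+t\<in>{..0}. ennreal \<bar>Xm t \<omega> - X0 t \<omega>\<bar> \<partial>lborel) +
             (\<integral>\<^sup>+t\<in>{0..}. ennreal \<bar>Xp t \<omega> - X0 t \<omega>\<bar> \<partial>lborel)) \<partial>N) < \<infinity>)"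

definition L2_norm :: "(real \<Rightarrow> real) \<Rightarrow> real" where
  "L2_norm f = sqrt (LINT t|lborel. (f t)\<^sup>2)"

end

theory Submission
  imports Defs
begin

text \<open>For a random variable \<open>Y\<close> put \<open>K\<^sub>Y(u) = u ln E exp(Y/u)\<close>. In these terms Hoelder's inequality is
additive, \<open>K\<^sub>Y\<^sub>+\<^sub>Z(u + v) \<le> K\<^sub>Y(u) + K\<^sub>Z(v)\<close> (lemma \<open>scaled_cgf_add_le\<close>), so that
perturbing \<open>Y\<close> costs a shift of the argument and an additive term. The theorem concerns
\<open>K(1/\<lambda>)\<close> for \<open>Y = \<integral> f(t/r) X\<^sub>t dt\<close>, divided by \<open>r \<lambda>\<close>.

Cut a time window at a point \<open>c\<close>. By stationarity the coupling may be moved to \<open>c\<close>, and then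
the integral over the window is a sum of two independent integrals, distributed like those over the
two halves, plus an error dominated by the integral in condition (c). The error is centred, because
all processes have the same mean, so its scaled generating function at \<open>v \<ge> 2\<close> is at most
\<open>C/v\<close>. Hence each cut costs a shift by \<open>v\<close> and an additive \<open>C/v\<close>, in both directions
(\<open>K_split_upper\<close>, \<open>K_split_lower\<close>). Cutting a window of \<open>2^n\<close> blocks of fixed length \<open>L\<close> down to
its blocks, with the shift \<open>v\<^sub>j = 2 + (\<epsilon>/\<lambda>)(3/4)^j\<close> for pairs of pieces of length \<open>2^j L\<close>
(\<open>K_dyadic_upper\<close>, \<open>K_dyadic_lower\<close>), has two effects:

\<^item> the total shift is at most \<open>2 n + 4 \<epsilon>/\<lambda>\<close>. As \<open>n\<close> is of order \<open>log r\<close>, it is a small fraction of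
  \<open>1/\<lambda>\<close> exactly when \<open>\<lambda> log r\<close> is small;

\<^item> the total cost is a sum of \<open>2^(n-1-j) C/v\<^sub>j\<close>, of order \<open>(r/L)(\<lambda>/\<epsilon>)\<close>; after division
  by \<open>r \<lambda>\<close> it is small if \<open>L\<close> is large compared with \<open>1/\<epsilon>\<close>.

On a block of fixed length, \<open>K(u) = E Y\<^sup>2/(2u) + O(u^(-2))\<close>, and \<open>f(t/r)\<close> is nearly constant there for
large \<open>r\<close>, so the sum over the blocks is a Riemann sum for \<open>\<lambda> r (V(L)/L) (\<integral> f\<^sup>2)/2\<close>, where
\<open>V(L)\<close> is the variance of the integral of \<open>X\<close> over an interval of length \<open>L\<close>
(\<open>level_estimate\<close>). A single cut also compares \<open>V(2L)\<close> with \<open>2V(L)\<close> well enough to make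
\<open>V(2^m)/2^m\<close> converge (\<open>variance_rate_convergent\<close>); its limit is \<open>\<sigma>\<^sup>2\<close>.

Two facts behind this are not immediate. The exponential moments of time integrals must be shown
to depend on the finite-dimensional distributions only, and to factorise for independent processes:
for bounded processes this follows from the mixed moments, which Fubini's theorem reduces to
finite-dimensional expectations one factor at a time (\<open>mixed_moments_transfer\<close>), and truncation
gives the general case. The exponential moments over long windows must be finite
(\<open>exp_integrable_dyadic\<close>): the dyadic bound for truncated processes is uniform in the level of
truncation, and Fatou's lemma applies.\<close>

section \<open>Scaled cumulant generating functions\<close>

definition scaled_cgf :: "'a measure \<Rightarrow> ('a \<Rightarrow> real) \<Rightarrow> real \<Rightarrow> real" where
  "scaled_cgf M Y u = u * ln (LINT w|M. exp (Y w / u))"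

lemma (in prob_space) integral_exp_pos:
  assumes "integrable M (\<lambda>w. exp (Y w))"
  shows "0 < (LINT w|M. exp (Y w :: real))"
proof -
  have "(LINT w|M. exp (Y w)) \<noteq> 0"
    using integral_nonneg_eq_0_iff_AE[OF assms] by (auto simp: AE_False)
  moreover have "(LINT w|M. exp (Y w)) \<ge> 0" by (rule integral_nonneg_AE) auto
  ultimately show ?thesis by linarith
qed

text \<open>Hoelder's inequality with exponents \<open>(u+v)/u\<close> and \<open>(u+v)/v\<close>. After normalising both factors to
mean one it is the convexity of the exponential function, integrated.\<close>

lemma (in prob_space) scaled_cgf_add_le:
  assumes [measurable]: "Y \<in> borel_measurable M" "Z \<in> borel_measurable M"
    and Y: "integrable M (\<lambda>w. exp (Y w / u))" and Z: "integrable M (\<lambda>w. exp (Z w / v))"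
    and uv: "0 < u" "0 < v"
  shows "scaled_cgf M (\<lambda>w. Y w + Z w) (u + v) \<le> scaled_cgf M Y u + scaled_cgf M Z v"
proof -
  define a where "a = (LINT w|M. exp (Y w / u))"
  define b where "b = (LINT w|M. exp (Z w / v))"
  have ab: "a > 0" "b > 0" unfolding a_def b_def using integral_exp_pos Y Z by auto
  define p where "p = u / (u + v)"
  define q where "q = v / (u + v)"
  have pq: "p \<ge> 0" "q \<ge> 0" "p + q = 1"
    using uv by (auto simp: p_def q_def simp flip: add_divide_distrib)
  define c where "c = exp (p * ln a + q * ln b)"
  have le: "exp ((Y w + Z w) / (u + v)) \<le> c * (p * (exp (Y w / u) / a) + q * (exp (Z w / v) / b))" for w
  proof -
    let ?s = "Y w / u - ln a" and ?t = "Z w / v - ln b"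
    have "exp (p * ?s + q * ?t) \<le> p * exp ?s + q * exp ?t"
    proof -
      have "exp ((1 - q) * ?s + q * ?t) \<le> (1 - q) * exp ?s + q * exp ?t"
        using convex_onD[OF exp_convex, of q ?s ?t] pq by auto
      moreover have "1 - q = p" using pq by linarith
      ultimately show ?thesis by simp
    qed
    also have "exp ?s = exp (Y w / u) / a" using ab by (simp add: exp_diff)
    also have "exp ?t = exp (Z w / v) / b" using ab by (simp add: exp_diff)
    also have "p * ?s + q * ?t = (Y w + Z w) / (u + v) - (p * ln a + q * ln b)"
      using uv unfolding p_def q_def by (simp add: divide_simps)
    finally have "exp ((Y w + Z w) / (u + v)) / c \<le> p * (exp (Y w / u) / a) + q * (exp (Z w / v) / b)"
      by (simp only: exp_diff c_def)
    thus ?thesis by (subst (asm) pos_divide_le_eq) (simp_all add: c_def mult.commute)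
  qed
  have int: "integrable M (\<lambda>w. c * (p * (exp (Y w / u) / a) + q * (exp (Z w / v) / b)))"
    using Y Z by auto
  have i: "integrable M (\<lambda>w. exp ((Y w + Z w) / (u + v)))"
  proof (rule Bochner_Integration.integrable_bound[OF int])
    show "AE w in M. norm (exp ((Y w + Z w) / (u + v)))
        \<le> norm (c * (p * (exp (Y w / u) / a) + q * (exp (Z w / v) / b)))"
      unfolding real_norm_def abs_exp_cancel by (intro AE_I2 order_trans[OF le abs_ge_self])
  qed simp
  have "(LINT w|M. exp ((Y w + Z w) / (u + v)))
      \<le> (LINT w|M. c * (p * (exp (Y w / u) / a) + q * (exp (Z w / v) / b)))"
    by (intro integral_mono i int le)
  also have "\<dots> = c"
    using Y Z ab pq by (simp add: a_def[symmetric] b_def[symmetric])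
  finally have "ln (LINT w|M. exp ((Y w + Z w) / (u + v))) \<le> p * ln a + q * ln b"
    using integral_exp_pos[OF i] unfolding c_def
    by (metis ln_exp ln_le_cancel_iff exp_gt_zero)
  hence "(u + v) * ln (LINT w|M. exp ((Y w + Z w) / (u + v))) \<le> (u + v) * (p * ln a + q * ln b)"
    using uv by (intro mult_left_mono) auto
  also have "\<dots> = u * ln a + v * ln b"
    using uv unfolding p_def q_def by (simp add: divide_simps)
  finally show "scaled_cgf M (\<lambda>w. Y w + Z w) (u + v) \<le> scaled_cgf M Y u + scaled_cgf M Z v"
    unfolding scaled_cgf_def a_def b_def .
qed

lemma exp_taylor2:
  fixes x :: real shows "\<bar>exp x - 1 - x - x\<^sup>2 / 2\<bar> \<le> \<bar>x\<bar> ^ 3 * exp \<bar>x\<bar> / 6"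
proof -
  obtain t where t: "\<bar>t\<bar> \<le> \<bar>x\<bar>" "exp x = (\<Sum>m<3. x ^ m / fact m) + exp t / fact 3 * x ^ 3"
    using Maclaurin_exp_le[of x 3] by auto
  have "exp x - 1 - x - x\<^sup>2 / 2 = exp t / 6 * x ^ 3"
    using t(2) by (simp add: eval_nat_numeral)
  hence "\<bar>exp x - 1 - x - x\<^sup>2 / 2\<bar> = exp t * \<bar>x\<bar> ^ 3 / 6"
    by (simp only: abs_mult power_abs) simp
  also have "\<dots> \<le> exp \<bar>x\<bar> * \<bar>x\<bar> ^ 3 / 6"
    using t(1) by (intro divide_right_mono mult_right_mono) auto
  finally show ?thesis by (simp add: mult.commute)
qed

lemma exp_ge_square: "0 \<le> x \<Longrightarrow> x\<^sup>2 \<le> 2 * exp (x::real)"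
  using exp_lower_Taylor_quadratic[of x] by linarith

lemma exp_ge_cube: assumes "0 \<le> (x::real)" shows "x ^ 3 \<le> 6 * exp x"
proof -
  obtain t where t: "exp x = (\<Sum>m<4. x ^ m / fact m) + exp t / fact 4 * x ^ 4"
    using Maclaurin_exp_le[of x 4] by auto
  have "exp t / fact 4 * x ^ 4 \<ge> 0" using assms by simp
  thus ?thesis using t assms by (simp add: eval_nat_numeral)
qed

text \<open>The exponential moment of \<open>T\<close> controls the cubic Taylor remainder of \<open>exp(Y/u)\<close>: one half of \<open>T\<close>
absorbs the cube, the other half the factor \<open>exp \<bar>Y/u\<bar>\<close>, which is the reason for \<open>u \<ge> 2L\<close>. The error
depends on \<open>Y\<close> only through \<open>L\<close> and \<open>c\<close>, as uniformity over all blocks of a window requires.\<close>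

lemma (in prob_space) scaled_cgf_expansion:
  assumes [measurable]: "Y \<in> borel_measurable M" "T \<in> borel_measurable M"
    and YT: "AE w in M. \<bar>Y w\<bar> \<le> L * T w" and T0: "\<And>w. 0 \<le> T w" and L: "0 < L"
    and T: "integrable M (\<lambda>w. exp (T w))" "(LINT w|M. exp (T w)) \<le> c"
    and Y0: "(LINT w|M. Y w) = 0" and u: "2 * L \<le> u"
  shows "integrable M Y" and "integrable M (\<lambda>w. (Y w)\<^sup>2)"
    and "(LINT w|M. (Y w)\<^sup>2) \<le> 2 * c * L\<^sup>2"
    and "integrable M (\<lambda>w. exp (Y w / u))"
    and "\<bar>scaled_cgf M Y u - (LINT w|M. (Y w)\<^sup>2) / (2 * u)\<bar> \<le> 21 * c\<^sup>2 * L ^ 3 / u\<^sup>2"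
proof -
  have u0: "u > 0" using L u by linarith
  have "(1::real) = (LINT w|M. 1)" by (simp add: prob_space)
  also have "\<dots> \<le> (LINT w|M. exp (T w))" by (intro integral_mono T) (auto simp: T0)
  finally have c1: "c \<ge> 1" using T by linarith
  have bd1: "AE w in M. norm (Y w) \<le> L * exp (T w)"
    using YT
  proof eventually_elim
    case (elim w)
    have "T w \<le> exp (T w)" using exp_ge_add_one_self[of "T w"] by linarith
    hence "L * T w \<le> L * exp (T w)" using L by simp
    thus ?case using elim by simp
  qed
  show iY: "integrable M Y"
    by (rule Bochner_Integration.integrable_bound[of M "\<lambda>w. L * exp (T w)"]) (use T bd1 in auto)
  have bd2: "AE w in M. (Y w)\<^sup>2 \<le> L\<^sup>2 * (2 * exp (T w))"
    using YT
  proof eventually_elim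
    case (elim w)
    have "(Y w)\<^sup>2 \<le> (L * T w)\<^sup>2" using elim by (simp add: abs_le_square_iff[symmetric])
    also have "\<dots> \<le> L\<^sup>2 * (2 * exp (T w))"
      unfolding power_mult_distrib by (intro mult_left_mono exp_ge_square T0) auto
    finally show ?case .
  qed
  show iY2: "integrable M (\<lambda>w. (Y w)\<^sup>2)"
    by (rule Bochner_Integration.integrable_bound[of M "\<lambda>w. L\<^sup>2 * (2 * exp (T w))"]) (use T bd2 in auto)
  have "(LINT w|M. (Y w)\<^sup>2) \<le> (LINT w|M. L\<^sup>2 * (2 * exp (T w)))"
    by (intro integral_mono_AE iY2 bd2) (use T in auto)
  also have "\<dots> = L\<^sup>2 * 2 * (LINT w|M. exp (T w))" by simp
  also have "\<dots> \<le> L\<^sup>2 * 2 * c" by (intro mult_left_mono T) auto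
  finally show EY2: "(LINT w|M. (Y w)\<^sup>2) \<le> 2 * c * L\<^sup>2" by (simp add: mult_ac)
  have bdx: "AE w in M. \<bar>Y w / u\<bar> \<le> (L / u) * T w"
    using YT by eventually_elim (use u0 in \<open>simp add: divide_right_mono\<close>)
  have Lu: "L / u \<le> 1 / 2" using u u0 by (simp add: field_simps)
  have bdh: "AE w in M. \<bar>Y w / u\<bar> \<le> T w / 2"
    using bdx
  proof eventually_elim
    case (elim w) thus ?case using mult_right_mono[OF Lu T0, of w] by linarith
  qed
  have bde: "AE w in M. norm (exp (Y w / u)) \<le> exp (T w)"
    using bdh
  proof eventually_elim
    case (elim w) thus ?case using T0[of w] by (simp only: real_norm_def abs_exp_cancel exp_le_cancel_iff)
  qed
  show iE: "integrable M (\<lambda>w. exp (Y w / u))"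
    by (rule Bochner_Integration.integrable_bound[OF T(1)]) (use bde in auto)
  define R where "R w = exp (Y w / u) - 1 - Y w / u - (Y w / u)\<^sup>2 / 2" for w
  have iR: "integrable M R" unfolding R_def power_divide using iE iY iY2 by auto
  have bdR: "AE w in M. \<bar>R w\<bar> \<le> 8 * (L / u) ^ 3 * exp (T w)"
    using bdx bdh
  proof eventually_elim
    case (elim w)
    have "\<bar>R w\<bar> \<le> \<bar>Y w / u\<bar> ^ 3 * exp \<bar>Y w / u\<bar> / 6" unfolding R_def by (rule exp_taylor2)
    also have "\<dots> \<le> ((L / u) * T w) ^ 3 * exp (T w / 2) / 6"
      using elim T0[of w] L u0 by (intro divide_right_mono mult_mono power_mono) auto
    also have "\<dots> = 8 * (L / u) ^ 3 * ((T w / 2) ^ 3 / 6) * exp (T w / 2)"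
      by (simp add: power_mult_distrib power_divide)
    also have "\<dots> \<le> 8 * (L / u) ^ 3 * exp (T w / 2) * exp (T w / 2)"
      using exp_ge_cube[of "T w / 2"] T0 u0 L by (intro mult_right_mono mult_left_mono) auto
    also have "\<dots> = 8 * (L / u) ^ 3 * exp (T w)" by (simp flip: exp_add)
    finally show ?case .
  qed
  define m where "m = (LINT w|M. exp (Y w / u))"
  define q where "q = (LINT w|M. (Y w)\<^sup>2) / (2 * u\<^sup>2)"
  define \<rho> where "\<rho> = (LINT w|M. R w)"
  have "\<rho> = m - 1 - 0 - q"
    unfolding \<rho>_def R_def power_divide m_def q_def using iE iY iY2 Y0 by (simp add: prob_space)
  hence m_eq: "m = 1 + q + \<rho>" by simp
  have "\<bar>\<rho>\<bar> \<le> (LINT w|M. \<bar>R w\<bar>)" unfolding \<rho>_def by simp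
  also have "\<dots> \<le> (LINT w|M. 8 * (L / u) ^ 3 * exp (T w))"
    using T iR bdR by (intro integral_mono_AE) auto
  also have "\<dots> = 8 * (L / u) ^ 3 * (LINT w|M. exp (T w))" by simp
  also have "\<dots> \<le> 8 * (L / u) ^ 3 * c" using L u0 by (intro mult_left_mono T) auto
  finally have \<rho>: "\<bar>\<rho>\<bar> \<le> 8 * (L / u) ^ 3 * c" .
  have "1 = (LINT w|M. 1 + Y w / u)" using iY Y0 by (simp add: prob_space)
  also have "\<dots> \<le> m" unfolding m_def using iY iE by (intro integral_mono) auto
  finally have m1: "m \<ge> 1" .
  define y where "y = m - 1"
  have y0: "y \<ge> 0" using m1 by (simp add: y_def)
  have q: "0 \<le> q" "q \<le> c * (L / u)\<^sup>2"
    using EY2 u0 unfolding q_def by (auto simp: power_divide field_simps)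
  have lu0: "0 \<le> L / u" using L u0 by simp
  have "8 * (L / u) ^ 3 * c = 8 * (L / u) * ((L / u)\<^sup>2 * c)" by (simp add: power3_eq_cube power2_eq_square)
  also have "\<dots> \<le> 8 * (1/2) * ((L / u)\<^sup>2 * c)"
    using Lu c1 by (intro mult_right_mono mult_left_mono) auto
  finally have y5: "y \<le> 5 * c * (L / u)\<^sup>2" using q \<rho> unfolding y_def m_eq by (simp add: algebra_simps)
  have "y\<^sup>2 \<le> (5 * c * (L / u)\<^sup>2)\<^sup>2" using y0 y5 by (intro power_mono) auto
  also have "\<dots> = 25 * c\<^sup>2 * (L / u) ^ 3 * (L / u)"
    by (simp only: power_mult_distrib eval_nat_numeral power_Suc power_0 mult_ac) simp
  also have "\<dots> \<le> 25 * c\<^sup>2 * (L / u) ^ 3 * (1/2)"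
    using Lu lu0 by (intro mult_left_mono) auto
  finally have ysq: "y\<^sup>2 \<le> 25 / 2 * c\<^sup>2 * (L / u) ^ 3" by simp
  have ln_up: "ln m \<le> y" unfolding y_def using m1 by (intro ln_le_minus_one) auto
  \<comment> \<open>The mean zero makes y nonnegative, and then y - y^2 bounds ln (1 + y) from below.\<close>
  have ln_lo: "y - y\<^sup>2 \<le> ln m"
  proof (cases "y \<le> 1")
    case True thus ?thesis using ln_one_plus_pos_lower_bound[of y] y0 by (simp add: y_def)
  next
    case False
    hence "y * 1 \<le> y * y" by (intro mult_left_mono) auto
    hence "y - y\<^sup>2 \<le> 0" by (simp add: power2_eq_square)
    also have "0 \<le> ln m" using m1 by simp
    finally show ?thesis .
  qed
  have cc: "c \<le> c\<^sup>2" using c1 by (simp add: power2_eq_square)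
  have "(8 * (L / u) ^ 3) * c \<le> (8 * (L / u) ^ 3) * c\<^sup>2" using lu0 cc by (intro mult_left_mono) auto
  hence "\<bar>ln m - q\<bar> \<le> 8 * (L / u) ^ 3 * c\<^sup>2 + 25 / 2 * c\<^sup>2 * (L / u) ^ 3"
    using ln_up ln_lo ysq \<rho> m_eq zero_le_power2[of y] unfolding y_def by linarith
  also have "\<dots> = (41 / 2) * (c\<^sup>2 * (L / u) ^ 3)" by simp
  also have "\<dots> \<le> 21 * (c\<^sup>2 * (L / u) ^ 3)" using lu0 by (intro mult_right_mono) auto
  finally have fin: "\<bar>ln m - q\<bar> \<le> 21 * c\<^sup>2 * (L / u) ^ 3" by simp
  have "scaled_cgf M Y u - (LINT w|M. (Y w)\<^sup>2) / (2 * u) = u * (ln m - q)"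
    unfolding scaled_cgf_def m_def q_def using u0 by (simp add: field_simps power2_eq_square)
  hence "\<bar>scaled_cgf M Y u - (LINT w|M. (Y w)\<^sup>2) / (2 * u)\<bar> = u * \<bar>ln m - q\<bar>"
    using u0 by (simp add: abs_mult)
  also have "\<dots> \<le> u * (21 * c\<^sup>2 * (L / u) ^ 3)" using u0 fin by (intro mult_left_mono) auto
  also have "\<dots> = 21 * c\<^sup>2 * L ^ 3 / u\<^sup>2" using u0 by (simp add: field_simps eval_nat_numeral)
  finally show "\<bar>scaled_cgf M Y u - (LINT w|M. (Y w)\<^sup>2) / (2 * u)\<bar> \<le> 21 * c\<^sup>2 * L ^ 3 / u\<^sup>2" .
qed


section \<open>Time integrals and finite-dimensional distributions\<close>

definition time_integral :: "(real \<Rightarrow> real) \<Rightarrow> (real \<Rightarrow> 'a \<Rightarrow> real) \<Rightarrow> 'a \<Rightarrow> real" where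
  "time_integral g X w = (LINT t|lborel. g t * X t w)"

abbreviation abs_moment :: "'a measure \<Rightarrow> (real \<Rightarrow> 'a \<Rightarrow> real) \<Rightarrow> real \<Rightarrow> ennreal" where
  "abs_moment M X t \<equiv> \<integral>\<^sup>+w. ennreal \<bar>X t w\<bar> \<partial>M"

lemma random_process_prob_space: "random_process M X \<Longrightarrow> prob_space M"
  by (simp add: random_process_def)

lemma random_process_pair_measurable:
  assumes "random_process M X"
  shows "(\<lambda>p. X (fst p) (snd p)) \<in> borel_measurable (lborel \<Otimes>\<^sub>M M)"
    and "(\<lambda>p. X (snd p) (fst p)) \<in> borel_measurable (M \<Otimes>\<^sub>M lborel)"
proof -
  have X: "case_prod X \<in> borel_measurable (borel \<Otimes>\<^sub>M M)"
    using assms by (simp add: random_process_def)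
  have "(\<lambda>p. (fst p, snd p)) \<in> lborel \<Otimes>\<^sub>M M \<rightarrow>\<^sub>M borel \<Otimes>\<^sub>M M" by measurable
  from measurable_compose[OF this X] show "(\<lambda>p. X (fst p) (snd p)) \<in> borel_measurable (lborel \<Otimes>\<^sub>M M)"
    by simp
  have "(\<lambda>p. (snd p, fst p)) \<in> M \<Otimes>\<^sub>M lborel \<rightarrow>\<^sub>M borel \<Otimes>\<^sub>M M" by measurable
  from measurable_compose[OF this X] show "(\<lambda>p. X (snd p) (fst p)) \<in> borel_measurable (M \<Otimes>\<^sub>M lborel)"
    by simp
qed

lemma random_process_component:
  assumes "random_process M X" shows "X t \<in> borel_measurable M"
proof -
  have X: "case_prod X \<in> borel_measurable (borel \<Otimes>\<^sub>M M)"
    using assms by (simp add: random_process_def)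
  have "(\<lambda>w. (t, w)) \<in> M \<rightarrow>\<^sub>M borel \<Otimes>\<^sub>M M" by measurable
  from measurable_compose[OF this X] show ?thesis by simp
qed

lemma random_process_path:
  assumes "random_process M X" "w \<in> space M" shows "(\<lambda>t. X t w) \<in> borel_measurable borel"
proof -
  have X: "case_prod X \<in> borel_measurable (borel \<Otimes>\<^sub>M M)"
    using assms by (simp add: random_process_def)
  have "(\<lambda>t. (t, w)) \<in> borel \<rightarrow>\<^sub>M borel \<Otimes>\<^sub>M M" using assms by measurable
  from measurable_compose[OF this X] show ?thesis by simp
qed

lemma time_integral_measurable:
  assumes "random_process M X" and [measurable]: "g \<in> borel_measurable borel"
  shows "time_integral g X \<in> borel_measurable M"
proof -
  note [measurable] = random_process_pair_measurable[OF assms(1)]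
  have "(\<lambda>w. LINT t|lborel. g t * X t w) \<in> borel_measurable M"
    by (rule lborel.borel_measurable_lebesgue_integral) (simp add: split_beta')
  thus ?thesis unfolding time_integral_def .
qed

lemma fd_vector_measurable:
  assumes "random_process M X"
  shows "fd_vector J X \<in> M \<rightarrow>\<^sub>M (\<Pi>\<^sub>M t\<in>J. borel)"
  unfolding fd_vector_def using random_process_component[OF assms]
  by (intro measurable_restrict) auto

lemma random_process_compose:
  assumes "random_process M X" and [measurable]: "\<psi> \<in> borel_measurable borel"
  shows "random_process M (\<lambda>t w. \<psi> (X t w))"
proof -
  have X: "case_prod X \<in> borel_measurable (borel \<Otimes>\<^sub>M M)"
    using assms by (simp add: random_process_def)
  have "(\<lambda>p. \<psi> (case_prod X p)) \<in> borel_measurable (borel \<Otimes>\<^sub>M M)" using X by measurable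
  thus ?thesis using assms by (simp add: random_process_def split_beta')
qed

lemma random_process_shift:
  assumes "random_process M X"
  shows "random_process M (\<lambda>t. X (s + t))"
proof -
  have X: "case_prod X \<in> borel_measurable (borel \<Otimes>\<^sub>M M)"
    using assms by (simp add: random_process_def)
  have "(\<lambda>p. (s + fst p, snd p)) \<in> borel \<Otimes>\<^sub>M M \<rightarrow>\<^sub>M borel \<Otimes>\<^sub>M M" by measurable
  from measurable_compose[OF this X] show ?thesis
    using assms by (simp add: random_process_def split_beta')
qed

lemma time_integral_shift: "time_integral g X w = time_integral (\<lambda>t. g (s + t)) (\<lambda>t. X (s + t)) w"
  unfolding time_integral_def
  using lborel_integral_real_affine[of 1 "\<lambda>t. g t * X t w" s] by simp

text \<open>The weight \<open>V\<close> will carry the factors of a product of several time integrals other than the one that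
is exchanged with the expectation.\<close>

lemma fubini_weighted:
  assumes X: "random_process M X" and [measurable]: "V \<in> borel_measurable M"
    and g: "integrable lborel g"
    and m: "\<And>t. (\<integral>\<^sup>+w. ennreal \<bar>V w * X t w\<bar> \<partial>M) \<le> ennreal m"
  shows time_integral_paths: "AE w in M. integrable lborel (\<lambda>t. g t * (V w * X t w))"
    and time_integral_integrable: "integrable M (\<lambda>w. V w * time_integral g X w)"
    and time_integral_fubini:
      "(LINT w|M. V w * time_integral g X w) = (LINT t|lborel. g t * (LINT w|M. V w * X t w))"
proof -
  interpret M: prob_space M using X by (rule random_process_prob_space)
  interpret P: pair_sigma_finite lborel M ..
  note [measurable] = random_process_pair_measurable[OF X] borel_measurable_integrable[OF g]
    random_process_component[OF X]
  have "integrable (lborel \<Otimes>\<^sub>M M) (\<lambda>p. g (fst p) * (V (snd p) * X (fst p) (snd p)))"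
  proof (rule integrableI_bounded)
    have "(\<integral>\<^sup>+p. ennreal (norm (g (fst p) * (V (snd p) * X (fst p) (snd p)))) \<partial>(lborel \<Otimes>\<^sub>M M))
        = (\<integral>\<^sup>+t. \<integral>\<^sup>+w. ennreal (norm (g t * (V w * X t w))) \<partial>M \<partial>lborel)"
      by (subst M.nn_integral_fst[symmetric]) auto
    also have "\<dots> = (\<integral>\<^sup>+t. ennreal (norm (g t)) * (\<integral>\<^sup>+w. ennreal \<bar>V w * X t w\<bar> \<partial>M) \<partial>lborel)"
      by (simp add: norm_mult ennreal_mult nn_integral_cmult abs_mult)
    also have "\<dots> \<le> (\<integral>\<^sup>+t. ennreal (norm (g t)) * ennreal m \<partial>lborel)"
      by (intro nn_integral_mono mult_left_mono m) auto
    also have "\<dots> = (\<integral>\<^sup>+t. ennreal (norm (g t)) \<partial>lborel) * ennreal m"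
      by (simp add: nn_integral_multc)
    also have "\<dots> < \<infinity>"
      using g by (simp add: integrable_iff_bounded ennreal_mult_less_top)
    finally show "(\<integral>\<^sup>+p. ennreal (norm (g (fst p) * (V (snd p) * X (fst p) (snd p)))) \<partial>(lborel \<Otimes>\<^sub>M M)) < \<infinity>" .
  qed simp
  hence int: "integrable (lborel \<Otimes>\<^sub>M M) (case_prod (\<lambda>t w. g t * (V w * X t w)))"
    by (simp add: split_beta')
  show "AE w in M. integrable lborel (\<lambda>t. g t * (V w * X t w))"
    using P.AE_integrable_snd[OF int] .
  have eq: "V w * time_integral g X w = (LINT t|lborel. g t * (V w * X t w))" for w
    unfolding time_integral_def by (simp add: mult.left_commute flip: integral_mult_right_zero)
  show "integrable M (\<lambda>w. V w * time_integral g X w)"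
    unfolding eq using P.integrable_snd[OF int] .
  have "(LINT w|M. V w * time_integral g X w) = (LINT w|M. LINT t|lborel. g t * (V w * X t w))"
    unfolding eq ..
  also have "\<dots> = (LINT t|lborel. LINT w|M. g t * (V w * X t w))"
    by (rule P.Fubini_integral[OF int])
  also have "\<dots> = (LINT t|lborel. g t * (LINT w|M. V w * X t w))" by simp
  finally show "(LINT w|M. V w * time_integral g X w) = (LINT t|lborel. g t * (LINT w|M. V w * X t w))" .
qed

lemma time_integral_bounded:
  assumes X: "random_process M X" and c: "\<And>t w. \<bar>X t w\<bar> \<le> c" and g: "integrable lborel g"
    and w: "w \<in> space M"
  shows "\<bar>time_integral g X w\<bar> \<le> c * (LINT t|lborel. \<bar>g t\<bar>)"
proof -
  note [measurable] = random_process_path[OF X w] borel_measurable_integrable[OF g]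
  have i2: "integrable lborel (\<lambda>t. c * \<bar>g t\<bar>)" using g by auto
  have le: "\<bar>g t * X t w\<bar> \<le> c * \<bar>g t\<bar>" for t
    using mult_right_mono[OF c[of t w], of "\<bar>g t\<bar>"] by (simp add: abs_mult mult.commute)
  have i1: "integrable lborel (\<lambda>t. g t * X t w)"
    by (rule Bochner_Integration.integrable_bound[OF i2]) (auto intro!: AE_I2 order_trans[OF le])
  have "\<bar>time_integral g X w\<bar> \<le> (LINT t|lborel. \<bar>g t * X t w\<bar>)" unfolding time_integral_def by simp
  also have "\<dots> \<le> (LINT t|lborel. c * \<bar>g t\<bar>)" using i1 i2 le by (intro integral_mono) auto
  finally show ?thesis by simp
qed

lemma (in finite_measure) integrable_bounded:
  assumes "f \<in> borel_measurable M" "\<And>x. x \<in> space M \<Longrightarrow> \<bar>f x\<bar> \<le> (b::real)"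
  shows "integrable M f"
  by (rule integrable_const_bound[of _ b]) (use assms in auto)

text \<open>Adding the value at time \<open>t\<close> to a test function of the values on \<open>J\<close>. The coordinate is truncated at
the level \<open>c\<close> that bounds the process, which keeps the test function bounded and changes no value
along the process.\<close>

abbreviation with_coordinate ::
    "real set \<Rightarrow> real \<Rightarrow> ((real \<Rightarrow> real) \<Rightarrow> real) \<Rightarrow> real \<Rightarrow> (real \<Rightarrow> real) \<Rightarrow> real" where
  "with_coordinate J c \<phi> t z \<equiv> \<phi> (restrict z J) * max (-c) (min c (z t))"

text \<open>One of the \<open>k + 1\<close> factors is written as an integral over \<open>t\<close> and moved out of the expectation; the
value of the process at \<open>t\<close> joins the finite-dimensional test function.\<close>

lemma moment_step:
  assumes Z: "random_process L Z" and bZ: "\<And>t w. \<bar>Z t w\<bar> \<le> c"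
    and U[measurable]: "U \<in> borel_measurable L" and bU: "\<And>w. w \<in> space L \<Longrightarrow> \<bar>U w\<bar> \<le> v"
    and \<phi>[measurable]: "\<phi> \<in> borel_measurable (\<Pi>\<^sub>M t\<in>J. borel)" and B: "\<And>z. \<bar>\<phi> z\<bar> \<le> (B::real)"
    and g: "integrable lborel g"
  shows "(LINT w|L. U w * \<phi> (fd_vector J Z w) * time_integral g Z w ^ Suc k)
      = (LINT t|lborel. g t * (LINT w|L. U w * with_coordinate J c \<phi> t (fd_vector (insert t J) Z w) * time_integral g Z w ^ k))"
proof -
  have gm: "g \<in> borel_measurable borel" using g by (auto dest: borel_measurable_integrable)
  define b where "b = c * (LINT t|lborel. \<bar>g t\<bar>)"
  have c0: "c \<ge> 0" using bZ[of 0 undefined] by linarith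
  have b0: "b \<ge> 0" unfolding b_def using c0 by (intro mult_nonneg_nonneg) auto
  interpret L: prob_space L using Z by (rule random_process_prob_space)
  note [measurable] = fd_vector_measurable[OF Z] random_process_component[OF Z]
    time_integral_measurable[OF Z gm]
  let ?V = "\<lambda>w. U w * \<phi> (fd_vector J Z w) * time_integral g Z w ^ k"
  have bV: "\<bar>?V w * Z t w\<bar> \<le> v * B * b ^ k * c" if "w \<in> space L" for t w
  proof -
    have "v \<ge> 0" using bU[OF that] by linarith
    moreover have "B \<ge> 0" using B[of undefined] by linarith
    ultimately show ?thesis
    unfolding abs_mult power_abs using b0 c0 bU[OF that] bZ B time_integral_bounded[OF Z bZ g that]
    by (intro mult_mono power_mono) (auto simp: b_def intro!: mult_nonneg_nonneg)
  qed
  have "(LINT w|L. U w * \<phi> (fd_vector J Z w) * time_integral g Z w ^ Suc k)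
      = (LINT w|L. ?V w * time_integral g Z w)" by (simp add: mult_ac)
  also have "\<dots> = (LINT t|lborel. g t * (LINT w|L. ?V w * Z t w))"
  proof (rule time_integral_fubini[OF Z _ g])
    fix t
    have "(\<integral>\<^sup>+w. ennreal \<bar>?V w * Z t w\<bar> \<partial>L) \<le> (\<integral>\<^sup>+w. ennreal (v * B * b ^ k * c) \<partial>L)"
      by (intro nn_integral_mono ennreal_leI bV)
    also have "\<dots> = ennreal (v * B * b ^ k * c)" by (simp add: L.emeasure_space_1)
    finally show "(\<integral>\<^sup>+w. ennreal \<bar>?V w * Z t w\<bar> \<partial>L) \<le> ennreal (v * B * b ^ k * c)" .
  qed simp
  also have "\<dots> = (LINT t|lborel. g t * (LINT w|L. U w * with_coordinate J c \<phi> t (fd_vector (insert t J) Z w) * time_integral g Z w ^ k))"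
  proof -
    have "restrict (fd_vector (insert t J) Z w) J = fd_vector J Z w" for t w
      by (auto simp: fd_vector_def restrict_def)
    moreover have "max (-c) (min c (fd_vector (insert t J) Z w t)) = Z t w" for t w
      using bZ[of t w] by (auto simp: fd_vector_def)
    ultimately show ?thesis by (simp add: mult_ac)
  qed
  finally show ?thesis .
qed

text \<open>Time integrals are not functions of finitely many coordinates, yet their moments are determined by
the finite-dimensional distributions. The induction on \<open>k\<close> works because the claim is made for all
\<open>J\<close> and \<open>\<phi>\<close> at once. The weights \<open>V\<close> and \<open>W\<close> allow the same argument to give equality in law
(with weight 1) and independence (with \<open>V\<close> a functional of the other process and \<open>W\<close> its mean).\<close>

lemma mixed_moments_transfer:
  fixes M :: "'a measure" and N :: "'b measure"
  assumes X: "random_process M X" and Y: "random_process N Y"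
    and bX: "\<And>t w. \<bar>X t w\<bar> \<le> c" and bY: "\<And>t w. \<bar>Y t w\<bar> \<le> c"
    and V[measurable]: "V \<in> borel_measurable M" and W[measurable]: "W \<in> borel_measurable N"
    and bV: "\<And>w. w \<in> space M \<Longrightarrow> \<bar>V w\<bar> \<le> v" and bW: "\<And>w. w \<in> space N \<Longrightarrow> \<bar>W w\<bar> \<le> v"
    and base: "\<And>J \<phi>. finite J \<Longrightarrow> \<phi> \<in> borel_measurable (\<Pi>\<^sub>M t\<in>J. borel) \<Longrightarrow> (\<exists>B::real. \<forall>z. \<bar>\<phi> z\<bar> \<le> B) \<Longrightarrow>
      (LINT w|M. V w * \<phi> (fd_vector J X w)) = (LINT w|N. W w * \<phi> (fd_vector J Y w))"
    and g: "integrable lborel g"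
  shows "finite J \<Longrightarrow> \<phi> \<in> borel_measurable (\<Pi>\<^sub>M t\<in>J. borel) \<Longrightarrow> (\<exists>B::real. \<forall>z. \<bar>\<phi> z\<bar> \<le> B) \<Longrightarrow>
    (LINT w|M. V w * \<phi> (fd_vector J X w) * time_integral g X w ^ k)
      = (LINT w|N. W w * \<phi> (fd_vector J Y w) * time_integral g Y w ^ k)"
proof (induction k arbitrary: J \<phi>)
  case 0
  then show ?case using base by simp
next
  case (Suc k)
  note [measurable] = Suc.prems(2)
  from Suc.prems obtain B where B: "\<And>z. \<bar>\<phi> z\<bar> \<le> B" by auto
  have gm: "g \<in> borel_measurable borel" using g by (auto dest: borel_measurable_integrable)
  have c0: "c \<ge> 0" using bX[of 0 undefined] by linarith
  have IH: "(LINT w|M. V w * with_coordinate J c \<phi> t (fd_vector (insert t J) X w) * time_integral g X w ^ k)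
     = (LINT w|N. W w * with_coordinate J c \<phi> t (fd_vector (insert t J) Y w) * time_integral g Y w ^ k)" for t
  proof (rule Suc.IH[of "insert t J" "with_coordinate J c \<phi> t"])
    show "finite (insert t J)" using Suc.prems by simp
    have [measurable]: "(\<lambda>z. restrict z J) \<in> (\<Pi>\<^sub>M t\<in>insert t J. borel) \<rightarrow>\<^sub>M (\<Pi>\<^sub>M t\<in>J. borel)"
      by (rule measurable_restrict_subset) auto
    have [measurable]: "(\<lambda>z. z t) \<in> (\<Pi>\<^sub>M t\<in>insert t J. borel) \<rightarrow>\<^sub>M (borel :: real measure)"
      by (rule measurable_component_singleton) auto
    show "with_coordinate J c \<phi> t \<in> borel_measurable (\<Pi>\<^sub>M t\<in>insert t J. borel)"
      by measurable
    have "B \<ge> 0" using B[of undefined] by linarith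
    hence "\<bar>with_coordinate J c \<phi> t z\<bar> \<le> B * c" for z
      unfolding abs_mult using B c0 by (intro mult_mono) auto
    thus "\<exists>B. \<forall>z. \<bar>with_coordinate J c \<phi> t z\<bar> \<le> B" by auto
  qed
  have eX: "(LINT w|M. V w * \<phi> (fd_vector J X w) * time_integral g X w ^ Suc k)
      = (LINT t|lborel. g t * (LINT w|M. V w * with_coordinate J c \<phi> t (fd_vector (insert t J) X w) * time_integral g X w ^ k))"
    by (rule moment_step) (fact X bX V bV Suc.prems(2) B g)+
  have eY: "(LINT w|N. W w * \<phi> (fd_vector J Y w) * time_integral g Y w ^ Suc k)
      = (LINT t|lborel. g t * (LINT w|N. W w * with_coordinate J c \<phi> t (fd_vector (insert t J) Y w) * time_integral g Y w ^ k))"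
    by (rule moment_step) (fact Y bY W bW Suc.prems(2) B g)+
  show ?case unfolding eX eY by (simp only: IH)
qed

lemma exp_moments_sums:
  assumes X: "random_process M X" and bX: "\<And>t w. \<bar>X t w\<bar> \<le> c"
    and V[measurable]: "V \<in> borel_measurable M" and bV: "\<And>w. w \<in> space M \<Longrightarrow> \<bar>V w\<bar> \<le> v"
    and g: "integrable lborel g"
  shows "(\<lambda>k. (LINT w|M. V w * time_integral g X w ^ k) / fact k)
    sums (LINT w|M. V w * exp (time_integral g X w))"
proof -
  interpret M: prob_space M using X by (rule random_process_prob_space)
  have gm: "g \<in> borel_measurable borel" using g by (auto dest: borel_measurable_integrable)
  note [measurable] = time_integral_measurable[OF X gm]
  define b where "b = c * (LINT t|lborel. \<bar>g t\<bar>)"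
  have c0: "c \<ge> 0" using bX[of 0 undefined] by linarith
  have b0: "b \<ge> 0" unfolding b_def using c0 by (intro mult_nonneg_nonneg) auto
  let ?f = "\<lambda>k w. V w * (time_integral g X w ^ k / fact k)"
  have bf: "\<bar>?f k w\<bar> \<le> v * (b ^ k / fact k)" if "w \<in> space M" for k w
  proof -
    have "v \<ge> 0" using bV[OF that] by linarith
    thus ?thesis unfolding abs_mult abs_divide power_abs
      using bV[OF that] time_integral_bounded[OF X bX g that] b0
      by (intro mult_mono) (auto simp: b_def intro!: divide_right_mono power_mono)
  qed
  have se: "summable (\<lambda>k. v * (b ^ k / fact k))"
    using summable_exp[of b] by (intro summable_mult) (simp add: field_simps)
  have int: "integrable M (?f k)" for k
    by (rule M.integrable_bounded[of _ "v * (b ^ k / fact k)"]) (use bf in auto)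
  have "(\<lambda>k. LINT w|M. ?f k w) sums (LINT w|M. (\<Sum>k. ?f k w))"
  proof (rule sums_integral[OF int])
    show "AE w in M. summable (\<lambda>k. norm (?f k w))"
    proof (rule AE_I2)
      fix w assume "w \<in> space M"
      thus "summable (\<lambda>k. norm (?f k w))"
        using bf by (intro summable_comparison_test[OF _ se]) auto
    qed
    have "norm (LINT w|M. norm (?f k w)) \<le> v * (b ^ k / fact k)" for k
    proof -
      have "(LINT w|M. norm (?f k w)) \<le> (LINT w|M. v * (b ^ k / fact k))"
        using bf by (intro integral_mono integrable_norm int) auto
      thus ?thesis by (simp add: M.prob_space)
    qed
    thus "summable (\<lambda>k. LINT w|M. norm (?f k w))"
      by (intro summable_comparison_test[OF _ se]) auto
  qed
  moreover have "(\<Sum>k. ?f k w) = V w * exp (time_integral g X w)" for w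
  proof -
    have "(\<lambda>k. time_integral g X w ^ k / fact k) sums exp (time_integral g X w)"
      using exp_converges[of "time_integral g X w"] by (simp add: field_simps)
    from sums_unique[OF sums_mult[OF this, of "V w"]] show ?thesis by simp
  qed
  moreover have "(LINT w|M. ?f k w) = (LINT w|M. V w * time_integral g X w ^ k) / fact k" for k
    by (simp flip: integral_divide_zero)
  ultimately show ?thesis by simp
qed

lemma exp_transfer_weighted:
  fixes M :: "'a measure" and N :: "'b measure"
  assumes X: "random_process M X" and Y: "random_process N Y"
    and bX: "\<And>t w. \<bar>X t w\<bar> \<le> c" and bY: "\<And>t w. \<bar>Y t w\<bar> \<le> c"
    and V: "V \<in> borel_measurable M" and W: "W \<in> borel_measurable N"
    and bV: "\<And>w. w \<in> space M \<Longrightarrow> \<bar>V w\<bar> \<le> v" and bW: "\<And>w. w \<in> space N \<Longrightarrow> \<bar>W w\<bar> \<le> v"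
    and base: "\<And>J \<phi>. finite J \<Longrightarrow> \<phi> \<in> borel_measurable (\<Pi>\<^sub>M t\<in>J. borel) \<Longrightarrow> (\<exists>B::real. \<forall>z. \<bar>\<phi> z\<bar> \<le> B) \<Longrightarrow>
      (LINT w|M. V w * \<phi> (fd_vector J X w)) = (LINT w|N. W w * \<phi> (fd_vector J Y w))"
    and g: "integrable lborel g"
  shows "(LINT w|M. V w * exp (time_integral g X w)) = (LINT w|N. W w * exp (time_integral g Y w))"
proof -
  have "(LINT w|M. V w * time_integral g X w ^ k) = (LINT w|N. W w * time_integral g Y w ^ k)" for k
  proof -
    have "(LINT w|M. V w * (\<lambda>_. 1) (fd_vector {} X w) * time_integral g X w ^ k)
        = (LINT w|N. W w * (\<lambda>_. 1) (fd_vector {} Y w) * time_integral g Y w ^ k)"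
      by (rule mixed_moments_transfer[where c=c and v=v])
         ((fact X Y bX bY V W bV bW base g) | force)+
    thus ?thesis by simp
  qed
  moreover have "(\<lambda>k. (LINT w|M. V w * time_integral g X w ^ k) / fact k)
      sums (LINT w|M. V w * exp (time_integral g X w))"
    by (rule exp_moments_sums) (fact X bX V bV g)+
  moreover have "(\<lambda>k. (LINT w|N. W w * time_integral g Y w ^ k) / fact k)
      sums (LINT w|N. W w * exp (time_integral g Y w))"
    by (rule exp_moments_sums) (fact Y bY W bW g)+
  ultimately show ?thesis by (simp add: sums_unique2)
qed

lemma exp_transfer_bounded:
  fixes M :: "'a measure" and N :: "'b measure"
  assumes X: "random_process M X" and Y: "random_process N Y"
    and XY: "identically_distributed M X N Y"
    and bX: "\<And>t w. \<bar>X t w\<bar> \<le> c" and bY: "\<And>t w. \<bar>Y t w\<bar> \<le> c"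
    and g: "integrable lborel g"
  shows "(LINT w|M. exp (time_integral g X w)) = (LINT w|N. exp (time_integral g Y w))"
proof -
  have "(LINT w|M. 1 * exp (time_integral g X w)) = (LINT w|N. 1 * exp (time_integral g Y w))"
  proof (rule exp_transfer_weighted[where V="\<lambda>_. 1" and W="\<lambda>_. 1" and v=1, OF X Y bX bY _ _ _ _ _ g])
    fix J :: "real set" and \<phi> :: "(real \<Rightarrow> real) \<Rightarrow> real"
    assume J: "finite J" and \<phi>: "\<phi> \<in> borel_measurable (\<Pi>\<^sub>M t\<in>J. borel)"
    have "(LINT w|M. \<phi> (fd_vector J X w)) = (LINT z|distr M (\<Pi>\<^sub>M t\<in>J. borel) (fd_vector J X). \<phi> z)"
      by (rule integral_distr[symmetric, OF fd_vector_measurable[OF X] \<phi>])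
    also have "\<dots> = (LINT z|distr N (\<Pi>\<^sub>M t\<in>J. borel) (fd_vector J Y). \<phi> z)"
      using XY J by (simp add: identically_distributed_def)
    also have "\<dots> = (LINT w|N. \<phi> (fd_vector J Y w))"
      by (rule integral_distr[OF fd_vector_measurable[OF Y] \<phi>])
    finally show "(LINT w|M. 1 * \<phi> (fd_vector J X w)) = (LINT w|N. 1 * \<phi> (fd_vector J Y w))" by simp
  qed simp_all
  thus ?thesis by simp
qed

text \<open>Independence of the finite-dimensional vectors is upgraded one process at a time: first only \<open>Y\<close> is
integrated, tested against finitely many values of \<open>X\<close>; then \<open>exp (\<integral> h Y)\<close> becomes the weight
for \<open>X\<close>.\<close>

lemma exp_indep_bounded:
  assumes X: "random_process M X" and Y: "random_process M Y"
    and ind: "independent_processes M X Y"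
    and bX: "\<And>t w. \<bar>X t w\<bar> \<le> c" and bY: "\<And>t w. \<bar>Y t w\<bar> \<le> c"
    and g: "integrable lborel g" and h: "integrable lborel h"
  shows "(LINT w|M. exp (time_integral g X w + time_integral h Y w))
    = (LINT w|M. exp (time_integral g X w)) * (LINT w|M. exp (time_integral h Y w))"
proof -
  interpret M: prob_space M using X by (rule random_process_prob_space)
  note fX[measurable] = fd_vector_measurable[OF X] and fY[measurable] = fd_vector_measurable[OF Y]
  have hm: "h \<in> borel_measurable borel" using h by (auto dest: borel_measurable_integrable)
  note [measurable] = time_integral_measurable[OF Y hm]
  let ?e = "LINT w|M. exp (time_integral h Y w)"
  have one: "(LINT w|M. \<phi> (fd_vector J X w) * exp (time_integral h Y w))
      = (LINT w|M. \<phi> (fd_vector J X w)) * ?e"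
    if J: "finite J" and \<phi>[measurable]: "\<phi> \<in> borel_measurable (\<Pi>\<^sub>M t\<in>J. borel)"
      and B: "\<And>z. \<bar>\<phi> z\<bar> \<le> (B::real)" for J \<phi> B
  proof -
    let ?m = "LINT w|M. \<phi> (fd_vector J X w)"
    have i\<phi>: "integrable M (\<lambda>w. \<phi> (fd_vector J X w))"
      by (rule M.integrable_bounded[of _ B]) (use B in auto)
    have "\<bar>?m\<bar> \<le> (LINT w|M. \<bar>\<phi> (fd_vector J X w)\<bar>)" by simp
    also have "\<dots> \<le> (LINT w|M. B)" using i\<phi> B by (intro integral_mono) auto
    finally have m: "\<bar>?m\<bar> \<le> B" by (simp add: M.prob_space)
    have "(LINT w|M. \<phi> (fd_vector J X w) * exp (time_integral h Y w))
        = (LINT w|M. ?m * exp (time_integral h Y w))"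
    proof (rule exp_transfer_weighted[OF Y Y bY bY _ _ _ _ _ h, where v=B])
      fix K :: "real set" and \<theta> :: "(real \<Rightarrow> real) \<Rightarrow> real"
      assume K: "finite K" and \<theta>[measurable]: "\<theta> \<in> borel_measurable (\<Pi>\<^sub>M t\<in>K. borel)"
        and "\<exists>B. \<forall>z. \<bar>\<theta> z\<bar> \<le> B"
      then obtain B' where B': "\<And>z. \<bar>\<theta> z\<bar> \<le> B'" by auto
      have "M.indep_var borel (\<phi> \<circ> fd_vector J X) borel (\<theta> \<circ> fd_vector K Y)"
        using ind J K by (intro M.indep_var_compose[OF _ \<phi> \<theta>]) (simp add: independent_processes_def)
      moreover have "integrable M (\<theta> \<circ> fd_vector K Y)" unfolding comp_def
        by (rule M.integrable_bounded[of _ B']) (use B' in auto)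
      ultimately have "(LINT w|M. \<phi> (fd_vector J X w) * \<theta> (fd_vector K Y w))
          = ?m * (LINT w|M. \<theta> (fd_vector K Y w))"
        using M.indep_var_lebesgue_integral[of "\<phi> \<circ> fd_vector J X" "\<theta> \<circ> fd_vector K Y"] i\<phi>
        by (simp add: comp_def)
      thus "(LINT w|M. \<phi> (fd_vector J X w) * \<theta> (fd_vector K Y w))
          = (LINT w|M. ?m * \<theta> (fd_vector K Y w))" by simp
    qed (use B m in auto)
    thus ?thesis by simp
  qed
  define b where "b = c * (LINT t|lborel. \<bar>h t\<bar>)"
  have be: "\<bar>exp (time_integral h Y w)\<bar> \<le> exp b" if "w \<in> space M" for w
    using time_integral_bounded[OF Y bY h that] by (simp add: b_def)
  have ie: "integrable M (\<lambda>w. exp (time_integral h Y w))"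
    by (rule M.integrable_bounded[of _ "exp b"]) (use be in auto)
  have "\<bar>?e\<bar> \<le> (LINT w|M. \<bar>exp (time_integral h Y w)\<bar>)" by (rule integral_abs_bound)
  also have "\<dots> \<le> (LINT w|M. exp b)" using ie be by (intro integral_mono) auto
  finally have eb: "\<bar>?e\<bar> \<le> exp b" by (simp add: M.prob_space)
  have "(LINT w|M. exp (time_integral h Y w) * exp (time_integral g X w))
      = (LINT w|M. ?e * exp (time_integral g X w))"
  proof (rule exp_transfer_weighted[OF X X bX bX _ _ _ _ _ g, where v="exp b"])
    fix J :: "real set" and \<phi> :: "(real \<Rightarrow> real) \<Rightarrow> real"
    assume J: "finite J" and \<phi>: "\<phi> \<in> borel_measurable (\<Pi>\<^sub>M t\<in>J. borel)" and "\<exists>B. \<forall>z. \<bar>\<phi> z\<bar> \<le> B"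
    then obtain B where B: "\<And>z. \<bar>\<phi> z\<bar> \<le> B" by auto
    show "(LINT w|M. exp (time_integral h Y w) * \<phi> (fd_vector J X w))
        = (LINT w|M. ?e * \<phi> (fd_vector J X w))"
      using one[OF J \<phi> B] by (simp add: mult.commute)
  qed (use be eb in auto)
  thus ?thesis by (simp add: exp_add mult.commute)
qed


lemma time_integral_divide: "time_integral (\<lambda>t. g t / u) X w = time_integral g X w / u"
  unfolding time_integral_def by (simp flip: integral_divide_zero)

abbreviation abs_time_integral :: "(real \<Rightarrow> real) \<Rightarrow> (real \<Rightarrow> 'a \<Rightarrow> real) \<Rightarrow> 'a \<Rightarrow> real" where
  "abs_time_integral g X \<equiv> time_integral (\<lambda>t. \<bar>g t\<bar>) (\<lambda>t w. \<bar>X t w\<bar>)"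

lemma abs_time_integral_ge: "\<bar>time_integral g X w\<bar> \<le> abs_time_integral g X w"
  unfolding time_integral_def using integral_abs_bound[of lborel "\<lambda>t. g t * X t w"] by (simp add: abs_mult)

lemma abs_time_integral_divide:
  "0 < u \<Longrightarrow> abs_time_integral (\<lambda>t. g t / u) X w = abs_time_integral g X w / u"
  using time_integral_divide[of "\<lambda>t. \<bar>g t\<bar>" u "\<lambda>t w. \<bar>X t w\<bar>"] by simp

lemma integrable_paths:
  assumes X: "random_process M X" and g: "integrable lborel g"
    and m: "\<And>t. abs_moment M X t \<le> ennreal m"
  shows "AE w in M. integrable lborel (\<lambda>t. g t * X t w)"
  using time_integral_paths[OF X _ g, of "\<lambda>_. 1" m] m by simp

lemma time_integral_truncation:
  assumes X: "random_process M X" and g: "integrable lborel g"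
    and m: "\<And>t. abs_moment M X t \<le> ennreal m"
    and [measurable]: "\<And>n. \<psi> n \<in> borel_measurable borel" "\<phi> \<in> borel_measurable borel"
    and le: "\<And>n x. \<bar>\<psi> n x\<bar> \<le> \<bar>x\<bar>" and lim: "\<And>x. (\<lambda>n. \<psi> n x) \<longlonglongrightarrow> \<phi> x"
  shows "AE w in M. (\<lambda>n. time_integral g (\<lambda>t w. \<psi> n (X t w)) w)
    \<longlonglongrightarrow> time_integral g (\<lambda>t w. \<phi> (X t w)) w"
proof -
  have "AE w in M. w \<in> space M" by simp
  with integrable_paths[OF X g m] show ?thesis
  proof eventually_elim
    case (elim w)
    note [measurable] = random_process_path[OF X elim(2)] borel_measurable_integrable[OF g]
    show ?case unfolding time_integral_def
    proof (rule integral_dominated_convergence[where w="\<lambda>t. \<bar>g t * X t w\<bar>"])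
      show "integrable lborel (\<lambda>t. \<bar>g t * X t w\<bar>)" using elim by auto
      show "AE t in lborel. (\<lambda>n. g t * \<psi> n (X t w)) \<longlonglongrightarrow> g t * \<phi> (X t w)"
        by (intro AE_I2 tendsto_mult tendsto_const lim)
      show "AE t in lborel. norm (g t * \<psi> n (X t w)) \<le> \<bar>g t * X t w\<bar>" for n
        by (intro AE_I2) (simp add: abs_mult le mult_left_mono)
    qed auto
  qed
qed

lemma integrable_exp_fatou:
  fixes f :: "nat \<Rightarrow> 'a \<Rightarrow> real"
  assumes int: "\<And>n. integrable M (\<lambda>w. exp (f n w))" and [measurable]: "F \<in> borel_measurable M"
    and lim: "AE w in M. (\<lambda>n. f n w) \<longlonglongrightarrow> F w"
    and le: "\<And>n. (LINT w|M. exp (f n w)) \<le> C"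
  shows "integrable M (\<lambda>w. exp (F w))" and "(LINT w|M. exp (F w)) \<le> C"
proof -
  have "(\<integral>\<^sup>+w. ennreal (exp (F w)) \<partial>M) = (\<integral>\<^sup>+w. liminf (\<lambda>n. ennreal (exp (f n w))) \<partial>M)"
  proof (rule nn_integral_cong_AE, use lim in eventually_elim)
    case (elim w)
    have "(\<lambda>n. ennreal (exp (f n w))) \<longlonglongrightarrow> ennreal (exp (F w))"
      by (intro tendsto_ennrealI tendsto_exp elim)
    from lim_imp_Liminf[OF _ this] show ?case by simp
  qed
  also have "\<dots> \<le> liminf (\<lambda>n. \<integral>\<^sup>+w. ennreal (exp (f n w)) \<partial>M)"
    using int by (intro nn_integral_liminf) auto
  also have "\<dots> \<le> ennreal C"
  proof (rule Liminf_le)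
    show "\<forall>\<^sub>F n in sequentially. (\<integral>\<^sup>+w. ennreal (exp (f n w)) \<partial>M) \<le> ennreal C"
      using int le by (auto simp: nn_integral_eq_integral intro!: always_eventually ennreal_leI)
  qed simp
  finally have bd: "(\<integral>\<^sup>+w. ennreal (exp (F w)) \<partial>M) \<le> ennreal C" .
  show i: "integrable M (\<lambda>w. exp (F w))"
    by (rule integrableI_bounded) (use le_less_trans[OF bd] in auto)
  have "0 \<le> (LINT w|M. exp (f 0 w))" by simp
  hence "0 \<le> C" using le[of 0] by linarith
  thus "(LINT w|M. exp (F w)) \<le> C"
    using bd by (simp add: nn_integral_eq_integral[OF i] ennreal_le_iff)
qed

definition clip :: "nat \<Rightarrow> real \<Rightarrow> real" where "clip n x = max (- real n) (min (real n) x)"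

abbreviation clipped :: "nat \<Rightarrow> (real \<Rightarrow> 'a \<Rightarrow> real) \<Rightarrow> real \<Rightarrow> 'a \<Rightarrow> real" where
  "clipped n X \<equiv> \<lambda>t w. clip n (X t w)"

lemma clip_measurable [measurable]: "clip n \<in> borel_measurable borel"
  unfolding clip_def by measurable

lemma abs_clip_le: "\<bar>clip n x\<bar> \<le> \<bar>x\<bar>" "\<bar>clip n x\<bar> \<le> real n"
  by (auto simp: clip_def)

lemma eventually_clip: "eventually (\<lambda>n. clip n x = x) sequentially"
proof -
  obtain n0 where "\<bar>x\<bar> \<le> real n0" using real_arch_simple by blast
  hence "clip n x = x" if "n0 \<le> n" for n using that by (auto simp: clip_def)
  thus ?thesis by (auto simp: eventually_sequentially)
qed

lemma tendsto_clip: "(\<lambda>n. clip n x) \<longlonglongrightarrow> x"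
  by (rule tendsto_eventually[OF eventually_clip])

lemma tendsto_abs_clip: "(\<lambda>n. \<bar>clip n x\<bar>) \<longlonglongrightarrow> \<bar>x\<bar>"
  by (intro tendsto_rabs tendsto_clip)

lemma clip_lipschitz: "\<bar>clip n x - clip n y\<bar> \<le> \<bar>x - y\<bar>"
  by (auto simp: clip_def max_def min_def)

lemma integrable_exp_bounded:
  assumes X: "random_process M X" and c: "\<And>t w. \<bar>X t w\<bar> \<le> c" and g: "integrable lborel g"
  shows "integrable M (\<lambda>w. exp (time_integral g X w))"
proof -
  interpret M: prob_space M using X by (rule random_process_prob_space)
  have gm: "g \<in> borel_measurable borel" using g by (auto dest: borel_measurable_integrable)
  note [measurable] = time_integral_measurable[OF X gm]
  have "\<bar>exp (time_integral g X w)\<bar> \<le> exp (c * (LINT t|lborel. \<bar>g t\<bar>))" if "w \<in> space M" for w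
    using time_integral_bounded[OF X c g that] by simp
  thus ?thesis by (intro M.integrable_bounded) auto
qed

subsection \<open>Operations on families of finite-dimensional distributions\<close>

lemma identically_distributed_trans:
  "identically_distributed M X N Y \<Longrightarrow> identically_distributed N Y L Z \<Longrightarrow> identically_distributed M X L Z"
  by (simp add: identically_distributed_def)

lemma fd_vector_compose:
  "fd_vector J (\<lambda>t w. \<psi> (X t w)) = (\<lambda>z. \<lambda>t\<in>J. \<psi> (z t)) \<circ> fd_vector J X"
  by (auto simp: fd_vector_def fun_eq_iff restrict_def)

lemma pointwise_measurable:
  assumes [measurable]: "\<psi> \<in> borel_measurable borel"
  shows "(\<lambda>z. \<lambda>t\<in>J. \<psi> (z t)) \<in> (\<Pi>\<^sub>M t\<in>J. borel) \<rightarrow>\<^sub>M (\<Pi>\<^sub>M t\<in>J. borel :: real measure)"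
  by (intro measurable_restrict) (use assms in \<open>measurable\<close>)

lemma identically_distributed_compose:
  assumes X: "random_process M X" and Y: "random_process N Y"
    and XY: "identically_distributed M X N Y" and \<psi>: "\<psi> \<in> borel_measurable borel"
  shows "identically_distributed M (\<lambda>t w. \<psi> (X t w)) N (\<lambda>t w. \<psi> (Y t w))"
  unfolding identically_distributed_def
proof (intro allI impI)
  fix J :: "real set" assume J: "finite J"
  have "distr M (\<Pi>\<^sub>M t\<in>J. borel) (fd_vector J (\<lambda>t w. \<psi> (X t w)))
      = distr (distr M (\<Pi>\<^sub>M t\<in>J. borel) (fd_vector J X)) (\<Pi>\<^sub>M t\<in>J. borel) (\<lambda>z. \<lambda>t\<in>J. \<psi> (z t))"
    unfolding fd_vector_compose
    by (rule distr_distr[symmetric, OF pointwise_measurable[OF \<psi>] fd_vector_measurable[OF X]])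
  also have "\<dots> = distr (distr N (\<Pi>\<^sub>M t\<in>J. borel) (fd_vector J Y)) (\<Pi>\<^sub>M t\<in>J. borel) (\<lambda>z. \<lambda>t\<in>J. \<psi> (z t))"
    using XY J by (simp add: identically_distributed_def)
  also have "\<dots> = distr N (\<Pi>\<^sub>M t\<in>J. borel) (fd_vector J (\<lambda>t w. \<psi> (Y t w)))"
    unfolding fd_vector_compose
    by (rule distr_distr[OF pointwise_measurable[OF \<psi>] fd_vector_measurable[OF Y]])
  finally show "distr M (\<Pi>\<^sub>M t\<in>J. borel) (fd_vector J (\<lambda>t w. \<psi> (X t w)))
      = distr N (\<Pi>\<^sub>M t\<in>J. borel) (fd_vector J (\<lambda>t w. \<psi> (Y t w)))" .
qed

lemma independent_processes_compose:
  assumes M: "prob_space M" and ind: "independent_processes M X Y"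
    and \<psi>: "\<psi> \<in> borel_measurable borel"
  shows "independent_processes M (\<lambda>t w. \<psi> (X t w)) (\<lambda>t w. \<psi> (Y t w))"
  unfolding independent_processes_def fd_vector_compose
  using ind by (intro allI impI prob_space.indep_var_compose[OF M _ pointwise_measurable[OF \<psi>] pointwise_measurable[OF \<psi>]])
    (simp add: independent_processes_def)

lemma distr_component_eq:
  assumes X: "random_process M X" and Y: "random_process N Y"
    and XY: "identically_distributed M X N Y"
  shows "distr M borel (X t) = distr N borel (Y t)"
proof -
  have m: "(\<lambda>z. z t) \<in> (\<Pi>\<^sub>M t\<in>{t}. borel) \<rightarrow>\<^sub>M (borel :: real measure)"
    by (rule measurable_component_singleton) auto
  have "distr M borel (X t) = distr (distr M (\<Pi>\<^sub>M t\<in>{t}. borel) (fd_vector {t} X)) borel (\<lambda>z. z t)"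
    using distr_distr[OF m fd_vector_measurable[OF X]] by (simp add: fd_vector_def comp_def)
  also have "\<dots> = distr (distr N (\<Pi>\<^sub>M t\<in>{t}. borel) (fd_vector {t} Y)) borel (\<lambda>z. z t)"
    using XY by (simp add: identically_distributed_def)
  also have "\<dots> = distr N borel (Y t)"
    using distr_distr[OF m fd_vector_measurable[OF Y]] by (simp add: fd_vector_def comp_def)
  finally show ?thesis .
qed

lemma nn_integral_component_eq:
  assumes "random_process M X" "random_process N Y" "identically_distributed M X N Y"
    and f: "f \<in> borel_measurable borel"
  shows "(\<integral>\<^sup>+w. f (X t w) \<partial>M) = (\<integral>\<^sup>+w. f (Y t w) \<partial>N)"
  using nn_integral_distr[OF random_process_component[OF assms(1), of t], of f]
    nn_integral_distr[OF random_process_component[OF assms(2), of t], of f]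
    distr_component_eq[OF assms(1-3), of t] f by simp

lemma integral_component_eq:
  assumes "random_process M X" "random_process N Y" "identically_distributed M X N Y"
  shows "(LINT w|M. X t w) = (LINT w|N. Y t w)"
  using integral_distr[OF random_process_component[OF assms(1), of t], of "\<lambda>x. x"]
    integral_distr[OF random_process_component[OF assms(2), of t], of "\<lambda>x. x"]
    distr_component_eq[OF assms(1-3), of t] by simp

subsection \<open>Exponential moments of unbounded processes\<close>

text \<open>Fatou's lemma: bounds uniform in the level of truncation are all that is needed for the exponential
moment of the untruncated process.\<close>

lemma integrable_exp_truncation:
  assumes X: "random_process M X" and g: "integrable lborel g"
    and m: "\<And>t. abs_moment M X t \<le> ennreal m"
    and le: "\<And>n. (LINT w|M. exp (abs_time_integral g (clipped n X) w)) \<le> C"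
  shows "integrable M (\<lambda>w. exp (abs_time_integral g X w))"
proof (rule integrable_exp_fatou(1))
  have ga: "integrable lborel (\<lambda>t. \<bar>g t\<bar>)" using g by auto
  have gm: "(\<lambda>t. \<bar>g t\<bar>) \<in> borel_measurable borel" using g by (auto dest: borel_measurable_integrable)
  have Xc: "random_process M (\<lambda>t w. \<bar>clip n (X t w)\<bar>)" for n
    using random_process_compose[OF X, of "\<lambda>x. \<bar>clip n x\<bar>"] by simp
  show "integrable M (\<lambda>w. exp (abs_time_integral g (clipped n X) w))" for n
    by (rule integrable_exp_bounded[OF Xc _ ga, where c="real n"]) (simp add: abs_clip_le)
  show "abs_time_integral g X \<in> borel_measurable M"
    using random_process_compose[OF X, of abs] gm by (intro time_integral_measurable) auto
  show "AE w in M. (\<lambda>n. abs_time_integral g (clipped n X) w) \<longlonglongrightarrow> abs_time_integral g X w"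
    by (rule time_integral_truncation[OF X ga m, of "\<lambda>n x. \<bar>clip n x\<bar>" abs])
       (auto simp: abs_clip_le tendsto_abs_clip)
qed (rule le)

lemma abs_time_integral_clip_le:
  assumes X: "random_process M X" and g: "integrable lborel g"
    and m: "\<And>t. abs_moment M X t \<le> ennreal m"
  shows "AE w in M. \<forall>n. abs_time_integral g (clipped n X) w \<le> abs_time_integral g X w"
proof -
  have "AE w in M. w \<in> space M" by simp
  with integrable_paths[OF X g m] show ?thesis
  proof eventually_elim
    case (elim w)
    note [measurable] = random_process_path[OF X elim(2)] borel_measurable_integrable[OF g]
    have i: "integrable lborel (\<lambda>t. \<bar>g t\<bar> * \<bar>X t w\<bar>)"
      using integrable_abs[OF elim(1)] by (simp add: abs_mult)
    show ?case unfolding time_integral_def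
      by (intro allI integral_mono_AE' i) (auto intro!: mult_left_mono abs_clip_le)
  qed
qed

lemma integrable_exp_transfer:
  assumes X: "random_process M X" and Y: "random_process N Y"
    and XY: "identically_distributed M X N Y" and g: "integrable lborel g"
    and m: "\<And>t. abs_moment M X t \<le> ennreal m"
    and int: "integrable M (\<lambda>w. exp (abs_time_integral g X w))"
  shows "integrable N (\<lambda>w. exp (abs_time_integral g Y w))"
proof (rule integrable_exp_truncation[OF Y g])
  have ga: "integrable lborel (\<lambda>t. \<bar>g t\<bar>)" using g by auto
  show "abs_moment N Y t \<le> ennreal m" for t
    using nn_integral_component_eq[OF X Y XY, of "\<lambda>x. ennreal \<bar>x\<bar>" t] m[of t] by simp
  fix n
  have Xc: "random_process M (\<lambda>t w. \<bar>clip n (X t w)\<bar>)"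
    using random_process_compose[OF X, of "\<lambda>x. \<bar>clip n x\<bar>"] by simp
  have Yc: "random_process N (\<lambda>t w. \<bar>clip n (Y t w)\<bar>)"
    using random_process_compose[OF Y, of "\<lambda>x. \<bar>clip n x\<bar>"] by simp
  have "(LINT w|N. exp (abs_time_integral g (clipped n Y) w))
      = (LINT w|M. exp (abs_time_integral g (clipped n X) w))"
    by (rule exp_transfer_bounded[OF Xc Yc _ _ _ ga, where c="real n", symmetric])
       (auto simp: abs_clip_le intro!: identically_distributed_compose[OF X Y XY, of "\<lambda>x. \<bar>clip n x\<bar>"])
  also have "\<dots> \<le> (LINT w|M. exp (abs_time_integral g X w))"
  proof (rule integral_mono_AE[OF _ int])
    show "integrable M (\<lambda>w. exp (abs_time_integral g (clipped n X) w))"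
      by (rule integrable_exp_bounded[OF Xc _ ga, where c="real n"]) (simp add: abs_clip_le)
    show "AE w in M. exp (abs_time_integral g (clipped n X) w) \<le> exp (abs_time_integral g X w)"
      using abs_time_integral_clip_le[OF X g m] by eventually_elim simp
  qed
  finally show "(LINT w|N. exp (abs_time_integral g (clipped n Y) w))
     \<le> (LINT w|M. exp (abs_time_integral g X w))" .
qed

lemma exp_clip_tendsto:
  assumes X: "random_process M X" and g: "integrable lborel g"
    and m: "\<And>t. abs_moment M X t \<le> ennreal m"
    and int: "integrable M (\<lambda>w. exp (abs_time_integral g X w))"
  shows "(\<lambda>n. LINT w|M. exp (time_integral g (clipped n X) w))
    \<longlonglongrightarrow> (LINT w|M. exp (time_integral g X w))"
    and "integrable M (\<lambda>w. exp (time_integral g X w))"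
proof -
  have gm: "g \<in> borel_measurable borel" using g by (auto dest: borel_measurable_integrable)
  note [measurable] = time_integral_measurable[OF X gm]
    time_integral_measurable[OF random_process_compose[OF X clip_measurable] gm]
  show "integrable M (\<lambda>w. exp (time_integral g X w))"
    by (rule Bochner_Integration.integrable_bound[OF int])
       (auto intro!: AE_I2 order_trans[OF _ abs_time_integral_ge])
  show "(\<lambda>n. LINT w|M. exp (time_integral g (clipped n X) w))
    \<longlonglongrightarrow> (LINT w|M. exp (time_integral g X w))"
  proof (rule integral_dominated_convergence[OF _ _ int])
    show "AE w in M. (\<lambda>n. exp (time_integral g (clipped n X) w)) \<longlonglongrightarrow> exp (time_integral g X w)"
    proof -
      have "AE w in M. (\<lambda>n. time_integral g (clipped n X) w) \<longlonglongrightarrow> time_integral g X w"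
        by (rule time_integral_truncation[OF X g m, of clip "\<lambda>x. x"]) (auto simp: abs_clip_le tendsto_clip)
      thus ?thesis by eventually_elim (rule tendsto_exp)
    qed
    show "AE w in M. norm (exp (time_integral g (clipped n X) w)) \<le> exp (abs_time_integral g X w)" for n
      using abs_time_integral_clip_le[OF X g m]
    proof eventually_elim
      case (elim w)
      have "time_integral g (clipped n X) w \<le> abs_time_integral g X w"
        using elim abs_time_integral_ge[of g "\<lambda>t w. clip n (X t w)" w] by (auto simp: abs_le_iff intro: order_trans)
      thus ?case by simp
    qed
  qed auto
qed

lemma exp_transfer:
  assumes X: "random_process M X" and Y: "random_process N Y"
    and XY: "identically_distributed M X N Y" and g: "integrable lborel g"
    and m: "\<And>t. abs_moment M X t \<le> ennreal m"
    and int: "integrable M (\<lambda>w. exp (abs_time_integral g X w))"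
  shows "(LINT w|M. exp (time_integral g X w)) = (LINT w|N. exp (time_integral g Y w))"
proof (rule LIMSEQ_unique)
  show "(\<lambda>n. LINT w|M. exp (time_integral g (clipped n X) w))
    \<longlonglongrightarrow> (LINT w|M. exp (time_integral g X w))" by (rule exp_clip_tendsto[OF X g m int])
  have mY: "abs_moment N Y t \<le> ennreal m" for t
    using nn_integral_component_eq[OF X Y XY, of "\<lambda>x. ennreal \<bar>x\<bar>" t] m[of t] by simp
  have "(LINT w|M. exp (time_integral g (clipped n X) w))
      = (LINT w|N. exp (time_integral g (clipped n Y) w))" for n
    by (rule exp_transfer_bounded[OF random_process_compose[OF X clip_measurable]
          random_process_compose[OF Y clip_measurable]
          identically_distributed_compose[OF X Y XY clip_measurable] abs_clip_le(2) abs_clip_le(2) g])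
  thus "(\<lambda>n. LINT w|M. exp (time_integral g (clipped n X) w))
    \<longlonglongrightarrow> (LINT w|N. exp (time_integral g Y w))"
    using exp_clip_tendsto(1)[OF Y g mY integrable_exp_transfer[OF X Y XY g m int]] by simp
qed

text \<open>The dominating variable \<open>exp (\<integral> \<bar>g X\<bar> + \<integral> \<bar>h Y\<bar>)\<close> is not integrable for free: its integrability comes
from the factorisation for the truncated processes and Fatou's lemma. After that the
factorisation passes to the limit by dominated convergence.\<close>

lemma exp_indep:
  assumes X: "random_process M X" and Y: "random_process M Y"
    and ind: "independent_processes M X Y"
    and g: "integrable lborel g" and h: "integrable lborel h"
    and mX: "\<And>t. abs_moment M X t \<le> ennreal m"
    and mY: "\<And>t. abs_moment M Y t \<le> ennreal m"
    and iX: "integrable M (\<lambda>w. exp (abs_time_integral g X w))"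
    and iY: "integrable M (\<lambda>w. exp (abs_time_integral h Y w))"
  shows "integrable M (\<lambda>w. exp (time_integral g X w + time_integral h Y w))"
    and "(LINT w|M. exp (time_integral g X w + time_integral h Y w))
    = (LINT w|M. exp (time_integral g X w)) * (LINT w|M. exp (time_integral h Y w))"
proof -
  have M: "prob_space M" using X by (rule random_process_prob_space)
  interpret M: prob_space M by fact
  have ga: "integrable lborel (\<lambda>t. \<bar>g t\<bar>)" using g by auto
  have ha: "integrable lborel (\<lambda>t. \<bar>h t\<bar>)" using h by auto
  have gm: "g \<in> borel_measurable borel" "(\<lambda>t. \<bar>g t\<bar>) \<in> borel_measurable borel"
    using g by (auto dest: borel_measurable_integrable)
  have hm: "h \<in> borel_measurable borel" "(\<lambda>t. \<bar>h t\<bar>) \<in> borel_measurable borel"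
    using h by (auto dest: borel_measurable_integrable)
  have Xc: "random_process M (\<lambda>t w. \<bar>clip n (X t w)\<bar>)" for n
    using random_process_compose[OF X, of "\<lambda>x. \<bar>clip n x\<bar>"] by simp
  have Yc: "random_process M (\<lambda>t w. \<bar>clip n (Y t w)\<bar>)" for n
    using random_process_compose[OF Y, of "\<lambda>x. \<bar>clip n x\<bar>"] by simp
  have Xa: "random_process M (\<lambda>t w. \<bar>X t w\<bar>)" and Ya: "random_process M (\<lambda>t w. \<bar>Y t w\<bar>)"
    using random_process_compose[OF X, of abs] random_process_compose[OF Y, of abs] by simp_all
  note [measurable] = time_integral_measurable[OF X gm(1)] time_integral_measurable[OF Y hm(1)]
    time_integral_measurable[OF Xc gm(2)] time_integral_measurable[OF Yc hm(2)]
    time_integral_measurable[OF Xa gm(2)] time_integral_measurable[OF Ya hm(2)]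
    time_integral_measurable[OF random_process_compose[OF X clip_measurable] gm(1)]
    time_integral_measurable[OF random_process_compose[OF Y clip_measurable] hm(1)]
  let ?A = "\<lambda>n w. abs_time_integral g (clipped n X) w + abs_time_integral h (clipped n Y) w"
  let ?C = "(LINT w|M. exp (abs_time_integral g X w)) * (LINT w|M. exp (abs_time_integral h Y w))"
  have dom: "integrable M (\<lambda>w. exp (abs_time_integral g X w + abs_time_integral h Y w))"
  proof (rule integrable_exp_fatou(1))
    fix n
    have iXn: "integrable M (\<lambda>w. exp (abs_time_integral g (clipped n X) w))"
      by (rule integrable_exp_bounded[OF Xc _ ga, where c="real n"]) (simp add: abs_clip_le)
    have iYn: "integrable M (\<lambda>w. exp (abs_time_integral h (clipped n Y) w))"
      by (rule integrable_exp_bounded[OF Yc _ ha, where c="real n"]) (simp add: abs_clip_le)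
    show "integrable M (\<lambda>w. exp (?A n w))"
    proof (rule M.integrable_bounded)
      fix w assume w: "w \<in> space M"
      have "\<bar>abs_time_integral g (clipped n X) w\<bar> \<le> real n * (LINT t|lborel. \<bar>\<bar>g t\<bar>\<bar>)"
        by (rule time_integral_bounded[OF Xc _ ga w]) (simp add: abs_clip_le)
      moreover have "\<bar>abs_time_integral h (clipped n Y) w\<bar> \<le> real n * (LINT t|lborel. \<bar>\<bar>h t\<bar>\<bar>)"
        by (rule time_integral_bounded[OF Yc _ ha w]) (simp add: abs_clip_le)
      ultimately have "?A n w \<le> real n * (LINT t|lborel. \<bar>\<bar>g t\<bar>\<bar>) + real n * (LINT t|lborel. \<bar>\<bar>h t\<bar>\<bar>)"
        by linarith
      thus "\<bar>exp (?A n w)\<bar> \<le> exp (real n * (LINT t|lborel. \<bar>\<bar>g t\<bar>\<bar>) + real n * (LINT t|lborel. \<bar>\<bar>h t\<bar>\<bar>))"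
        by (simp only: abs_exp_cancel exp_le_cancel_iff)
    qed measurable
    have "independent_processes M (\<lambda>t w. \<bar>clip n (X t w)\<bar>) (\<lambda>t w. \<bar>clip n (Y t w)\<bar>)"
      using independent_processes_compose[OF M ind, of "\<lambda>x. \<bar>clip n x\<bar>"] by simp
    hence "(LINT w|M. exp (?A n w)) = (LINT w|M. exp (abs_time_integral g (clipped n X) w))
        * (LINT w|M. exp (abs_time_integral h (clipped n Y) w))"
      by (rule exp_indep_bounded[OF Xc Yc _ _ _ ga ha, where c="real n"]) (simp_all add: abs_clip_le)
    also have "\<dots> \<le> ?C"
    proof (rule mult_mono)
      show "(LINT w|M. exp (abs_time_integral g (clipped n X) w)) \<le> (LINT w|M. exp (abs_time_integral g X w))"
        using abs_time_integral_clip_le[OF X g mX]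
        by (intro integral_mono_AE iX iXn) (auto elim!: eventually_mono)
      show "(LINT w|M. exp (abs_time_integral h (clipped n Y) w)) \<le> (LINT w|M. exp (abs_time_integral h Y w))"
        using abs_time_integral_clip_le[OF Y h mY]
        by (intro integral_mono_AE iY iYn) (auto elim!: eventually_mono)
    qed simp_all
    finally show "(LINT w|M. exp (?A n w)) \<le> ?C" .
  next
    have "AE w in M. (\<lambda>n. abs_time_integral g (clipped n X) w) \<longlonglongrightarrow> abs_time_integral g X w"
      by (rule time_integral_truncation[OF X ga mX, of "\<lambda>n x. \<bar>clip n x\<bar>" abs])
         (auto simp: abs_clip_le tendsto_abs_clip)
    moreover have "AE w in M. (\<lambda>n. abs_time_integral h (clipped n Y) w) \<longlonglongrightarrow> abs_time_integral h Y w"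
      by (rule time_integral_truncation[OF Y ha mY, of "\<lambda>n x. \<bar>clip n x\<bar>" abs])
         (auto simp: abs_clip_le tendsto_abs_clip)
    ultimately show "AE w in M. (\<lambda>n. ?A n w) \<longlonglongrightarrow> abs_time_integral g X w + abs_time_integral h Y w"
      by eventually_elim (rule tendsto_add)
  qed measurable
  have ge: "time_integral g X w + time_integral h Y w \<le> abs_time_integral g X w + abs_time_integral h Y w" for w
    using abs_time_integral_ge[of g X w] abs_time_integral_ge[of h Y w] by linarith
  show "integrable M (\<lambda>w. exp (time_integral g X w + time_integral h Y w))"
    by (rule Bochner_Integration.integrable_bound[OF dom]) (auto intro!: AE_I2 ge)
  let ?B = "\<lambda>n w. time_integral g (clipped n X) w + time_integral h (clipped n Y) w"
  have lim: "(\<lambda>n. LINT w|M. exp (?B n w)) \<longlonglongrightarrow> (LINT w|M. exp (time_integral g X w + time_integral h Y w))"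
  proof (rule integral_dominated_convergence[OF _ _ dom])
    have "AE w in M. (\<lambda>n. time_integral g (clipped n X) w) \<longlonglongrightarrow> time_integral g X w"
      by (rule time_integral_truncation[OF X g mX, of clip "\<lambda>x. x"]) (auto simp: abs_clip_le tendsto_clip)
    moreover have "AE w in M. (\<lambda>n. time_integral h (clipped n Y) w) \<longlonglongrightarrow> time_integral h Y w"
      by (rule time_integral_truncation[OF Y h mY, of clip "\<lambda>x. x"]) (auto simp: abs_clip_le tendsto_clip)
    ultimately show "AE w in M. (\<lambda>n. exp (?B n w)) \<longlonglongrightarrow> exp (time_integral g X w + time_integral h Y w)"
      by eventually_elim (intro tendsto_exp tendsto_add)
    show "AE w in M. norm (exp (?B n w)) \<le> exp (abs_time_integral g X w + abs_time_integral h Y w)" for n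
      using abs_time_integral_clip_le[OF X g mX] abs_time_integral_clip_le[OF Y h mY]
    proof eventually_elim
      case (elim w)
      have "?B n w \<le> abs_time_integral g X w + abs_time_integral h Y w"
        using elim(1)[rule_format, of n] elim(2)[rule_format, of n]
          abs_time_integral_ge[of g "\<lambda>t w. clip n (X t w)" w]
          abs_time_integral_ge[of h "\<lambda>t w. clip n (Y t w)" w] by linarith
      thus ?case by (simp only: real_norm_def abs_exp_cancel exp_le_cancel_iff)
    qed
  qed measurable
  have "(LINT w|M. exp (?B n w)) = (LINT w|M. exp (time_integral g (clipped n X) w))
      * (LINT w|M. exp (time_integral h (clipped n Y) w))" for n
    by (rule exp_indep_bounded[OF random_process_compose[OF X clip_measurable]
          random_process_compose[OF Y clip_measurable]
          independent_processes_compose[OF M ind clip_measurable] abs_clip_le(2) abs_clip_le(2) g h])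
  hence "(\<lambda>n. LINT w|M. exp (?B n w)) \<longlonglongrightarrow>
      (LINT w|M. exp (time_integral g X w)) * (LINT w|M. exp (time_integral h Y w))"
    using tendsto_mult[OF exp_clip_tendsto(1)[OF X g mX iX] exp_clip_tendsto(1)[OF Y h mY iY]] by simp
  thus "(LINT w|M. exp (time_integral g X w + time_integral h Y w))
    = (LINT w|M. exp (time_integral g X w)) * (LINT w|M. exp (time_integral h Y w))"
    by (rule LIMSEQ_unique[OF lim])
qed


section \<open>Coupled processes\<close>

text \<open>The exponent in condition (c) of splittability.\<close>

definition coupling_deviation ::
    "(real \<Rightarrow> 'b \<Rightarrow> real) \<Rightarrow> (real \<Rightarrow> 'b \<Rightarrow> real) \<Rightarrow> (real \<Rightarrow> 'b \<Rightarrow> real) \<Rightarrow> 'b \<Rightarrow> ennreal" where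
  "coupling_deviation X0 Xm Xp w =
     (\<integral>\<^sup>+t\<in>{..0}. ennreal \<bar>Xm t w - X0 t w\<bar> \<partial>lborel) +
     (\<integral>\<^sup>+t\<in>{0..}. ennreal \<bar>Xp t w - X0 t w\<bar> \<partial>lborel)"

text \<open>These assumptions survive composition with a 1-Lipschitz function that fixes 0. So they hold also for
the truncations \<open>min \<bar>X\<bar> n\<close> that serve to prove the finiteness of exponential moments, with the same
constant \<open>\<tau>\<close> for all \<open>n\<close>.\<close>

locale coupled_process =
  fixes M :: "'a measure" and X :: "real \<Rightarrow> 'a \<Rightarrow> real"
    and N :: "'b measure" and X0 Xm Xp :: "real \<Rightarrow> 'b \<Rightarrow> real" and \<tau> :: real
  assumes X: "random_process M X" and stat: "stationary M X"
    and X0: "random_process N X0" and Xm: "random_process N Xm" and Xp: "random_process N Xp"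
    and indep: "independent_processes N Xm Xp"
    and id0: "identically_distributed M X N X0"
    and idm: "identically_distributed M X N Xm"
    and idp: "identically_distributed M X N Xp"
    and integrable_X0: "integrable M (X 0)"
    and coupling: "(\<integral>\<^sup>+w. exp_ennreal (coupling_deviation X0 Xm Xp w) \<partial>N) \<le> ennreal \<tau>"

lemma exp_ennreal_mono: "x \<le> y \<Longrightarrow> exp_ennreal x \<le> exp_ennreal y"
  by (auto simp: exp_ennreal_def top_unique less_top[symmetric] intro!: ennreal_leI enn2real_mono)

lemma exp_enn2real_le: "ennreal (exp (enn2real x)) \<le> exp_ennreal x"
  by (simp add: exp_ennreal_def)

lemma le_exp_ennreal: "x \<le> exp_ennreal x"
proof (cases "x = \<infinity>")
  case False
  then obtain r where r: "x = ennreal r" "r \<ge> 0" by (cases x) auto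
  have "r \<le> exp r" using exp_ge_add_one_self[of r] by linarith
  thus ?thesis using r by (simp add: exp_ennreal_def ennreal_leI)
qed (simp add: exp_ennreal_def)

lemma coupled_process_compose:
  assumes "coupled_process M X N X0 Xm Xp \<tau>"
    and \<psi>: "\<psi> \<in> borel_measurable borel" and lip: "\<And>x y. \<bar>\<psi> x - \<psi> y\<bar> \<le> \<bar>x - y\<bar>" and zero: "\<psi> 0 = 0"
  shows "coupled_process M (\<lambda>t w. \<psi> (X t w)) N (\<lambda>t w. \<psi> (X0 t w)) (\<lambda>t w. \<psi> (Xm t w)) (\<lambda>t w. \<psi> (Xp t w)) \<tau>"
proof -
  let ?dev = "coupling_deviation (\<lambda>t w. \<psi> (X0 t w)) (\<lambda>t w. \<psi> (Xm t w)) (\<lambda>t w. \<psi> (Xp t w))"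
  interpret coupled_process M X N X0 Xm Xp \<tau> by fact
  note [measurable] = \<psi> random_process_component[OF X]
  show ?thesis
  proof
    show "stationary M (\<lambda>t w. \<psi> (X t w))"
      unfolding stationary_def
    proof
      fix s show "identically_distributed M (\<lambda>t w. \<psi> (X (s + t) w)) M (\<lambda>t w. \<psi> (X t w))"
        using stat identically_distributed_compose[OF random_process_shift[OF X, of s] X _ \<psi>]
        by (simp add: stationary_def)
    qed
    show "integrable M (\<lambda>w. \<psi> (X 0 w))"
      by (rule Bochner_Integration.integrable_bound[OF integrable_X0]) (use lip[of _ 0] zero in auto)
    have "?dev w \<le> coupling_deviation X0 Xm Xp w" for w
      unfolding coupling_deviation_def
      by (intro add_mono nn_integral_mono mult_right_mono ennreal_leI lip) auto
    hence "(\<integral>\<^sup>+w. exp_ennreal (?dev w) \<partial>N) \<le> (\<integral>\<^sup>+w. exp_ennreal (coupling_deviation X0 Xm Xp w) \<partial>N)"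
      by (intro nn_integral_mono exp_ennreal_mono)
    also note coupling
    finally show "(\<integral>\<^sup>+w. exp_ennreal (?dev w) \<partial>N) \<le> ennreal \<tau>" .
    show "independent_processes N (\<lambda>t w. \<psi> (Xm t w)) (\<lambda>t w. \<psi> (Xp t w))"
      by (rule independent_processes_compose[OF random_process_prob_space[OF X0] indep \<psi>])
  qed (rule random_process_compose[OF _ \<psi>] identically_distributed_compose[OF _ _ _ \<psi>];
       fact X X0 Xm Xp id0 idm idp)+
qed

context coupled_process
begin

sublocale M: prob_space M using X by (rule random_process_prob_space)
sublocale N: prob_space N using X0 by (rule random_process_prob_space)

definition dev :: "'b \<Rightarrow> real" where
  "dev w = enn2real (coupling_deviation X0 Xm Xp w)"

lemma coupling_deviation_measurable [measurable]:
  "coupling_deviation X0 Xm Xp \<in> borel_measurable N"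
proof -
  note [measurable] = random_process_pair_measurable[OF X0] random_process_pair_measurable[OF Xm]
    random_process_pair_measurable[OF Xp]
  show ?thesis unfolding coupling_deviation_def by measurable
qed

lemma dev_measurable [measurable]: "dev \<in> borel_measurable N"
  unfolding dev_def by measurable

lemma dev_nonneg: "0 \<le> dev w" by (simp add: dev_def)

lemma coupling_deviation_finite: "AE w in N. coupling_deviation X0 Xm Xp w \<noteq> \<infinity>"
proof (rule nn_integral_PInf_AE)
  have "(\<integral>\<^sup>+w. coupling_deviation X0 Xm Xp w \<partial>N) \<le> (\<integral>\<^sup>+w. exp_ennreal (coupling_deviation X0 Xm Xp w) \<partial>N)"
    by (intro nn_integral_mono le_exp_ennreal)
  also note coupling
  finally show "(\<integral>\<^sup>+w. coupling_deviation X0 Xm Xp w \<partial>N) \<noteq> \<infinity>" by (auto simp: top_unique)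
qed simp

lemma exp_dev: "integrable N (\<lambda>w. exp (dev w))" "(LINT w|N. exp (dev w)) \<le> \<tau>" and tau_ge_1: "1 \<le> \<tau>"
proof -
  have "(\<integral>\<^sup>+w. ennreal (exp (dev w)) \<partial>N) \<le> (\<integral>\<^sup>+w. exp_ennreal (coupling_deviation X0 Xm Xp w) \<partial>N)"
    unfolding dev_def by (intro nn_integral_mono exp_enn2real_le)
  also note coupling
  finally have le: "(\<integral>\<^sup>+w. ennreal (exp (dev w)) \<partial>N) \<le> ennreal \<tau>" .
  show i: "integrable N (\<lambda>w. exp (dev w))"
    by (rule integrableI_bounded) (use le_less_trans[OF le] in auto)
  have "(1::ennreal) = (\<integral>\<^sup>+w. 1 \<partial>N)" by (simp add: N.emeasure_space_1)
  also have "\<dots> \<le> (\<integral>\<^sup>+w. ennreal (exp (dev w)) \<partial>N)"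
    by (intro nn_integral_mono) (simp add: dev_nonneg)
  also note le
  finally show t: "1 \<le> \<tau>" by simp
  show "(LINT w|N. exp (dev w)) \<le> \<tau>"
    using le t by (simp add: nn_integral_eq_integral[OF i] ennreal_le_iff)
qed

definition abs_mean :: real where "abs_mean = (LINT w|M. \<bar>X 0 w\<bar>)"

lemma id_shift: "identically_distributed M (\<lambda>t. X (s + t)) M X"
  using stat by (simp add: stationary_def)

lemma nn_integral_shift:
  assumes "f \<in> borel_measurable borel"
  shows "(\<integral>\<^sup>+w. f (X t w) \<partial>M) = (\<integral>\<^sup>+w. f (X 0 w) \<partial>M)"
  using nn_integral_component_eq[OF random_process_shift[OF X] X id_shift assms, of t 0] by simp

lemma first_moment: "abs_moment M X t \<le> ennreal abs_mean"
  using nn_integral_shift[of "\<lambda>x. ennreal \<bar>x\<bar>" t] nn_integral_eq_integral[OF integrable_abs[OF integrable_X0]]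
  by (simp add: abs_mean_def)

lemma first_moment_copy:
  assumes "random_process L Y" "identically_distributed M X L Y"
  shows "abs_moment L Y t \<le> ennreal abs_mean"
  using nn_integral_component_eq[OF X assms, of "\<lambda>x. ennreal \<bar>x\<bar>" t] first_moment[of t] by simp

lemma mean_copy:
  assumes "random_process L Y" "identically_distributed M X L Y"
  shows "(LINT w|L. Y t w) = (LINT w|M. X 0 w)"
  using integral_component_eq[OF X assms, of t]
    integral_component_eq[OF random_process_shift[OF X] X id_shift, of t 0] by simp

lemma mean_time_integral_copy:
  assumes Y: "random_process L Y" and id: "identically_distributed M X L Y" and g: "integrable lborel g"
  shows "integrable L (time_integral g Y)"
    and "(LINT w|L. time_integral g Y w) = (LINT t|lborel. g t) * (LINT w|M. X 0 w)"
  using time_integral_integrable[OF Y, of "\<lambda>_. 1" g abs_mean] time_integral_fubini[OF Y, of "\<lambda>_. 1" g abs_mean]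
    first_moment_copy[OF Y id] mean_copy[OF Y id] g by auto

definition exp_integrable :: "(real \<Rightarrow> real) \<Rightarrow> real \<Rightarrow> bool" where
  "exp_integrable g u \<longleftrightarrow> integrable M (\<lambda>w. exp (abs_time_integral g X w / u))"

definition K :: "(real \<Rightarrow> real) \<Rightarrow> real \<Rightarrow> real" where
  "K g u = scaled_cgf M (time_integral g X) u"

lemma exp_integrable_mono:
  assumes "exp_integrable g u" "0 < u" "u \<le> u'" and g: "integrable lborel g"
    and h[measurable]: "h \<in> borel_measurable borel" and le: "\<And>t. \<bar>h t\<bar> \<le> \<bar>g t\<bar>"
  shows "exp_integrable h u'"
  unfolding exp_integrable_def
proof (rule Bochner_Integration.integrable_bound)
  show "integrable M (\<lambda>w. exp (abs_time_integral g X w / u))"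
    using assms by (simp add: exp_integrable_def)
  have "random_process M (\<lambda>t w. \<bar>X t w\<bar>)" using random_process_compose[OF X, of abs] by simp
  note [measurable] = time_integral_measurable[OF this, of "\<lambda>t. \<bar>h t\<bar>"]
  show "(\<lambda>w. exp (abs_time_integral h X w / u')) \<in> borel_measurable M" by measurable
  show "AE w in M. norm (exp (abs_time_integral h X w / u')) \<le> norm (exp (abs_time_integral g X w / u))"
    using integrable_paths[OF X g first_moment]
  proof eventually_elim
    case (elim w)
    have i: "integrable lborel (\<lambda>t. \<bar>g t\<bar> * \<bar>X t w\<bar>)"
      using integrable_abs[OF elim] by (simp add: abs_mult)
    have "abs_time_integral h X w \<le> abs_time_integral g X w"
      unfolding time_integral_def
      by (intro integral_mono_AE' i) (auto intro!: mult_right_mono le)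
    moreover have "0 \<le> abs_time_integral g X w" unfolding time_integral_def by simp
    ultimately have "abs_time_integral h X w / u' \<le> abs_time_integral g X w / u"
      using assms by (intro frac_le) auto
    thus ?case by simp
  qed
qed

lemma exp_integrable_imp:
  assumes "exp_integrable g u" "0 < u" and g: "integrable lborel g"
  shows "integrable M (\<lambda>w. exp (time_integral g X w / u))"
proof -
  have gm: "g \<in> borel_measurable borel" using g by (auto dest: borel_measurable_integrable)
  note [measurable] = time_integral_measurable[OF X gm]
  have "integrable M (\<lambda>w. exp (abs_time_integral g X w / u))"
    using assms by (simp add: exp_integrable_def)
  thus ?thesis
  proof (rule Bochner_Integration.integrable_bound)
    show "AE w in M. norm (exp (time_integral g X w / u)) \<le> norm (exp (abs_time_integral g X w / u))"
      using assms(2) abs_time_integral_ge[of g X]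
      by (intro AE_I2) (auto intro!: divide_right_mono simp: abs_le_iff)
  qed simp
qed

text \<open>The coupling lives near time 0 of the auxiliary space; by stationarity an integral of \<open>X\<close> around any
\<open>c\<close> may be replaced by the shifted integral of a copy of \<open>X\<close> there.\<close>

lemma exp_copy_shift:
  assumes Y: "random_process L Y" and id: "identically_distributed M X L Y"
    and g: "integrable lborel g" and u: "0 < u" and e: "exp_integrable g u"
  shows "integrable L (\<lambda>w. exp (abs_time_integral (\<lambda>t. g (c + t) / u) Y w))"
    and "(LINT w|L. exp (time_integral (\<lambda>t. g (c + t)) Y w / u)) = (LINT w|M. exp (time_integral g X w / u))"
proof -
  let ?X = "\<lambda>t. X (c + t)" and ?g = "\<lambda>t. g (c + t) / u"
  have gc: "integrable lborel (\<lambda>t. g (c + t))"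
    using lborel_integrable_real_affine[OF g, of 1 c] by simp
  hence gu: "integrable lborel ?g" by auto
  have Xc: "random_process M ?X" by (rule random_process_shift[OF X])
  have idc: "identically_distributed M ?X L Y"
    using identically_distributed_trans[OF id_shift id] .
  have "abs_time_integral ?g ?X w = abs_time_integral g X w / u" for w
    using abs_time_integral_divide[OF u, of "\<lambda>t. g (c + t)" ?X w]
      time_integral_shift[of "\<lambda>t. \<bar>g t\<bar>" "\<lambda>t w. \<bar>X t w\<bar>" w c] by simp
  hence i: "integrable M (\<lambda>w. exp (abs_time_integral ?g ?X w))"
    using e by (simp add: exp_integrable_def)
  show "integrable L (\<lambda>w. exp (abs_time_integral ?g Y w))"
    by (rule integrable_exp_transfer[OF Xc Y idc gu first_moment i])
  have "(LINT w|L. exp (time_integral ?g Y w)) = (LINT w|M. exp (time_integral ?g ?X w))"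
    by (rule exp_transfer[OF Xc Y idc gu first_moment i, symmetric])
  thus "(LINT w|L. exp (time_integral (\<lambda>t. g (c + t)) Y w / u)) = (LINT w|M. exp (time_integral g X w / u))"
    by (simp add: time_integral_divide time_integral_shift[of g X _ c])
qed

lemma K_shift:
  assumes g: "integrable lborel g" and u: "0 < u" and e: "exp_integrable g u"
  shows "K (\<lambda>t. g (c + t)) u = K g u"
proof -
  have "identically_distributed M X M X" by (simp add: identically_distributed_def)
  from exp_copy_shift(2)[OF X this g u e, of c] show ?thesis by (simp add: K_def scaled_cgf_def)
qed

text \<open>On the auxiliary space, \<open>P\<close> is the integral over the whole window and \<open>Q\<close> the sum of two independent
integrals with the laws of its two halves. Since \<open>\<bar>g\<bar> \<le> 1\<close>, they differ by at most the deviation of the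
coupling. The difference has mean zero, as both means are the mean of \<open>X 0\<close> times
\<open>\<integral> g\<close>.\<close>

lemma coupling_step:
  fixes g :: "real \<Rightarrow> real" and c :: real
  defines "P \<equiv> time_integral (\<lambda>t. g (c + t)) X0"
    and "Q \<equiv> (\<lambda>w. time_integral (\<lambda>t. indicator {..<c} (c + t) * g (c + t)) Xm w
                + time_integral (\<lambda>t. indicator {c..} (c + t) * g (c + t)) Xp w)"
  assumes g: "integrable lborel g" and g1: "\<And>t. \<bar>g t\<bar> \<le> 1"
  shows "P \<in> borel_measurable N" "Q \<in> borel_measurable N"
    and "AE w in N. \<bar>P w - Q w\<bar> \<le> dev w"
    and "(LINT w|N. P w - Q w) = 0"
    and "\<And>u. 0 < u \<Longrightarrow> exp_integrable g u \<Longrightarrow> integrable N (\<lambda>w. exp (P w / u))"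
    and "\<And>u. 0 < u \<Longrightarrow> exp_integrable g u \<Longrightarrow> scaled_cgf N P u = K g u"
    and "\<And>u. 0 < u \<Longrightarrow> exp_integrable g u \<Longrightarrow> integrable N (\<lambda>w. exp (Q w / u))"
    and "\<And>u. 0 < u \<Longrightarrow> exp_integrable g u \<Longrightarrow> scaled_cgf N Q u
      = K (\<lambda>t. indicator {..<c} t * g t) u + K (\<lambda>t. indicator {c..} t * g t) u"
proof -
  define k where "k t = g (c + t)" for t
  define gm where "gm t = indicator {..<c} t * g t" for t
  define gp where "gp t = indicator {c..} t * g t" for t
  have k: "integrable lborel k"
    using lborel_integrable_real_affine[OF g, of 1 c] by (simp add: k_def[abs_def])
  have [measurable]: "g \<in> borel_measurable borel" "k \<in> borel_measurable borel"
    using g k by (auto dest: borel_measurable_integrable)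
  have gmi: "integrable lborel gm" and gpi: "integrable lborel gp"
    unfolding gm_def[abs_def] gp_def[abs_def]
    by (auto intro!: Bochner_Integration.integrable_bound[OF g] simp: indicator_def)
  have [measurable]: "gm \<in> borel_measurable borel" "gp \<in> borel_measurable borel"
    using gmi gpi by (auto dest: borel_measurable_integrable)
  define A where "A = time_integral (\<lambda>t. gm (c + t)) Xm"
  define B where "B = time_integral (\<lambda>t. gp (c + t)) Xp"
  have Q: "Q = (\<lambda>w. A w + B w)" unfolding Q_def A_def B_def gm_def gp_def ..
  have P: "P = time_integral k X0" unfolding P_def k_def ..
  have cm: "integrable lborel (\<lambda>t. gm (c + t))"
    using lborel_integrable_real_affine[OF gmi, of 1 c] by simp
  have cp: "integrable lborel (\<lambda>t. gp (c + t))"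
    using lborel_integrable_real_affine[OF gpi, of 1 c] by simp
  have Pm[measurable]: "P \<in> borel_measurable N" unfolding P by (intro time_integral_measurable X0) simp
  have [measurable]: "A \<in> borel_measurable N" unfolding A_def by (intro time_integral_measurable Xm) simp
  have [measurable]: "B \<in> borel_measurable N" unfolding B_def by (intro time_integral_measurable Xp) simp
  show "P \<in> borel_measurable N" by fact
  show "Q \<in> borel_measurable N" unfolding Q by simp
  have ksplit: "k t = gm (c + t) + gp (c + t)" for t by (auto simp: k_def gm_def gp_def indicator_def)
  have "(LINT w|N. P w - Q w) = (LINT w|N. P w) - ((LINT w|N. A w) + (LINT w|N. B w))"
    unfolding Q P A_def B_def
    using mean_time_integral_copy(1)[OF X0 id0 k] mean_time_integral_copy(1)[OF Xm idm cm]
      mean_time_integral_copy(1)[OF Xp idp cp] by simp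
  also have "\<dots> = ((LINT t|lborel. k t) - ((LINT t|lborel. gm (c + t)) + (LINT t|lborel. gp (c + t))))
      * (LINT w|M. X 0 w)"
    unfolding P A_def B_def mean_time_integral_copy(2)[OF X0 id0 k]
      mean_time_integral_copy(2)[OF Xm idm cm] mean_time_integral_copy(2)[OF Xp idp cp]
    by (simp add: algebra_simps)
  also have "\<dots> = 0" unfolding ksplit using cm cp by simp
  finally show "(LINT w|N. P w - Q w) = 0" .
  show "AE w in N. \<bar>P w - Q w\<bar> \<le> dev w"
  proof -
    have "AE w in N. w \<in> space N" by simp
    with integrable_paths[OF X0 k first_moment_copy[OF X0 id0]]
      integrable_paths[OF Xm cm first_moment_copy[OF Xm idm]]
      integrable_paths[OF Xp cp first_moment_copy[OF Xp idp]] coupling_deviation_finite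
    show ?thesis
    proof eventually_elim
      case (elim w)
      note [measurable] = random_process_path[OF X0 elim(5)] random_process_path[OF Xm elim(5)]
        random_process_path[OF Xp elim(5)]
      let ?d = "\<lambda>t. k t * X0 t w - gm (c + t) * Xm t w - gp (c + t) * Xp t w"
      have id: "integrable lborel ?d" using elim by auto
      have eq: "P w - Q w = (LINT t|lborel. ?d t)"
        unfolding P Q A_def B_def time_integral_def using elim by simp
      have pt: "ennreal \<bar>?d t\<bar> \<le> ennreal \<bar>Xm t w - X0 t w\<bar> * indicator {..0} t
          + ennreal \<bar>Xp t w - X0 t w\<bar> * indicator {0..} t" for t
      proof (cases "t < 0")
        case True
        have "?d t = g (c + t) * (X0 t w - Xm t w)"
          using True by (simp add: k_def gm_def gp_def algebra_simps)
        hence "\<bar>?d t\<bar> \<le> 1 * \<bar>Xm t w - X0 t w\<bar>"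
          using mult_right_mono[OF g1[of "c + t"], of "\<bar>Xm t w - X0 t w\<bar>"]
          by (simp add: abs_mult abs_minus_commute)
        thus ?thesis using True by (simp add: ennreal_leI)
      next
        case False
        have "?d t = g (c + t) * (X0 t w - Xp t w)"
          using False by (simp add: k_def gm_def gp_def algebra_simps)
        hence "\<bar>?d t\<bar> \<le> 1 * \<bar>Xp t w - X0 t w\<bar>"
          using mult_right_mono[OF g1[of "c + t"], of "\<bar>Xp t w - X0 t w\<bar>"]
          by (simp add: abs_mult abs_minus_commute)
        hence "ennreal \<bar>?d t\<bar> \<le> ennreal \<bar>Xp t w - X0 t w\<bar> * indicator {0..} t"
          using False by (simp add: ennreal_leI)
        thus ?thesis by (rule order_trans) simp
      qed
      have "ennreal \<bar>P w - Q w\<bar> \<le> (\<integral>\<^sup>+t. ennreal \<bar>?d t\<bar> \<partial>lborel)"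
        unfolding eq using integral_norm_bound_ennreal[OF id] by simp
      also have "\<dots> \<le> (\<integral>\<^sup>+t. ennreal \<bar>Xm t w - X0 t w\<bar> * indicator {..0} t
          + ennreal \<bar>Xp t w - X0 t w\<bar> * indicator {0..} t \<partial>lborel)"
        by (intro nn_integral_mono pt)
      also have "\<dots> = coupling_deviation X0 Xm Xp w"
        unfolding coupling_deviation_def by (rule nn_integral_add) auto
      also have "\<dots> = ennreal (dev w)"
        unfolding dev_def using elim(4) by (simp add: less_top)
      finally show ?case using dev_nonneg[of w] by (simp add: ennreal_le_iff)
    qed
  qed
  fix u :: real assume u: "0 < u" and e: "exp_integrable g u"
  have em: "exp_integrable gm u"
    by (rule exp_integrable_mono[OF e u order_refl g]) (auto simp: gm_def indicator_def)
  have ep: "exp_integrable gp u"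
    by (rule exp_integrable_mono[OF e u order_refl g]) (auto simp: gp_def indicator_def)
  note e0 = exp_copy_shift[OF X0 id0 g u e, of c]
  note em' = exp_copy_shift[OF Xm idm gmi u em, of c]
  note ep' = exp_copy_shift[OF Xp idp gpi u ep, of c]
  have ku: "integrable lborel (\<lambda>t. g (c + t) / u)" using k by (simp add: k_def[abs_def])
  show "integrable N (\<lambda>w. exp (P w / u))"
    using exp_clip_tendsto(2)[OF X0 ku first_moment_copy[OF X0 id0] e0(1)]
    by (simp add: P_def time_integral_divide)
  show "scaled_cgf N P u = K g u"
    using e0(2) by (simp add: scaled_cgf_def K_def P_def)
  have cmu: "integrable lborel (\<lambda>t. gm (c + t) / u)" and cpu: "integrable lborel (\<lambda>t. gp (c + t) / u)"
    using cm cp by auto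
  note ind = exp_indep[OF Xm Xp indep cmu cpu first_moment_copy[OF Xm idm] first_moment_copy[OF Xp idp] em'(1) ep'(1)]
  have Qu: "Q w / u = time_integral (\<lambda>t. gm (c + t) / u) Xm w + time_integral (\<lambda>t. gp (c + t) / u) Xp w" for w
    by (simp add: Q A_def B_def time_integral_divide add_divide_distrib)
  show "integrable N (\<lambda>w. exp (Q w / u))" unfolding Qu by (rule ind(1))
  have "(LINT w|N. exp (Q w / u)) = (LINT w|M. exp (time_integral gm X w / u)) * (LINT w|M. exp (time_integral gp X w / u))"
    unfolding Qu ind(2) using em'(2) ep'(2) by (simp add: time_integral_divide)
  moreover have "0 < (LINT w|M. exp (time_integral gm X w / u))"
    by (rule M.integral_exp_pos[OF exp_integrable_imp[OF em u gmi]])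
  moreover have "0 < (LINT w|M. exp (time_integral gp X w / u))"
    by (rule M.integral_exp_pos[OF exp_integrable_imp[OF ep u gpi]])
  ultimately have "scaled_cgf N Q u = K gm u + K gp u"
    unfolding scaled_cgf_def K_def by (simp add: ln_mult distrib_left)
  thus "scaled_cgf N Q u = K (\<lambda>t. indicator {..<c} t * g t) u + K (\<lambda>t. indicator {c..} t * g t) u"
    by (simp add: gm_def[abs_def] gp_def[abs_def])
qed

text \<open>For a centred \<open>D\<close> the generating function has no linear term; this is what makes the bound decay in
\<open>v\<close>, instead of staying of constant order.\<close>

lemma deviation_cgf:
  assumes [measurable]: "D \<in> borel_measurable N" and D: "AE w in N. \<bar>D w\<bar> \<le> dev w"
    and D0: "(LINT w|N. D w) = 0" and v: "2 \<le> v"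
  shows "integrable N (\<lambda>w. exp (D w / v))" and "scaled_cgf N D v \<le> 12 * \<tau>\<^sup>2 / v"
proof -
  have D': "AE w in N. \<bar>D w\<bar> \<le> 1 * dev w" using D by simp
  note * = N.scaled_cgf_expansion[OF assms(1) dev_measurable D' dev_nonneg _ exp_dev D0, of v]
  show "integrable N (\<lambda>w. exp (D w / v))" using * v by simp
  have a: "(LINT w|N. (D w)\<^sup>2) \<le> 2 * \<tau>" using *(3) v by simp
  have b: "scaled_cgf N D v \<le> (LINT w|N. (D w)\<^sup>2) / (2 * v) + 21 * \<tau>\<^sup>2 / v\<^sup>2"
    using *(5) v by (simp add: abs_le_iff)
  have "\<tau> \<le> \<tau>\<^sup>2" using tau_ge_1 by (simp add: power2_eq_square)
  hence "(LINT w|N. (D w)\<^sup>2) / (2 * v) \<le> (2 * \<tau>\<^sup>2) / (2 * v)"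
    using a v by (intro divide_right_mono) auto
  moreover have "21 * \<tau>\<^sup>2 / v\<^sup>2 \<le> 11 * \<tau>\<^sup>2 / v"
  proof -
    have "21 * \<tau>\<^sup>2 / v\<^sup>2 = (21 / v) * (\<tau>\<^sup>2 / v)" by (simp add: power2_eq_square)
    also have "\<dots> \<le> 11 * (\<tau>\<^sup>2 / v)" using v by (intro mult_right_mono) (auto simp: field_simps)
    finally show ?thesis by simp
  qed
  ultimately have "scaled_cgf N D v \<le> (2 * \<tau>\<^sup>2) / (2 * v) + 11 * \<tau>\<^sup>2 / v" using b by linarith
  also have "\<dots> = 12 * \<tau>\<^sup>2 / v" using v by (simp add: field_simps)
  finally show "scaled_cgf N D v \<le> 12 * \<tau>\<^sup>2 / v" .
qed

text \<open>Both inequalities are \<open>K\<^sub>Y\<^sub>+\<^sub>Z(u + v) \<le> K\<^sub>Y(u) + K\<^sub>Z(v)\<close>, applied to \<open>P = Q + (P - Q)\<close> and to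
\<open>Q = P + (Q - P)\<close> with \<open>P\<close> and \<open>Q\<close> from \<open>coupling_step\<close>.\<close>

lemma K_split:
  assumes g: "integrable lborel g" and g1: "\<And>t. \<bar>g t\<bar> \<le> 1"
    and u: "0 < u" and v: "2 \<le> v" and e: "exp_integrable g u"
  shows K_split_upper: "K g (u + v) \<le> K (\<lambda>t. indicator {..<c} t * g t) u
      + K (\<lambda>t. indicator {c..} t * g t) u + 12 * \<tau>\<^sup>2 / v"
    and K_split_lower: "K (\<lambda>t. indicator {..<c} t * g t) (u + v)
      + K (\<lambda>t. indicator {c..} t * g t) (u + v) \<le> K g u + 12 * \<tau>\<^sup>2 / v"
proof -
  define P where "P = time_integral (\<lambda>t. g (c + t)) X0"
  define Q where "Q w = time_integral (\<lambda>t. indicator {..<c} (c + t) * g (c + t)) Xm w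
                + time_integral (\<lambda>t. indicator {c..} (c + t) * g (c + t)) Xp w" for w
  note st = coupling_step[OF g g1, where c=c, folded P_def Q_def]
  note [measurable] = st(1,2)
  have gm: "g \<in> borel_measurable borel" using g by (auto dest: borel_measurable_integrable)
  have uv: "0 < u + v" "u \<le> u + v" using u v by auto
  have e': "exp_integrable g (u + v)" by (rule exp_integrable_mono[OF e u uv(2) g gm]) simp
  define D where "D w = P w - Q w" for w
  define E where "E w = Q w - P w" for w
  have [measurable]: "D \<in> borel_measurable N" "E \<in> borel_measurable N"
    unfolding D_def E_def by measurable
  have dD: "AE w in N. \<bar>D w\<bar> \<le> dev w" using st(3) by (simp add: D_def)
  have dE: "AE w in N. \<bar>E w\<bar> \<le> dev w" using st(3) by (simp add: E_def abs_minus_commute)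
  have D0: "(LINT w|N. D w) = 0" using st(4) by (simp add: D_def)
  have "(LINT w|N. E w) = (LINT w|N. - (P w - Q w))" by (simp add: E_def)
  also have "\<dots> = 0" unfolding integral_minus using st(4) by simp
  finally have E0: "(LINT w|N. E w) = 0" .
  have v0: "0 < v" using v by simp
  have "scaled_cgf N (\<lambda>w. Q w + D w) (u + v) \<le> scaled_cgf N Q u + scaled_cgf N D v"
    by (rule N.scaled_cgf_add_le[OF _ _ st(7)[OF u e] deviation_cgf(1)[OF _ dD D0 v] u v0]) simp_all
  also have "(\<lambda>w. Q w + D w) = P" by (simp add: D_def)
  finally show "K g (u + v) \<le> K (\<lambda>t. indicator {..<c} t * g t) u
      + K (\<lambda>t. indicator {c..} t * g t) u + 12 * \<tau>\<^sup>2 / v"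
    using st(6)[OF uv(1) e'] st(8)[OF u e] deviation_cgf(2)[OF _ dD D0 v] by simp
  have "scaled_cgf N (\<lambda>w. P w + E w) (u + v) \<le> scaled_cgf N P u + scaled_cgf N E v"
    by (rule N.scaled_cgf_add_le[OF _ _ st(5)[OF u e] deviation_cgf(1)[OF _ dE E0 v] u v0]) simp_all
  also have "(\<lambda>w. P w + E w) = Q" by (simp add: E_def)
  finally show "K (\<lambda>t. indicator {..<c} t * g t) (u + v)
      + K (\<lambda>t. indicator {c..} t * g t) (u + v) \<le> K g u + 12 * \<tau>\<^sup>2 / v"
    using st(8)[OF uv(1) e'] st(6)[OF u e] deviation_cgf(2)[OF _ dE E0 v] by simp
qed

end


section \<open>Dyadic decomposition\<close>

definition window :: "real \<Rightarrow> real \<Rightarrow> (real \<Rightarrow> real) \<Rightarrow> real \<Rightarrow> real" where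
  "window a b g t = indicator {a..<b} t * g t"

lemma window_measurable [measurable]:
  "g \<in> borel_measurable borel \<Longrightarrow> window a b g \<in> borel_measurable borel"
  unfolding window_def[abs_def] by measurable

lemma window_abs_le_1: "(\<And>t. \<bar>g t\<bar> \<le> 1) \<Longrightarrow> \<bar>window a b g t\<bar> \<le> 1"
  by (auto simp: window_def indicator_def)

lemma window_integrable:
  assumes [measurable]: "g \<in> borel_measurable borel" and g: "\<And>t. \<bar>g t\<bar> \<le> 1"
  shows "integrable lborel (window a b g)"
proof (rule Bochner_Integration.integrable_bound)
  show "integrable lborel (indicator {a..<b} :: real \<Rightarrow> real)"
    by (cases "a \<le> b") (auto intro!: integrable_real_indicator)
  show "AE t in lborel. norm (window a b g t) \<le> norm (indicator {a..<b} t :: real)"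
    using g by (auto simp: window_def indicator_def)
qed simp

lemma window_left: "c \<le> b \<Longrightarrow> (\<lambda>t. indicator {..<c} t * window a b g t) = window a c g"
  by (auto simp: window_def indicator_def fun_eq_iff)

lemma window_right: "a \<le> c \<Longrightarrow> (\<lambda>t. indicator {c..} t * window a b g t) = window c b g"
  by (auto simp: window_def indicator_def fun_eq_iff)

abbreviation block :: "real \<Rightarrow> real \<Rightarrow> nat \<Rightarrow> (real \<Rightarrow> real) \<Rightarrow> real \<Rightarrow> real" where
  "block s L i \<equiv> window (s + real i * L) (s + real (Suc i) * L)"

lemma sum_lessThan_double: "(\<Sum>i<m + n. f i) = (\<Sum>i<m. f i) + (\<Sum>i<n. f (m + i :: nat) :: real)"
  by (induction n) (auto simp: algebra_simps)

text \<open>The sum of \<open>2^(k-1-j) / v j\<close> over \<open>j < k\<close>: at level \<open>j\<close> there are \<open>2^(k-1-j)\<close> cuts, each of cost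
proportional to \<open>1 / v j\<close>.\<close>

definition split_error :: "(nat \<Rightarrow> real) \<Rightarrow> nat \<Rightarrow> real" where
  "split_error v k = 2 ^ k * (\<Sum>j<k. 1 / (2 ^ Suc j * v j))"

lemma split_error_Suc: "v k > 0 \<Longrightarrow> split_error v (Suc k) = 2 * split_error v k + 1 / v k"
  by (simp add: split_error_def algebra_simps)

context coupled_process
begin

lemma exp_integrable_window:
  assumes g: "g \<in> borel_measurable borel" "\<And>t. \<bar>g t\<bar> \<le> 1"
    and e: "exp_integrable (window a b g) u" "0 < u" "u \<le> u'" and s: "a \<le> a'" "b' \<le> b"
  shows "exp_integrable (window a' b' g) u'"
  by (rule exp_integrable_mono[OF e window_integrable[OF g]])
     (use g s in \<open>auto simp: window_def indicator_def\<close>)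

text \<open>Induction on the number of levels: the window is cut in the middle, and the two halves are treated at
the same argument. The shift \<open>v k\<close> of the coarsest cut is spent first.\<close>

lemma K_dyadic_upper:
  assumes g: "g \<in> borel_measurable borel" "\<And>t. \<bar>g t\<bar> \<le> 1" and L: "0 < L" and u: "0 < u"
    and v: "\<And>j. 2 \<le> v j"
  shows "exp_integrable (window s (s + 2 ^ k * L) g) u \<Longrightarrow>
    K (window s (s + 2 ^ k * L) g) (u + (\<Sum>j<k. v j))
      \<le> (\<Sum>i<2^k. K (block s L i g) u) + 12 * \<tau>\<^sup>2 * split_error v k"
proof (induction k arbitrary: s)
  case 0
  then show ?case by (simp add: split_error_def)
next
  case (Suc k)
  define c where "c = s + 2 ^ k * L"
  define b where "b = s + 2 ^ Suc k * L"
  have b: "b = c + 2 ^ k * L" unfolding b_def c_def by (simp add: algebra_simps)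
  have sc: "s \<le> c" "c \<le> b" using L by (auto simp: c_def b)
  have vk: "v k > 0" using v[of k] by linarith
  have v0: "0 \<le> v j" for j using v[of j] by linarith
  define u' where "u' = u + (\<Sum>j<k. v j)"
  have u': "u \<le> u'" "0 < u'" unfolding u'_def using u v0 by (auto intro: sum_nonneg add_pos_nonneg)
  have e: "exp_integrable (window s b g) u" using Suc.prems by (simp only: b_def)
  have e': "exp_integrable (window s b g) u'"
    by (rule exp_integrable_window[OF g e u u'(1)]) auto
  have "K (window s b g) (u' + v k) \<le> K (window s c g) u' + K (window c b g) u' + 12 * \<tau>\<^sup>2 / v k"
    using K_split_upper[OF window_integrable[OF g] window_abs_le_1[OF g(2)] u'(2) v e', where c=c]
    unfolding window_left[OF sc(2)] window_right[OF sc(1)] .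
  also have "K (window s c g) u' \<le> (\<Sum>i<2^k. K (block s L i g) u)
      + 12 * \<tau>\<^sup>2 * split_error v k"
    unfolding c_def u'_def
    by (rule Suc.IH) (rule exp_integrable_window[OF g e u order_refl], use sc in \<open>auto simp: c_def\<close>)
  also have "K (window c b g) u' \<le> (\<Sum>i<2^k. K (block c L i g) u)
      + 12 * \<tau>\<^sup>2 * split_error v k"
    unfolding b u'_def
    by (rule Suc.IH) (rule exp_integrable_window[OF g e u order_refl], use sc in \<open>auto simp: b\<close>)
  also have "(\<Sum>i<2^k. K (block c L i g) u)
      = (\<Sum>i<2^k. K (block s L (2 ^ k + i) g) u)"
    by (simp add: c_def algebra_simps)
  finally have "K (window s b g) (u' + v k)
      \<le> (\<Sum>i<2^k + 2^k. K (block s L i g) u)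
        + 12 * \<tau>\<^sup>2 * split_error v (Suc k)"
    unfolding sum_lessThan_double split_error_Suc[where v=v and k=k, OF vk] by (simp add: algebra_simps)
  moreover have "u' + v k = u + (\<Sum>j<Suc k. v j)" by (simp add: u'_def)
  moreover have "(2::nat) ^ k + 2 ^ k = 2 ^ Suc k" by simp
  ultimately show ?case unfolding b_def by (simp only:)
qed

lemma K_dyadic_lower:
  assumes g: "g \<in> borel_measurable borel" "\<And>t. \<bar>g t\<bar> \<le> 1" and L: "0 < L"
    and v: "\<And>j. 2 \<le> v j"
  shows "0 < u \<Longrightarrow> exp_integrable (window s (s + 2 ^ k * L) g) u \<Longrightarrow>
    (\<Sum>i<2^k. K (block s L i g) (u + (\<Sum>j<k. v j)))
      \<le> K (window s (s + 2 ^ k * L) g) u + 12 * \<tau>\<^sup>2 * split_error v k"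
proof (induction k arbitrary: s u)
  case 0
  then show ?case by (simp add: split_error_def)
next
  case (Suc k)
  define c where "c = s + 2 ^ k * L"
  define b where "b = s + 2 ^ Suc k * L"
  have b: "b = c + 2 ^ k * L" unfolding b_def c_def by (simp add: algebra_simps)
  have sc: "s \<le> c" "c \<le> b" using L by (auto simp: c_def b)
  have vk: "v k > 0" using v[of k] by linarith
  define u' where "u' = u + v k"
  have u: "0 < u" and u': "u \<le> u'" "0 < u'" using Suc.prems(1) vk by (auto simp: u'_def)
  have e: "exp_integrable (window s b g) u" using Suc.prems by (simp only: b_def)
  let ?w = "u' + (\<Sum>j<k. v j)"
  have "(\<Sum>i<2^k. K (block s L i g) ?w)
      \<le> K (window s c g) u' + 12 * \<tau>\<^sup>2 * split_error v k"
    unfolding c_def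
    by (rule Suc.IH[OF u'(2)]) (rule exp_integrable_window[OF g e u u'(1)], use sc in \<open>auto simp: c_def\<close>)
  moreover have "(\<Sum>i<2^k. K (block c L i g) ?w)
      \<le> K (window c b g) u' + 12 * \<tau>\<^sup>2 * split_error v k"
    unfolding b
    by (rule Suc.IH[OF u'(2)]) (rule exp_integrable_window[OF g e u u'(1)], use sc in \<open>auto simp: b\<close>)
  moreover have "(\<Sum>i<2^k. K (block c L i g) ?w)
      = (\<Sum>i<2^k. K (block s L (2 ^ k + i) g) ?w)"
    by (simp add: c_def algebra_simps)
  moreover have "K (window s c g) u' + K (window c b g) u' \<le> K (window s b g) u + 12 * \<tau>\<^sup>2 / v k"
    using K_split_lower[OF window_integrable[OF g] window_abs_le_1[OF g(2)] u v e, where c=c]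
    unfolding window_left[OF sc(2)] window_right[OF sc(1)] u'_def .
  ultimately have "(\<Sum>i<2^k + 2^k. K (block s L i g) ?w)
      \<le> K (window s b g) u + 12 * \<tau>\<^sup>2 * split_error v (Suc k)"
    unfolding sum_lessThan_double split_error_Suc[where v=v and k=k, OF vk] by (simp add: algebra_simps)
  moreover have "?w = u + (\<Sum>j<Suc k. v j)" by (simp add: u'_def)
  moreover have "(2::nat) ^ k + 2 ^ k = 2 ^ Suc k" by simp
  ultimately show ?case unfolding b_def by (simp only:)
qed

subsection \<open>Exponential moments of a single block\<close>

lemma integral_indicator_window: "0 \<le> L \<Longrightarrow> (LINT t|lborel. window s (s + L) (\<lambda>_. 1) t) = L"
  unfolding window_def by simp

text \<open>Jensen's inequality for the average of \<open>\<bar>X t\<bar>\<close> over the block, pathwise, followed by Fubini's theorem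
and stationarity. This is the reason for the argument \<open>u = L\<close>.\<close>

lemma block_exp_moment:
  assumes ex: "integrable M (\<lambda>w. exp \<bar>X 0 w\<bar>)" and \<gamma>: "(LINT w|M. exp \<bar>X 0 w\<bar>) \<le> \<gamma>"
    and g: "g \<in> borel_measurable borel" "\<And>t. \<bar>g t\<bar> \<le> 1" and L: "0 < L"
  shows "exp_integrable (window s (s + L) g) L"
    and "(LINT w|M. exp (abs_time_integral (window s (s + L) g) X w / L)) \<le> \<gamma>"
proof -
  let ?w = "window s (s + L) (\<lambda>_. 1)"
  let ?E = "\<lambda>t w. exp \<bar>X t w\<bar>"
  have w: "integrable lborel ?w" by (rule window_integrable) auto
  have E: "random_process M ?E" using random_process_compose[OF X, of "\<lambda>x. exp \<bar>x\<bar>"] by simp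
  have Xa: "random_process M (\<lambda>t w. \<bar>X t w\<bar>)" using random_process_compose[OF X, of abs] by simp
  have nE: "(\<integral>\<^sup>+w. ennreal \<bar>?E t w\<bar> \<partial>M) \<le> ennreal \<gamma>" for t
  proof -
    have "(\<integral>\<^sup>+w. ennreal \<bar>?E t w\<bar> \<partial>M) = (\<integral>\<^sup>+w. ennreal (exp \<bar>X 0 w\<bar>) \<partial>M)"
      using nn_integral_shift[of "\<lambda>x. ennreal (exp \<bar>x\<bar>)" t] by simp
    also have "\<dots> = ennreal (LINT w|M. exp \<bar>X 0 w\<bar>)" using ex by (simp add: nn_integral_eq_integral)
    finally show ?thesis using \<gamma> by (simp add: ennreal_leI)
  qed
  have "0 \<le> (LINT w|M. exp \<bar>X 0 w\<bar>)" by simp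
  hence \<gamma>0: "0 \<le> \<gamma>" using \<gamma> by linarith
  have IE: "(LINT w|M. ?E t w) \<le> \<gamma>" for t
  proof -
    have i: "integrable M (?E t)"
      by (rule integrableI_bounded) (use random_process_component[OF E, of t] le_less_trans[OF nE[of t]] in auto)
    show ?thesis using \<gamma>0 nE[of t] by (simp add: nn_integral_eq_integral[OF i] ennreal_le_iff)
  qed
  have J: "integrable M (\<lambda>w. time_integral ?w ?E w / L)"
    using time_integral_integrable[OF E, of "\<lambda>_. 1" ?w \<gamma>] nE w by simp
  have "(LINT w|M. time_integral ?w ?E w) = (LINT t|lborel. ?w t * (LINT w|M. ?E t w))"
    using time_integral_fubini[OF E, of "\<lambda>_. 1" ?w \<gamma>] nE w by simp
  also have "\<dots> \<le> (LINT t|lborel. ?w t * \<gamma>)"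
  proof (rule integral_mono_AE')
    show "integrable lborel (\<lambda>t. ?w t * \<gamma>)" using w by (rule integrable_mult_left)
  qed (auto simp: window_def \<gamma>0 intro!: AE_I2 mult_left_mono IE)
  also have "\<dots> = L * \<gamma>" using integral_indicator_window[of L s] L by simp
  finally have JL: "(LINT w|M. time_integral ?w ?E w / L) \<le> \<gamma>" using L by (simp add: field_simps)
  have gm: "(\<lambda>t. \<bar>window s (s + L) g t\<bar>) \<in> borel_measurable borel"
    using g by measurable
  note [measurable] = time_integral_measurable[OF Xa gm]
  have le: "AE w in M. exp (abs_time_integral (window s (s + L) g) X w / L) \<le> time_integral ?w ?E w / L"
    using integrable_paths[OF X w first_moment] integrable_paths[OF E w nE]
  proof eventually_elim
    case (elim w)
    define z where "z = (LINT t|lborel. ?w t * \<bar>X t w\<bar>) / L"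
    have i: "integrable lborel (\<lambda>t. ?w t * \<bar>X t w\<bar>)"
      using integrable_abs[OF elim(1)] by (simp add: abs_mult window_def)
    have "abs_time_integral (window s (s + L) g) X w \<le> (LINT t|lborel. ?w t * \<bar>X t w\<bar>)"
      unfolding time_integral_def
      by (intro integral_mono_AE' i AE_I2) (use g in \<open>auto simp: window_def indicator_def intro!: mult_left_le_one_le\<close>)
    hence "exp (abs_time_integral (window s (s + L) g) X w / L) \<le> exp z"
      unfolding z_def using L by (simp add: divide_right_mono)
    also have "\<dots> = (LINT t|lborel. exp z * (1 - z) * ?w t + exp z * (?w t * \<bar>X t w\<bar>)) / L"
    proof -
      have "(LINT t|lborel. exp z * (1 - z) * ?w t + exp z * (?w t * \<bar>X t w\<bar>))
          = (LINT t|lborel. exp z * (1 - z) * ?w t) + (LINT t|lborel. exp z * (?w t * \<bar>X t w\<bar>))"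
        by (rule Bochner_Integration.integral_add) (use i w in auto)
      also have "\<dots> = exp z * (1 - z) * L + exp z * (z * L)"
        using integral_indicator_window[of L s] L by (simp add: z_def)
      finally show ?thesis using L by (simp add: algebra_simps)
    qed
    also have "\<dots> \<le> (LINT t|lborel. ?w t * ?E t w) / L"
    proof (intro divide_right_mono integral_mono)
      fix t
      \<comment> \<open>The tangent of the exponential function at the average z lies below its graph.\<close>
      have "exp z * (1 + (\<bar>X t w\<bar> - z)) \<le> exp z * exp (\<bar>X t w\<bar> - z)"
        by (intro mult_left_mono exp_ge_add_one_self) auto
      also have "\<dots> = ?E t w" by (simp flip: exp_add)
      finally have "?w t * (exp z * (1 + (\<bar>X t w\<bar> - z))) \<le> ?w t * ?E t w"
        by (intro mult_left_mono) (auto simp: window_def)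
      thus "exp z * (1 - z) * ?w t + exp z * (?w t * \<bar>X t w\<bar>) \<le> ?w t * ?E t w"
        by (simp add: algebra_simps)
    qed (use i w elim L in auto)
    finally show ?case by (simp add: time_integral_def)
  qed
  show *: "exp_integrable (window s (s + L) g) L"
    unfolding exp_integrable_def
  proof (rule Bochner_Integration.integrable_bound[OF J])
    show "AE w in M. norm (exp (abs_time_integral (window s (s + L) g) X w / L))
        \<le> norm (time_integral ?w ?E w / L)"
      using le
    proof eventually_elim
      case (elim w)
      from order_trans[OF elim abs_ge_self] show ?case by (simp only: real_norm_def abs_exp_cancel)
    qed
  qed measurable
  show "(LINT w|M. exp (abs_time_integral (window s (s + L) g) X w / L)) \<le> \<gamma>"
    using integral_mono_AE[OF *[unfolded exp_integrable_def] J le] JL by linarith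
qed

end

text \<open>For \<open>min \<bar>X\<bar> n\<close>, itself a coupled process with the same \<open>\<tau>\<close>, all exponential moments are finite, so the
dyadic upper bound applies without further conditions. With the least admissible shift 2 at each
level it starts from blocks at \<open>u = L\<close>, where Jensen's inequality bounds them, and ends at
\<open>L + 2k\<close>. The bound does not depend on \<open>n\<close>.\<close>

lemma exp_integrable_dyadic:
  assumes "coupled_process M X N X0 Xm Xp \<tau>"
    and ex: "integrable M (\<lambda>w. exp \<bar>X 0 w\<bar>)"
    and g: "g \<in> borel_measurable borel" "\<And>t. \<bar>g t\<bar> \<le> 1" and L: "0 < L"
  shows "coupled_process.exp_integrable M X (window s (s + 2 ^ k * L) g) (L + 2 * real k)"
proof -
  interpret coupled_process M X N X0 Xm Xp \<tau> by fact
  define \<gamma> where "\<gamma> = (LINT w|M. exp \<bar>X 0 w\<bar>)"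
  define u where "u = L + 2 * real k"
  have u: "0 < u" using L by (simp add: u_def)
  let ?w = "window s (s + 2 ^ k * L) g"
  define h where "h t = \<bar>g t\<bar>" for t
  have h: "h \<in> borel_measurable borel" "\<And>t. \<bar>h t\<bar> \<le> 1"
    using g unfolding h_def by auto
  have w: "integrable lborel ?w" by (rule window_integrable[OF g])
  hence wu: "integrable lborel (\<lambda>t. ?w t / u)" by auto
  define B where "B = 2 ^ k * (L * ln \<gamma>) + 12 * \<tau>\<^sup>2 * split_error (\<lambda>_. 2) k"
  have "integrable M (\<lambda>w. exp (abs_time_integral (\<lambda>t. ?w t / u) X w))"
  proof (rule integrable_exp_truncation[OF X wu first_moment])
    fix n
    define \<psi> where "\<psi> x = \<bar>clip n x\<bar>" for x
    have \<psi>[measurable]: "\<psi> \<in> borel_measurable borel" unfolding \<psi>_def by measurable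
    have "coupled_process M (\<lambda>t w. \<psi> (X t w)) N (\<lambda>t w. \<psi> (X0 t w)) (\<lambda>t w. \<psi> (Xm t w)) (\<lambda>t w. \<psi> (Xp t w)) \<tau>"
    proof (rule coupled_process_compose[OF assms(1) \<psi>])
      fix x y show "\<bar>\<psi> x - \<psi> y\<bar> \<le> \<bar>x - y\<bar>"
        using clip_lipschitz[of n x y] unfolding \<psi>_def by linarith
    qed (simp add: \<psi>_def clip_def)
    then interpret C: coupled_process M "\<lambda>t w. \<psi> (X t w)" N "\<lambda>t w. \<psi> (X0 t w)" "\<lambda>t w. \<psi> (Xm t w)" "\<lambda>t w. \<psi> (Xp t w)" \<tau> .
    have Ca: "random_process M (\<lambda>t w. \<bar>\<psi> (X t w)\<bar>)"
      using random_process_compose[OF C.X, of abs] by simp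
    have bd: "\<bar>\<psi> (X t w)\<bar> \<le> real n" for t w by (simp add: \<psi>_def abs_clip_le)
    have ei: "C.exp_integrable q u'" if q: "integrable lborel q" and u': "0 < u'" for q u'
    proof -
      have "integrable M (\<lambda>w. exp (abs_time_integral (\<lambda>t. q t / u') (\<lambda>t w. \<psi> (X t w)) w))"
        by (rule integrable_exp_bounded[OF Ca, where c="real n"]) (use bd q in auto)
      thus ?thesis by (simp only: C.exp_integrable_def abs_time_integral_divide[OF u'])
    qed
    have exn: "integrable M (\<lambda>w. exp \<bar>\<psi> (X 0 w)\<bar>)"
      by (rule Bochner_Integration.integrable_bound[OF ex])
         (use random_process_component[OF X, of 0] in \<open>auto simp: \<psi>_def abs_clip_le\<close>)
    have g\<gamma>: "(LINT w|M. exp \<bar>\<psi> (X 0 w)\<bar>) \<le> \<gamma>" unfolding \<gamma>_def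
      by (intro integral_mono exn ex) (simp add: \<psi>_def abs_clip_le)
    have block: "C.K (window a (a + L) h) L \<le> L * ln \<gamma>" for a
    proof -
      note b = C.block_exp_moment[OF exn g\<gamma> h L, of a]
      note i = C.exp_integrable_imp[OF b(1) L window_integrable[OF h]]
      have "(LINT w|M. exp (time_integral (window a (a + L) h) (\<lambda>t w. \<psi> (X t w)) w / L))
          \<le> (LINT w|M. exp (abs_time_integral (window a (a + L) h) (\<lambda>t w. \<psi> (X t w)) w / L))"
        using L abs_time_integral_ge[of "window a (a + L) h" "\<lambda>t w. \<psi> (X t w)"]
        by (intro integral_mono i b(1)[unfolded C.exp_integrable_def]) (auto simp: abs_le_iff divide_right_mono)
      also note b(2)
      finally show ?thesis unfolding C.K_def scaled_cgf_def
        using L M.integral_exp_pos[OF i] by (intro mult_left_mono) auto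
    qed
    have "C.K (window s (s + 2 ^ k * L) h) (L + (\<Sum>j<k. 2))
        \<le> (\<Sum>i<2^k. C.K (block s L i h) L) + 12 * \<tau>\<^sup>2 * split_error (\<lambda>_. 2) k"
      by (rule C.K_dyadic_upper[OF h L L]) (auto intro!: ei window_integrable h L)
    also have "L + (\<Sum>j<k. 2) = u" by (simp add: u_def)
    also have "(\<Sum>i<2^k. C.K (block s L i h) L) \<le> (\<Sum>i<(2::nat)^k. L * ln \<gamma>)"
      using block[of "s + real i * L" for i] by (intro sum_mono) (simp add: algebra_simps)
    finally have "C.K (window s (s + 2 ^ k * L) h) u \<le> B" by (simp add: B_def)
    hence "ln (LINT w|M. exp (time_integral (window s (s + 2 ^ k * L) h) (\<lambda>t w. \<psi> (X t w)) w / u)) \<le> B / u"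
      unfolding C.K_def scaled_cgf_def using u by (simp add: field_simps)
    moreover have "0 < (LINT w|M. exp (time_integral (window s (s + 2 ^ k * L) h) (\<lambda>t w. \<psi> (X t w)) w / u))"
      by (intro M.integral_exp_pos C.exp_integrable_imp ei window_integrable h u)
    ultimately have "(LINT w|M. exp (time_integral (window s (s + 2 ^ k * L) h) (\<lambda>t w. \<psi> (X t w)) w / u)) \<le> exp (B / u)"
      by (metis exp_le_cancel_iff exp_ln)
    moreover have "time_integral (window s (s + 2 ^ k * L) h) (\<lambda>t w. \<psi> (X t w)) w / u
        = abs_time_integral (\<lambda>t. ?w t / u) (clipped n X) w" for w
      unfolding abs_time_integral_divide[OF u]
      by (simp add: time_integral_def \<psi>_def h_def window_def abs_mult)
    ultimately show "(LINT w|M. exp (abs_time_integral (\<lambda>t. ?w t / u) (clipped n X) w)) \<le> exp (B / u)"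
      by simp
  qed
  hence "exp_integrable ?w u" by (simp only: exp_integrable_def abs_time_integral_divide[OF u])
  thus ?thesis by (simp only: u_def)
qed


section \<open>Second moments of blocks\<close>

text \<open>The right-hand side of the assumption, minimised over \<open>\<epsilon>\<close>, is \<open>(x + y)\<^sup>2\<close>; the minimiser is
\<open>y / x\<close>.\<close>

lemma le_add_of_weighted_squares:
  fixes x y z :: real
  assumes "0 \<le> x" "0 < y" "0 \<le> z"
    and le: "\<And>\<epsilon>. 0 < \<epsilon> \<Longrightarrow> z\<^sup>2 \<le> (1 + \<epsilon>) * x\<^sup>2 + (1 + 1 / \<epsilon>) * y\<^sup>2"
  shows "z \<le> x + y"
proof (cases "x = 0")
  case True
  have "z\<^sup>2 \<le> y\<^sup>2"
  proof (rule field_le_epsilon)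
    fix e :: real assume "0 < e"
    have "(1 + 1 / (y\<^sup>2 / e)) * y\<^sup>2 = y\<^sup>2 + e" using assms(2) by (simp add: field_simps)
    thus "z\<^sup>2 \<le> y\<^sup>2 + e" using le[of "y\<^sup>2 / e"] assms(2) True \<open>0 < e\<close> by simp
  qed
  thus ?thesis using assms True power2_le_imp_le by auto
next
  case False
  hence x: "0 < x" using assms(1) by simp
  have "(1 + y / x) * x\<^sup>2 + (1 + 1 / (y / x)) * y\<^sup>2 = (x + y)\<^sup>2"
    using x assms(2) by (simp add: field_simps power2_eq_square)
  hence "z\<^sup>2 \<le> (x + y)\<^sup>2" using le[of "y / x"] x assms(2) by simp
  thus ?thesis using assms power2_le_imp_le by auto
qed

locale centred_coupled_process = coupled_process M X N X0 Xm Xp \<tau>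
  for M :: "'a measure" and X and N :: "'b measure" and X0 Xm Xp \<tau> +
  assumes exp_moment: "integrable M (\<lambda>w. exp \<bar>X 0 w\<bar>)"
    and centred: "(LINT w|M. X 0 w) = 0"
begin

definition \<gamma> :: real where "\<gamma> = (LINT w|M. exp \<bar>X 0 w\<bar>)"

definition second_moment :: "(real \<Rightarrow> real) \<Rightarrow> real" where
  "second_moment g = (LINT w|M. (time_integral g X w)\<^sup>2)"

lemma second_moment_nonneg: "0 \<le> second_moment g" by (simp add: second_moment_def)

lemmas block_exp = block_exp_moment[OF exp_moment eq_refl[OF \<gamma>_def[symmetric]]]

lemma gamma_nonneg: "0 \<le> \<gamma>" by (simp add: \<gamma>_def)

lemma abs_time_integral_measurable:
  assumes g: "g \<in> borel_measurable borel"
  shows "abs_time_integral g X \<in> borel_measurable M"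
proof -
  have "random_process M (\<lambda>t w. \<bar>X t w\<bar>)" using random_process_compose[OF X, of abs] by simp
  thus ?thesis using g by (intro time_integral_measurable) auto
qed

lemma block_expansion:
  assumes g: "g \<in> borel_measurable borel" "\<And>t. \<bar>g t\<bar> \<le> 1" and L: "0 < L"
  shows "integrable M (\<lambda>w. (time_integral (window s (s + L) g) X w)\<^sup>2)"
    and "second_moment (window s (s + L) g) \<le> 2 * \<gamma> * L\<^sup>2"
    and "2 * L \<le> u \<Longrightarrow> \<bar>K (window s (s + L) g) u - second_moment (window s (s + L) g) / (2 * u)\<bar>
      \<le> 21 * \<gamma>\<^sup>2 * L ^ 3 / u\<^sup>2"
proof -
  let ?w = "window s (s + L) g"
  have w: "integrable lborel ?w" by (rule window_integrable[OF g])
  have wm: "?w \<in> borel_measurable borel" using g by measurable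
  note b = block_exp[OF g L, of s]
  have tm: "(\<lambda>w. abs_time_integral ?w X w / L) \<in> borel_measurable M"
    using abs_time_integral_measurable[OF wm] by measurable
  have le: "AE w in M. \<bar>time_integral ?w X w\<bar> \<le> L * (abs_time_integral ?w X w / L)"
    using L abs_time_integral_ge[of ?w X] by simp
  have nn: "0 \<le> abs_time_integral ?w X w / L" for w
    unfolding time_integral_def using L by (intro divide_nonneg_pos integral_nonneg_AE) auto
  have mz: "(LINT w|M. time_integral ?w X w) = 0"
    using mean_time_integral_copy(2)[OF X _ w] centred by (simp add: identically_distributed_def)
  note ex = M.scaled_cgf_expansion[OF time_integral_measurable[OF X wm] tm le nn L
      b(1)[unfolded exp_integrable_def] b(2) mz]
  show "integrable M (\<lambda>w. (time_integral ?w X w)\<^sup>2)" by (rule ex(2)[OF order_refl])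
  show "second_moment ?w \<le> 2 * \<gamma> * L\<^sup>2" unfolding second_moment_def by (rule ex(3)[OF order_refl])
  show "\<bar>K ?w u - second_moment ?w / (2 * u)\<bar> \<le> 21 * \<gamma>\<^sup>2 * L ^ 3 / u\<^sup>2" if "2 * L \<le> u"
    unfolding second_moment_def K_def by (rule ex(5)[OF that])
qed

text \<open>Second moments are recovered from scaled generating functions as \<open>u\<close> tends to infinity. Therefore
what has been proved for the latter (invariance under shifts, the effect of a cut) carries over to second
moments by passing to the limit.\<close>

lemma K_block_tendsto:
  assumes g: "g \<in> borel_measurable borel" "\<And>t. \<bar>g t\<bar> \<le> 1" and L: "0 < L"
  shows "((\<lambda>u. u * K (window s (s + L) g) u) \<longlongrightarrow> second_moment (window s (s + L) g) / 2) at_top"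
proof (rule LIM_zero_cancel, rule Lim_null_comparison)
  let ?w = "window s (s + L) g"
  show "\<forall>\<^sub>F u in at_top. norm (u * K ?w u - second_moment ?w / 2) \<le> 21 * \<gamma>\<^sup>2 * L ^ 3 * inverse u"
    using eventually_ge_at_top[of "2 * L"]
  proof eventually_elim
    case (elim u)
    have u: "0 < u" using elim L by linarith
    have "\<bar>u * K ?w u - second_moment ?w / 2\<bar> = u * \<bar>K ?w u - second_moment ?w / (2 * u)\<bar>"
      using u by (simp add: abs_mult_pos' algebra_simps)
    also have "\<dots> \<le> u * (21 * \<gamma>\<^sup>2 * L ^ 3 / u\<^sup>2)"
      using u by (intro mult_left_mono block_expansion(3)[OF g L elim]) auto
    also have "\<dots> = 21 * \<gamma>\<^sup>2 * L ^ 3 * inverse u" using u by (simp add: field_simps power2_eq_square)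
    finally show ?case by simp
  qed
  show "((\<lambda>u. 21 * \<gamma>\<^sup>2 * L ^ 3 * inverse u) \<longlongrightarrow> 0) at_top"
    by (intro tendsto_mult_right_zero tendsto_inverse_0_at_top filterlim_ident)
qed

definition V :: "real \<Rightarrow> real" where
  "V L = second_moment (window 0 L (\<lambda>_. 1))"

lemma V_nonneg: "0 \<le> V L" by (simp add: V_def second_moment_nonneg)

lemma K_window_shift:
  assumes L: "0 < L" "L \<le> u"
  shows "K (window s (s + L) (\<lambda>_. 1)) u = K (window 0 L (\<lambda>_. 1)) u"
proof -
  let ?w = "window s (s + L) (\<lambda>_. 1)"
  have e: "exp_integrable ?w L"
    by (rule block_exp(1)[OF _ _ L(1)]) auto
  have "exp_integrable ?w u"
    by (rule exp_integrable_window[OF _ _ e L]) auto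
  hence "K (\<lambda>t. ?w (s + t)) u = K ?w u"
    using L by (intro K_shift window_integrable) auto
  moreover have "(\<lambda>t. ?w (s + t)) = window 0 L (\<lambda>_. 1)"
    by (auto simp: window_def indicator_def fun_eq_iff)
  ultimately show ?thesis by simp
qed

lemma second_moment_window:
  assumes L: "0 < L" shows "second_moment (window s (s + L) (\<lambda>_. 1)) = V L"
proof -
  have a: "((\<lambda>u. u * K (window s (s + L) (\<lambda>_. 1)) u) \<longlongrightarrow> second_moment (window s (s + L) (\<lambda>_. 1)) / 2) at_top"
    by (rule K_block_tendsto) (use L in auto)
  have b: "((\<lambda>u. u * K (window 0 (0 + L) (\<lambda>_. 1)) u) \<longlongrightarrow> second_moment (window 0 (0 + L) (\<lambda>_. 1)) / 2) at_top"
    by (rule K_block_tendsto) (use L in auto)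
  have "\<forall>\<^sub>F u in at_top. u * K (window 0 (0 + L) (\<lambda>_. 1)) u = u * K (window s (s + L) (\<lambda>_. 1)) u"
    using eventually_ge_at_top[of L] by eventually_elim (simp add: K_window_shift[OF L])
  from tendsto_cong[THEN iffD1, OF this b] a
  have "second_moment (window 0 (0 + L) (\<lambda>_. 1)) / 2 = second_moment (window s (s + L) (\<lambda>_. 1)) / 2"
    by (intro tendsto_unique[of at_top]) auto
  thus ?thesis by (simp add: V_def)
qed

lemma V_le: "0 < L \<Longrightarrow> V L \<le> 2 * \<gamma> * L\<^sup>2"
  using block_expansion(2)[of "\<lambda>_. 1" L 0] by (simp add: V_def)

text \<open>On a block where \<open>g\<close> varies by at most \<open>\<kappa>\<close>, both terms are compared with the constant weight
\<open>g s\<close>.\<close>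

lemma second_moment_block:
  assumes g[measurable]: "g \<in> borel_measurable borel" and g1: "\<And>t. \<bar>g t\<bar> \<le> 1" and L: "0 < L"
    and \<kappa>: "\<And>t. s \<le> t \<Longrightarrow> t < s + L \<Longrightarrow> \<bar>g t - g s\<bar> \<le> \<kappa>"
  shows "\<bar>second_moment (window s (s + L) g) - V L / L * (LINT t|lborel. window s (s + L) (\<lambda>t. (g t)\<^sup>2) t)\<bar>
    \<le> 8 * \<gamma> * L\<^sup>2 * \<kappa>"
proof -
  let ?w = "window s (s + L) g" and ?o = "window s (s + L) (\<lambda>_. 1)"
  define a where "a = g s"
  have a1: "\<bar>a\<bar> \<le> 1" using g1 by (simp add: a_def)
  have \<kappa>0: "0 \<le> \<kappa>" using \<kappa>[of s] L by simp
  have one: "integrable lborel ?o" by (rule window_integrable) auto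
  have wi: "integrable lborel ?w" by (rule window_integrable[OF g g1])
  define Y where "Y = time_integral ?w X"
  define Y1 where "Y1 = time_integral ?o X"
  define Z where "Z = abs_time_integral ?o X"
  have Zabs: "Z = time_integral ?o (\<lambda>t w. \<bar>X t w\<bar>)"
    unfolding Z_def by (simp add: window_def fun_eq_iff time_integral_def)
  have [measurable]: "Z \<in> borel_measurable M" unfolding Z_def by (rule abs_time_integral_measurable) simp
  have Z2: "integrable M (\<lambda>w. (Z w)\<^sup>2)" "(LINT w|M. (Z w)\<^sup>2) \<le> 2 * \<gamma> * L\<^sup>2"
  proof -
    have "exp_integrable ?o L" "(LINT w|M. exp (Z w / L)) \<le> \<gamma>"
      unfolding Z_def
      by (rule block_exp[OF _ _ L]; simp)+
    hence e: "integrable M (\<lambda>w. exp (Z w / L))" and le: "(LINT w|M. exp (Z w / L)) \<le> \<gamma>"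
      by (simp_all only: exp_integrable_def Z_def)
    have pt: "(Z w)\<^sup>2 \<le> L\<^sup>2 * (2 * exp (Z w / L))" for w
    proof -
      have "0 \<le> Z w" unfolding Z_def time_integral_def by (intro integral_nonneg_AE) auto
      hence "(Z w / L)\<^sup>2 \<le> 2 * exp (Z w / L)" using L by (intro exp_ge_square) auto
      thus ?thesis using L by (simp add: power_divide field_simps)
    qed
    have i: "integrable M (\<lambda>w. L\<^sup>2 * (2 * exp (Z w / L)))" using e by auto
    show Zi: "integrable M (\<lambda>w. (Z w)\<^sup>2)"
      by (rule Bochner_Integration.integrable_bound[OF i]) (use pt in auto)
    have "(LINT w|M. (Z w)\<^sup>2) \<le> (LINT w|M. L\<^sup>2 * (2 * exp (Z w / L)))"
      by (intro integral_mono Zi i pt)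
    also have "\<dots> = L\<^sup>2 * 2 * (LINT w|M. exp (Z w / L))" by simp
    also have "\<dots> \<le> L\<^sup>2 * 2 * \<gamma>" by (intro mult_left_mono le) auto
    finally show "(LINT w|M. (Z w)\<^sup>2) \<le> 2 * \<gamma> * L\<^sup>2" by (simp add: mult_ac)
  qed
  have Yi: "integrable M (\<lambda>w. (Y w)\<^sup>2)" unfolding Y_def by (rule block_expansion(1)[OF g g1 L])
  have Y1i: "integrable M (\<lambda>w. (Y1 w)\<^sup>2)" unfolding Y1_def by (rule block_expansion(1)[OF _ _ L]) auto
  have pt: "AE w in M. \<bar>(Y w)\<^sup>2 - a\<^sup>2 * (Y1 w)\<^sup>2\<bar> \<le> 2 * \<kappa> * (Z w)\<^sup>2"
    using integrable_paths[OF X one first_moment] integrable_paths[OF X wi first_moment]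
  proof eventually_elim
    case (elim w)
    have iZ: "integrable lborel (\<lambda>t. ?o t * \<bar>X t w\<bar>)"
      using integrable_abs[OF elim(1)] by (simp add: abs_mult window_def)
    have eq: "Y w - a * Y1 w = (LINT t|lborel. ?w t * X t w - a * (?o t * X t w))"
      unfolding Y_def Y1_def time_integral_def using elim by simp
    have "\<bar>Y w - a * Y1 w\<bar> \<le> (LINT t|lborel. \<bar>?w t * X t w - a * (?o t * X t w)\<bar>)"
      unfolding eq by (rule integral_abs_bound)
    also have "\<dots> \<le> (LINT t|lborel. \<kappa> * (?o t * \<bar>X t w\<bar>))"
    proof (rule integral_mono_AE')
      have "\<bar>?w t * X t w - a * (?o t * X t w)\<bar> = ?o t * \<bar>g t - a\<bar> * \<bar>X t w\<bar>" for t
        by (auto simp: window_def indicator_def simp flip: abs_mult left_diff_distrib)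
      moreover have "?o t * \<bar>g t - a\<bar> \<le> ?o t * \<kappa>" for t
        using \<kappa>[of t] by (auto simp: window_def indicator_def a_def)
      ultimately have "\<bar>?w t * X t w - a * (?o t * X t w)\<bar> \<le> \<kappa> * (?o t * \<bar>X t w\<bar>)" for t
        using mult_right_mono[of "?o t * \<bar>g t - a\<bar>" "?o t * \<kappa>" "\<bar>X t w\<bar>"] by (simp add: mult_ac)
      thus "AE t in lborel. \<bar>?w t * X t w - a * (?o t * X t w)\<bar> \<le> \<kappa> * (?o t * \<bar>X t w\<bar>)" by simp
    qed (use iZ \<kappa>0 in \<open>auto simp: window_def\<close>)
    also have "\<dots> = \<kappa> * Z w" by (simp add: Zabs time_integral_def)
    finally have d: "\<bar>Y w - a * Y1 w\<bar> \<le> \<kappa> * Z w" .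
    have "\<bar>Y w\<bar> \<le> abs_time_integral ?w X w" unfolding Y_def by (rule abs_time_integral_ge)
    also have "\<dots> \<le> Z w" unfolding Zabs time_integral_def
      by (rule integral_mono_AE'[OF iZ])
         (use g1 in \<open>auto simp: window_def indicator_def intro!: mult_left_le_one_le\<close>)
    finally have y: "\<bar>Y w\<bar> \<le> Z w" .
    have "\<bar>Y1 w\<bar> \<le> Z w" unfolding Y1_def Z_def by (rule abs_time_integral_ge)
    hence "\<bar>a * Y1 w\<bar> \<le> Z w"
      using mult_mono[OF a1, of "\<bar>Y1 w\<bar>" "Z w"] by (simp add: abs_mult)
    hence s: "\<bar>Y w + a * Y1 w\<bar> \<le> 2 * Z w" using y by linarith
    have "(Y w)\<^sup>2 - a\<^sup>2 * (Y1 w)\<^sup>2 = (Y w - a * Y1 w) * (Y w + a * Y1 w)"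
      by (simp add: power2_eq_square algebra_simps)
    hence "\<bar>(Y w)\<^sup>2 - a\<^sup>2 * (Y1 w)\<^sup>2\<bar> = \<bar>Y w - a * Y1 w\<bar> * \<bar>Y w + a * Y1 w\<bar>" by (simp add: abs_mult)
    also have "\<dots> \<le> (\<kappa> * Z w) * (2 * Z w)" by (intro mult_mono d s) (use d in auto)
    finally show ?case by (simp add: power2_eq_square mult_ac)
  qed
  have eq: "second_moment ?w - a\<^sup>2 * V L = (LINT w|M. (Y w)\<^sup>2 - a\<^sup>2 * (Y1 w)\<^sup>2)"
    unfolding second_moment_window[OF L, of s, symmetric] second_moment_def
    using Yi Y1i by (simp add: Y_def Y1_def)
  have "\<bar>second_moment ?w - a\<^sup>2 * V L\<bar> \<le> (LINT w|M. \<bar>(Y w)\<^sup>2 - a\<^sup>2 * (Y1 w)\<^sup>2\<bar>)"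
    unfolding eq by (rule integral_abs_bound)
  also have "\<dots> \<le> (LINT w|M. 2 * \<kappa> * (Z w)\<^sup>2)"
    by (rule integral_mono_AE[OF _ _ pt]) (use Yi Y1i Z2 in auto)
  also have "\<dots> = 2 * \<kappa> * (LINT w|M. (Z w)\<^sup>2)" by simp
  also have "\<dots> \<le> 2 * \<kappa> * (2 * \<gamma> * L\<^sup>2)" using \<kappa>0 by (intro mult_left_mono Z2) auto
  finally have one': "\<bar>second_moment ?w - a\<^sup>2 * V L\<bar> \<le> 4 * \<gamma> * L\<^sup>2 * \<kappa>" by (simp add: mult_ac)
  let ?I = "LINT t|lborel. window s (s + L) (\<lambda>t. (g t)\<^sup>2) t"
  have i2: "integrable lborel (window s (s + L) (\<lambda>t. (g t)\<^sup>2))"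
    by (rule window_integrable) (use g1 in \<open>auto simp: abs_square_le_1\<close>)
  have eqI: "?I - a\<^sup>2 * L = (LINT t|lborel. window s (s + L) (\<lambda>t. (g t)\<^sup>2) t - a\<^sup>2 * ?o t)"
    using i2 one integral_indicator_window[of L s] L by simp
  have "\<bar>?I - a\<^sup>2 * L\<bar> \<le> (LINT t|lborel. \<bar>window s (s + L) (\<lambda>t. (g t)\<^sup>2) t - a\<^sup>2 * ?o t\<bar>)"
    unfolding eqI by (rule integral_abs_bound)
  also have "\<dots> \<le> (LINT t|lborel. 2 * \<kappa> * ?o t)"
  proof (rule integral_mono_AE')
    have "\<bar>window s (s + L) (\<lambda>t. (g t)\<^sup>2) t - a\<^sup>2 * ?o t\<bar> \<le> 2 * \<kappa> * ?o t" for t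
    proof (cases "s \<le> t \<and> t < s + L")
      case True
      have "(g t)\<^sup>2 - a\<^sup>2 = (g t - a) * (g t + a)" by (simp add: power2_eq_square algebra_simps)
      hence "\<bar>(g t)\<^sup>2 - a\<^sup>2\<bar> = \<bar>g t - a\<bar> * \<bar>g t + a\<bar>" by (simp add: abs_mult)
      also have "\<dots> \<le> \<kappa> * 2"
        using True \<kappa>[of t] g1[of t] a1 \<kappa>0 by (intro mult_mono) (auto simp: a_def)
      finally show ?thesis using True by (simp add: window_def)
    qed (auto simp: window_def indicator_def)
    thus "AE t in lborel. \<bar>window s (s + L) (\<lambda>t. (g t)\<^sup>2) t - a\<^sup>2 * ?o t\<bar> \<le> 2 * \<kappa> * ?o t" by simp
    show "integrable lborel (\<lambda>t. 2 * \<kappa> * ?o t)" using one by auto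
  qed (use \<kappa>0 in \<open>auto simp: window_def\<close>)
  also have "\<dots> = 2 * \<kappa> * L" using integral_indicator_window[of L s] L by simp
  finally have two: "\<bar>?I - a\<^sup>2 * L\<bar> \<le> 2 * \<kappa> * L" .
  have "V L / L \<le> 2 * \<gamma> * L" using V_le[OF L] L by (simp add: field_simps power2_eq_square)
  hence "V L / L * \<bar>?I - a\<^sup>2 * L\<bar> \<le> (2 * \<gamma> * L) * (2 * \<kappa> * L)"
    using two L gamma_nonneg V_nonneg[of L] by (intro mult_mono) auto
  moreover have "\<bar>V L / L * ?I - a\<^sup>2 * V L\<bar> = V L / L * \<bar>?I - a\<^sup>2 * L\<bar>"
  proof -
    have "V L / L * ?I - a\<^sup>2 * V L = V L / L * (?I - a\<^sup>2 * L)" using L by (simp add: field_simps)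
    thus ?thesis using V_nonneg[of L] L by (simp add: abs_mult)
  qed
  ultimately have "\<bar>V L / L * ?I - a\<^sup>2 * V L\<bar> \<le> 4 * \<gamma> * L\<^sup>2 * \<kappa>"
    by (simp add: power2_eq_square mult_ac)
  thus ?thesis using one' by linarith
qed

text \<open>The two inequalities for a cut at \<open>L\<close> with \<open>v = \<epsilon> u\<close>, multiplied by \<open>u\<close>, in the limit of large
\<open>u\<close>.\<close>

lemma V_double:
  assumes L: "0 < L" and \<epsilon>: "0 < \<epsilon>"
  shows "V (2 * L) \<le> (1 + \<epsilon>) * (2 * V L) + (1 + 1 / \<epsilon>) * (24 * \<tau>\<^sup>2)"
    and "2 * V L \<le> (1 + \<epsilon>) * V (2 * L) + (1 + 1 / \<epsilon>) * (24 * \<tau>\<^sup>2)"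
proof -
  let ?K = "\<lambda>L u. K (window 0 L (\<lambda>_. 1)) u"
  have lim: "((\<lambda>u. u * ?K L u) \<longlongrightarrow> V L / 2) at_top" if "0 < L" for L
    using K_block_tendsto[of "\<lambda>_. 1" L 0] that by (simp add: V_def)
  have lim': "((\<lambda>u. u * ?K L ((1 + \<epsilon>) * u)) \<longlongrightarrow> V L / 2 / (1 + \<epsilon>)) at_top" if "0 < L" for L
  proof -
    have "filterlim (\<lambda>u. (1 + \<epsilon>) * u) at_top at_top"
      using \<epsilon> by (intro filterlim_tendsto_pos_mult_at_top[OF tendsto_const] filterlim_ident) auto
    from filterlim_compose[OF lim[OF that] this]
    have "((\<lambda>u. (1 + \<epsilon>) * u * ?K L ((1 + \<epsilon>) * u) / (1 + \<epsilon>)) \<longlongrightarrow> V L / 2 / (1 + \<epsilon>)) at_top"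
      using \<epsilon> by (intro tendsto_divide tendsto_const) auto
    moreover have "(1 + \<epsilon>) * u * ?K L ((1 + \<epsilon>) * u) / (1 + \<epsilon>) = u * ?K L ((1 + \<epsilon>) * u)" for u
      using \<epsilon> by (simp add: field_simps)
    ultimately show ?thesis by simp
  qed
  have split: "?K (2 * L) ((1 + \<epsilon>) * u) \<le> 2 * ?K L u + 12 * \<tau>\<^sup>2 / (\<epsilon> * u)"
      "2 * ?K L ((1 + \<epsilon>) * u) \<le> ?K (2 * L) u + 12 * \<tau>\<^sup>2 / (\<epsilon> * u)"
    if u: "2 * L \<le> u" "2 / \<epsilon> \<le> u" for u
  proof -
    have u0: "0 < u" using u L by linarith
    have v: "2 \<le> \<epsilon> * u" using u \<epsilon> by (simp add: field_simps)
    let ?w = "window 0 (2 * L) (\<lambda>_. 1)"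
    have w: "integrable lborel ?w" by (rule window_integrable) auto
    have w1: "\<bar>?w t\<bar> \<le> 1" for t by (rule window_abs_le_1) auto
    have e0: "exp_integrable ?w (2 * L)"
      using block_exp(1)[ of "\<lambda>_. 1" "2 * L" 0] L by simp
    have e: "exp_integrable ?w u" by (rule exp_integrable_window[OF _ _ e0 _ u(1)]) (use L in auto)
    note sp = K_split_upper[OF w w1 u0 v e, where c=L] K_split_lower[OF w w1 u0 v e, where c=L]
    have l: "(\<lambda>t. indicator {..<L} t * ?w t) = window 0 L (\<lambda>_. 1)" using L by (intro window_left) auto
    have r: "(\<lambda>t. indicator {L..} t * ?w t) = window L (2 * L) (\<lambda>_. 1)" using L by (intro window_right) auto
    have sh: "K (window L (2 * L) (\<lambda>_. 1)) u' = ?K L u'" if "L \<le> u'" for u'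
      using K_window_shift[OF L that, of L] by simp
    have uu: "u + \<epsilon> * u = (1 + \<epsilon>) * u" by (simp add: algebra_simps)
    have "L \<le> u" using u L by linarith
    moreover have "u \<le> (1 + \<epsilon>) * u" using u0 \<epsilon> by simp
    ultimately have Lu: "L \<le> u" "L \<le> (1 + \<epsilon>) * u" by linarith+
    show "?K (2 * L) ((1 + \<epsilon>) * u) \<le> 2 * ?K L u + 12 * \<tau>\<^sup>2 / (\<epsilon> * u)"
      using sp(1) unfolding l r uu sh[OF Lu(1)] by simp
    show "2 * ?K L ((1 + \<epsilon>) * u) \<le> ?K (2 * L) u + 12 * \<tau>\<^sup>2 / (\<epsilon> * u)"
      using sp(2) unfolding l r uu sh[OF Lu(2)] by simp
  qed
  have ev: "\<forall>\<^sub>F u in at_top. 2 * L \<le> u \<and> 2 / \<epsilon> \<le> u \<and> 0 < u"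
    by (intro eventually_conj eventually_ge_at_top eventually_gt_at_top)
  have "V (2 * L) / 2 / (1 + \<epsilon>) \<le> 2 * (V L / 2) + 12 * \<tau>\<^sup>2 / \<epsilon>"
  proof (rule tendsto_le[OF _ _ lim'])
    show "((\<lambda>u. 2 * (u * ?K L u) + 12 * \<tau>\<^sup>2 / \<epsilon>) \<longlongrightarrow> 2 * (V L / 2) + 12 * \<tau>\<^sup>2 / \<epsilon>) at_top"
      by (intro tendsto_intros lim L)
    show "\<forall>\<^sub>F u in at_top. u * ?K (2 * L) ((1 + \<epsilon>) * u) \<le> 2 * (u * ?K L u) + 12 * \<tau>\<^sup>2 / \<epsilon>"
      using ev
    proof eventually_elim
      case (elim u)
      have "u * ?K (2 * L) ((1 + \<epsilon>) * u) \<le> u * (2 * ?K L u + 12 * \<tau>\<^sup>2 / (\<epsilon> * u))"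
        using elim split(1)[of u] by (intro mult_left_mono) auto
      also have "\<dots> = 2 * (u * ?K L u) + 12 * \<tau>\<^sup>2 / \<epsilon>" using elim \<epsilon> by (simp add: field_simps)
      finally show ?case .
    qed
  qed (use L in auto)
  thus "V (2 * L) \<le> (1 + \<epsilon>) * (2 * V L) + (1 + 1 / \<epsilon>) * (24 * \<tau>\<^sup>2)"
    using \<epsilon> by (simp add: field_simps)
  have "2 * (V L / 2 / (1 + \<epsilon>)) \<le> V (2 * L) / 2 + 12 * \<tau>\<^sup>2 / \<epsilon>"
  proof (rule tendsto_le[where F=at_top])
    show "((\<lambda>u. 2 * (u * ?K L ((1 + \<epsilon>) * u))) \<longlongrightarrow> 2 * (V L / 2 / (1 + \<epsilon>))) at_top"
      by (intro tendsto_mult tendsto_const lim' L)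
    show "((\<lambda>u. u * ?K (2 * L) u + 12 * \<tau>\<^sup>2 / \<epsilon>) \<longlongrightarrow> V (2 * L) / 2 + 12 * \<tau>\<^sup>2 / \<epsilon>) at_top"
      by (intro tendsto_add tendsto_const lim) (use L in auto)
    show "\<forall>\<^sub>F u in at_top. 2 * (u * ?K L ((1 + \<epsilon>) * u)) \<le> u * ?K (2 * L) u + 12 * \<tau>\<^sup>2 / \<epsilon>"
      using ev
    proof eventually_elim
      case (elim u)
      have "u * (2 * ?K L ((1 + \<epsilon>) * u)) \<le> u * (?K (2 * L) u + 12 * \<tau>\<^sup>2 / (\<epsilon> * u))"
        using elim split(2)[of u] by (intro mult_left_mono) auto
      also have "\<dots> = u * ?K (2 * L) u + 12 * \<tau>\<^sup>2 / \<epsilon>" using elim \<epsilon> by (simp add: field_simps)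
      finally show ?case by (simp add: mult_ac)
    qed
  qed simp
  thus "2 * V L \<le> (1 + \<epsilon>) * V (2 * L) + (1 + 1 / \<epsilon>) * (24 * \<tau>\<^sup>2)"
    using \<epsilon> by (simp add: field_simps)
qed

text \<open>Optimising \<open>\<epsilon>\<close> in the doubling inequalities turns them into a triangle inequality for standard
deviations: \<open>sqrt (V (2L))\<close> and \<open>sqrt (2 V L)\<close> differ by at most a constant. After division by
\<open>sqrt (2L)\<close> the differences are geometrically small along \<open>L = 2^m\<close>.\<close>

lemma variance_rate_convergent:
  "\<exists>\<sigma>\<ge>0. (\<lambda>m. V (2 ^ m) / 2 ^ m) \<longlonglongrightarrow> \<sigma>\<^sup>2"
proof -
  define y where "y = sqrt (24 * \<tau>\<^sup>2)"
  have y: "0 < y" "y\<^sup>2 = 24 * \<tau>\<^sup>2" using tau_ge_1 by (auto simp: y_def)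
  have sq: "\<bar>sqrt (V (2 * L)) - sqrt (2 * V L)\<bar> \<le> y" if L: "0 < L" for L
  proof -
    have "sqrt (V (2 * L)) \<le> sqrt (2 * V L) + y"
      by (rule le_add_of_weighted_squares) (use V_double(1)[OF L] V_nonneg y in auto)
    moreover have "sqrt (2 * V L) \<le> sqrt (V (2 * L)) + y"
      by (rule le_add_of_weighted_squares) (use V_double(2)[OF L] V_nonneg y in auto)
    ultimately show ?thesis by linarith
  qed
  define a where "a m = sqrt (V (2 ^ m) / 2 ^ m)" for m :: nat
  have step: "\<bar>a (Suc m) - a m\<bar> \<le> y * (1 / sqrt 2) ^ Suc m" for m
  proof -
    have e1: "a (Suc m) = sqrt (V (2 * 2 ^ m)) / sqrt 2 ^ Suc m"
      by (simp add: a_def real_sqrt_divide real_sqrt_mult real_sqrt_power)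
    have e2: "a m = sqrt (2 * V (2 ^ m)) / sqrt 2 ^ Suc m"
      by (simp add: a_def real_sqrt_divide real_sqrt_mult real_sqrt_power)
    have "\<bar>a (Suc m) - a m\<bar> = \<bar>sqrt (V (2 * 2 ^ m)) - sqrt (2 * V (2 ^ m))\<bar> / sqrt 2 ^ Suc m"
      unfolding e1 e2 by (simp add: abs_divide abs_mult power_abs flip: diff_divide_distrib)
    also have "\<dots> \<le> y / sqrt 2 ^ Suc m" by (intro divide_right_mono sq) auto
    finally show ?thesis by (simp add: power_one_over)
  qed
  have "summable (\<lambda>m. a (Suc m) - a m)"
  proof (rule summable_comparison_test')
    show "summable (\<lambda>m. y * (1 / sqrt 2) ^ Suc m)"
      by (intro summable_mult summable_Suc_iff[THEN iffD2] summable_geometric) auto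
    show "norm (a (Suc m) - a m) \<le> y * (1 / sqrt 2) ^ Suc m" for m using step by simp
  qed
  from summable_LIMSEQ[OF this] obtain l where "(\<lambda>n. \<Sum>m<n. a (Suc m) - a m) \<longlonglongrightarrow> l" by blast
  hence "(\<lambda>n. a 0 + (\<Sum>m<n. a (Suc m) - a m)) \<longlonglongrightarrow> a 0 + l" by (intro tendsto_intros)
  hence lim: "a \<longlonglongrightarrow> a 0 + l" by (simp add: sum_lessThan_telescope)
  have "0 \<le> a 0 + l" by (rule LIMSEQ_le_const[OF lim]) (auto simp: a_def V_nonneg)
  moreover have "(\<lambda>m. (a m)\<^sup>2) \<longlonglongrightarrow> (a 0 + l)\<^sup>2" by (intro tendsto_power lim)
  moreover have "(a m)\<^sup>2 = V (2 ^ m) / 2 ^ m" for m by (simp add: a_def V_nonneg)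
  ultimately show ?thesis by auto
qed

end


section \<open>Moderate deviations\<close>

lemma window_concat:
  "a \<le> b \<Longrightarrow> b \<le> c \<Longrightarrow> window a b h t + window b c h t = window a c h t"
  by (auto simp: window_def indicator_def)

lemma sum_windows:
  assumes "0 \<le> L"
  shows "(\<Sum>i<n. block s L i h t) = window s (s + real n * L) h t"
proof (induction n)
  case (Suc n)
  have "s \<le> s + real n * L" "s + real n * L \<le> s + real (Suc n) * L"
    using assms by (simp_all add: mult_right_mono)
  thus ?case unfolding sum.lessThan_Suc Suc.IH by (rule window_concat)
qed (simp add: window_def)

text \<open>A window of \<open>2^n\<close> blocks that covers the support of \<open>f(t/r)\<close> and is at most twice too long. The
blocks outside the support contribute nothing.\<close>

lemma dyadic_cover:
  assumes L: "1 \<le> L" and x: "L \<le> x"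
  shows "\<exists>n::nat. x < 2 ^ n * L \<and> 2 ^ n * L \<le> 2 * (x::real)"
proof -
  obtain n0 where "x < 2 ^ n0" using real_arch_pow[of 2 x] by auto
  also have "(2::real) ^ n0 \<le> 2 ^ n0 * L" using L by simp
  finally have ex: "x < 2 ^ n0 * L" .
  define n where "n = (LEAST n. x < 2 ^ n * L)"
  have n: "x < 2 ^ n * L" unfolding n_def using ex by (rule LeastI)
  then obtain k where k: "n = Suc k" using x by (cases n) auto
  have "\<not> x < 2 ^ k * L" using not_less_Least[of k "\<lambda>n. x < 2 ^ n * L"] k unfolding n_def by simp
  hence "2 ^ n * L \<le> 2 * x" using k by simp
  thus ?thesis using n by blast
qed

lemma sum_geometric_le:
  fixes q :: real assumes "0 \<le> q" "q < 1"
  shows "(\<Sum>j<n. q ^ j) \<le> 1 / (1 - q)"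
proof -
  have "(\<Sum>j<n. q ^ j) = (1 - q ^ n) / (1 - q)" using assms by (simp add: sum_gp_strict)
  also have "\<dots> \<le> 1 / (1 - q)" using assms by (intro divide_right_mono) auto
  finally show ?thesis .
qed

lemma abs_sum_diff_le:
  fixes x y :: "nat \<Rightarrow> real"
  assumes "\<And>i. i < n \<Longrightarrow> \<bar>x i - y i\<bar> \<le> e"
  shows "\<bar>(\<Sum>i<n. x i) - (\<Sum>i<n. y i)\<bar> \<le> real n * e"
proof -
  have "\<bar>(\<Sum>i<n. x i) - (\<Sum>i<n. y i)\<bar> = \<bar>\<Sum>i<n. x i - y i\<bar>" by (simp add: sum_subtractf)
  also have "\<dots> \<le> (\<Sum>i<n. \<bar>x i - y i\<bar>)" by (rule sum_abs)
  also have "\<dots> \<le> (\<Sum>i<n. e)" using assms by (intro sum_mono) auto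
  finally show ?thesis by simp
qed

context centred_coupled_process
begin

lemma sum_K_blocks:
  assumes g: "g \<in> borel_measurable borel" "\<And>t. \<bar>g t\<bar> \<le> 1" and L: "0 < L"
    and \<kappa>: "\<And>x y. \<bar>x - y\<bar> \<le> L \<Longrightarrow> \<bar>g x - g y\<bar> \<le> \<kappa>" and u: "2 * L \<le> u"
  shows "\<bar>(\<Sum>i<n. K (block s L i g) u)
      - V L / L * (LINT t|lborel. window s (s + real n * L) (\<lambda>t. (g t)\<^sup>2) t) / (2 * u)\<bar>
    \<le> real n * (21 * \<gamma>\<^sup>2 * L ^ 3 / u\<^sup>2 + 4 * \<gamma> * L\<^sup>2 * \<kappa> / u)"
proof -
  have u0: "0 < u" using u L by linarith
  let ?w = "block s L"
  have g2: "integrable lborel (?w i (\<lambda>t. (g t)\<^sup>2))" for i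
    using g by (intro window_integrable) (auto simp: abs_square_le_1)
  have each: "\<bar>K (?w i g) u - V L / L * (LINT t|lborel. ?w i (\<lambda>t. (g t)\<^sup>2) t) / (2 * u)\<bar>
      \<le> 21 * \<gamma>\<^sup>2 * L ^ 3 / u\<^sup>2 + 4 * \<gamma> * L\<^sup>2 * \<kappa> / u" for i
  proof -
    let ?a = "s + real i * L"
    have eq: "s + real (Suc i) * L = ?a + L" by (simp add: algebra_simps)
    let ?S = "second_moment (window ?a (?a + L) g)"
    let ?I = "LINT t|lborel. window ?a (?a + L) (\<lambda>t. (g t)\<^sup>2) t"
    have 1: "\<bar>K (window ?a (?a + L) g) u - ?S / (2 * u)\<bar> \<le> 21 * \<gamma>\<^sup>2 * L ^ 3 / u\<^sup>2"
      by (rule block_expansion(3)[OF g L u])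
    have "\<bar>?S - V L / L * ?I\<bar> \<le> 8 * \<gamma> * L\<^sup>2 * \<kappa>"
      by (rule second_moment_block[OF g L]) (use L in \<open>auto intro!: \<kappa>\<close>)
    hence "\<bar>?S - V L / L * ?I\<bar> / (2 * u) \<le> 8 * \<gamma> * L\<^sup>2 * \<kappa> / (2 * u)"
      using u0 by (intro divide_right_mono) auto
    moreover have "\<bar>?S / (2 * u) - V L / L * ?I / (2 * u)\<bar> = \<bar>?S - V L / L * ?I\<bar> / (2 * u)"
    proof -
      have "\<bar>p / (2 * u) - q / (2 * u)\<bar> = \<bar>p - q\<bar> / (2 * u)" for p q
        using u0 by (simp flip: diff_divide_distrib)
      thus ?thesis .
    qed
    moreover have "8 * \<gamma> * L\<^sup>2 * \<kappa> / (2 * u) = 4 * \<gamma> * L\<^sup>2 * \<kappa> / u" by simp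
    ultimately have 2: "\<bar>?S / (2 * u) - V L / L * ?I / (2 * u)\<bar> \<le> 4 * \<gamma> * L\<^sup>2 * \<kappa> / u" by (simp only:)
    have tri: "\<bar>x - y\<bar> \<le> c \<Longrightarrow> \<bar>y - z\<bar> \<le> d \<Longrightarrow> \<bar>x - z\<bar> \<le> c + d" for x y z c d :: real by linarith
    show ?thesis unfolding eq by (rule tri[OF 1 2])
  qed
  have "(\<Sum>i<n. V L / L * (LINT t|lborel. ?w i (\<lambda>t. (g t)\<^sup>2) t) / (2 * u))
      = V L / L * (LINT t|lborel. (\<Sum>i<n. ?w i (\<lambda>t. (g t)\<^sup>2) t)) / (2 * u)"
    using g2 by (simp add: sum_divide_distrib sum_distrib_left)
  also have "(\<lambda>t. \<Sum>i<n. ?w i (\<lambda>t. (g t)\<^sup>2) t) = (\<lambda>t. window s (s + real n * L) (\<lambda>t. (g t)\<^sup>2) t)"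
    using L by (intro ext sum_windows) auto
  finally have eq: "(\<Sum>i<n. V L / L * (LINT t|lborel. ?w i (\<lambda>t. (g t)\<^sup>2) t) / (2 * u))
      = V L / L * (LINT t|lborel. window s (s + real n * L) (\<lambda>t. (g t)\<^sup>2) t) / (2 * u)" .
  show ?thesis unfolding eq[symmetric] by (rule abs_sum_diff_le) (rule each)
qed

text \<open>The block length \<open>L\<close>, the modulus \<open>\<kappa>\<close> and \<open>\<epsilon>\<close> are free here. Of the three error terms, the first
comes from the shift of the argument, the second from the accumulated cost of the cuts, and the third
from the expansion inside the blocks. The third grows with \<open>L\<close>, but \<open>l\<close> and \<open>\<kappa>\<close> occur in no other
and can be chosen after \<open>L\<close>.\<close>

lemma level_estimate:
  fixes f :: "real \<Rightarrow> real"
  assumes f[measurable]: "f \<in> borel_measurable borel" and f1: "\<And>t. \<bar>f t\<bar> \<le> 1"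
    and a: "1 \<le> a" and supp: "\<And>t. a < \<bar>t\<bar> \<Longrightarrow> f t = 0"
    and d: "0 < d" and \<kappa>: "\<And>x y. \<bar>x - y\<bar> \<le> d \<Longrightarrow> \<bar>f x - f y\<bar> \<le> \<kappa>"
    and L: "1 \<le> L" and \<epsilon>: "0 < \<epsilon>" "\<epsilon> \<le> 1/10"
    and r: "4 * a \<le> r" "L \<le> r" "L / d \<le> r"
    and l: "0 < l" "6 * (l * ln r) \<le> \<epsilon>" "l * L \<le> 1/4"
  defines "F \<equiv> LINT t|lborel. (f t)\<^sup>2" and "g \<equiv> \<lambda>t. f (t / r)"
  shows "integrable M (\<lambda>w. exp (l * time_integral g X w))"
    and "\<bar>ln (LINT w|M. exp (l * time_integral g X w)) / (r * l\<^sup>2) - V L / L * F / 2\<bar>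
      \<le> 5 * \<epsilon> * (V L / L) * F + 72 * \<tau>\<^sup>2 * a / (\<epsilon> * L)
        + a * (336 * \<gamma>\<^sup>2 * L\<^sup>2 * l + 32 * \<gamma> * L * \<kappa>)"
proof -
  have r0: "0 < r" "1 < r" using a r by auto
  have L0: "0 < L" using L by simp
  have \<kappa>0: "0 \<le> \<kappa>" using \<kappa>[of 0 0] d by simp
  have gm: "g \<in> borel_measurable borel" unfolding g_def by measurable
  have g1: "\<bar>g t\<bar> \<le> 1" for t unfolding g_def by (rule f1)
  have "L \<le> 2 * (a * r)" using mult_mono[OF a r(2)] r0 L0 a by simp
  then obtain n where n: "2 * (a * r) < 2 ^ n * L" "2 ^ n * L \<le> 2 * (2 * (a * r))"
    using dyadic_cover[OF L] by blast
  define s where "s = - (2 ^ n * L) / 2"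
  have win: "window s (s + 2 ^ n * L) h = h" if "\<And>t. a * r < \<bar>t\<bar> \<Longrightarrow> h t = 0" for h
  proof
    fix t show "window s (s + 2 ^ n * L) h t = h t"
    proof (cases "a * r < \<bar>t\<bar>")
      case True thus ?thesis using that by (simp add: window_def)
    next
      case False
      thus ?thesis using n(1) by (auto simp: window_def s_def indicator_def field_simps abs_le_iff)
    qed
  qed
  have gs: "g t = 0" if "a * r < \<bar>t\<bar>" for t
    unfolding g_def using that r0 by (intro supp) (simp add: field_simps)
  have wg: "window s (s + 2 ^ n * L) g = g" by (rule win) (rule gs)
  have wg2: "window s (s + 2 ^ n * L) (\<lambda>t. (g t)\<^sup>2) = (\<lambda>t. (g t)\<^sup>2)" by (rule win) (simp add: gs)
  have Fr: "(LINT t|lborel. (g t)\<^sup>2) = r * F"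
    unfolding F_def g_def using lborel_integral_real_affine[of r "\<lambda>t. (f (t / r))\<^sup>2" 0] r0 by simp
  have F0: "0 \<le> F" unfolding F_def by simp
  have gi: "integrable lborel g" using window_integrable[OF gm g1] wg by metis
  \<comment> \<open>The number of levels is at most logarithmic in r.\<close>
  have "real n * (2 / 3) \<le> real n * ln 2" using ln2_ge_two_thirds by (intro mult_left_mono) auto
  also have "\<dots> = ln (2 ^ n)" by (simp add: ln_realpow)
  also have "\<dots> \<le> ln (r * r)"
  proof (rule ln_mono)
    have "2 ^ n * 1 \<le> 2 ^ n * L" using L by (intro mult_left_mono) auto
    also note n(2)
    also have "2 * (2 * (a * r)) = 4 * a * r" by simp
    also have "\<dots> \<le> r * r" using r r0 by (intro mult_right_mono) auto
    finally show "2 ^ n \<le> r * r" by simp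
  qed simp
  also have "\<dots> = 2 * ln r" using r0 by (simp add: ln_mult)
  finally have nln: "real n \<le> 3 * ln r" by simp
  have nl: "2 * real n * l \<le> \<epsilon>"
  proof -
    have "2 * real n * l \<le> 2 * (3 * ln r) * l" using nln l by (intro mult_right_mono mult_left_mono) auto
    thus ?thesis using l(2) by (simp add: mult_ac)
  qed
  \<comment> \<open>The loss at level j: a summable fraction of 1/l, plus the constant needed by the coupling.\<close>
  define v where "v j = 2 + \<epsilon> / l * (3/4) ^ j" for j :: nat
  have v2: "2 \<le> v j" for j unfolding v_def using \<epsilon> l by simp
  define W where "W = (\<Sum>j<n. v j)"
  have W0: "0 \<le> W" unfolding W_def using v2 by (intro sum_nonneg) (meson order_trans zero_le_numeral)
  have "W = 2 * real n + \<epsilon> / l * (\<Sum>j<n. (3/4) ^ j)"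
    unfolding W_def v_def by (simp add: sum.distrib sum_distrib_left)
  also have "\<dots> \<le> 2 * real n + \<epsilon> / l * 4"
    using sum_geometric_le[of "3/4" n] \<epsilon> l by (intro add_left_mono mult_left_mono) auto
  also have "2 * real n \<le> \<epsilon> / l" using nl l by (simp add: field_simps)
  finally have W: "W \<le> 5 * \<epsilon> / l" by simp
  define u0 where "u0 = 1 / l - W"
  define u1 where "u1 = 1 / l + W"
  have u0_lower: "(1 - 5 * \<epsilon>) / l \<le> u0" using W unfolding u0_def by (simp add: diff_divide_distrib)
  have u0h: "1 / (2 * l) \<le> u0"
  proof -
    have "1 / (2 * l) = (1/2) / l" by simp
    also have "\<dots> \<le> (1 - 5 * \<epsilon>) / l" using \<epsilon> l by (intro divide_right_mono) auto
    finally show ?thesis using u0_lower by linarith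
  qed
  have hl: "2 * L \<le> 1 / (2 * l)" using l(1,3) by (simp add: field_simps)
  \<comment> \<open>The argument L + 2 n is the one at which the exponential moments of the window are known to be finite.\<close>
  have Ln: "L + 2 * real n \<le> u0"
  proof -
    have "L + 2 * real n \<le> (1/4) / l + (1/10) / l"
      using l nl \<epsilon> by (intro add_mono) (simp_all add: field_simps)
    also have "\<dots> \<le> (1/2) / l"
      unfolding add_divide_distrib[symmetric] using l by (intro divide_right_mono) auto
    also have "\<dots> = 1 / (2 * l)" by simp
    finally show ?thesis using u0h by linarith
  qed
  have u0p: "0 < u0" using Ln L by linarith
  have u0u: "u0 \<le> 1 / l" "1 / l \<le> u1" using W0 by (auto simp: u0_def u1_def)
  have e0: "exp_integrable (window s (s + 2 ^ n * L) g) (L + 2 * real n)"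
    by (rule exp_integrable_dyadic[OF coupled_process_axioms exp_moment gm g1 L0])
  have Lp: "0 < L + 2 * real n" using L by simp
  have eu: "exp_integrable (window s (s + 2 ^ n * L) g) u" if "u0 \<le> u" for u
    by (rule exp_integrable_window[OF gm g1 e0 Lp]) (use that Ln in auto)
  have l0: "0 < 1 / l" using l by simp
  have "integrable M (\<lambda>w. exp (time_integral g X w / (1 / l)))"
    by (rule exp_integrable_imp[OF _ l0 gi]) (use eu[OF u0u(1)] wg in simp)
  thus "integrable M (\<lambda>w. exp (l * time_integral g X w))" by (simp add: mult.commute)
  have Kl: "K g (1 / l) = ln (LINT w|M. exp (l * time_integral g X w)) / l"
    by (simp add: K_def scaled_cgf_def mult.commute)
  define E1 where "E1 = 12 * \<tau>\<^sup>2 * split_error v n"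
  define B where "B u = (\<Sum>i<2^n. K (block s L i g) u)" for u
  have up: "K g (1 / l) \<le> B u0 + E1"
    using K_dyadic_upper[where v=v, OF gm g1 L0 u0p v2 eu[OF order_refl]] unfolding wg B_def E1_def W_def[symmetric]
    by (simp add: u0_def)
  have low: "B u1 \<le> K g (1 / l) + E1"
    using K_dyadic_lower[where v=v, OF gm g1 L0 v2 l0 eu[OF u0u(1)]] unfolding wg B_def E1_def W_def[symmetric]
    by (simp add: u1_def)
  define S where "S = V L / L * (r * F) / 2"
  have S0: "0 \<le> S" unfolding S_def using V_nonneg[of L] L r0 F0 by simp
  define E2 where "E2 = 2 ^ n * (21 * \<gamma>\<^sup>2 * L ^ 3 * (4 * l\<^sup>2) + 4 * \<gamma> * L\<^sup>2 * \<kappa> * (2 * l))"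
  have gk: "\<bar>g x - g y\<bar> \<le> \<kappa>" if "\<bar>x - y\<bar> \<le> L" for x y
    unfolding g_def
  proof (rule \<kappa>)
    have "\<bar>x / r - y / r\<bar> = \<bar>x - y\<bar> / r" using r0 by (simp flip: diff_divide_distrib)
    also have "\<dots> \<le> L / r" using that r0 by (intro divide_right_mono) auto
    also have "\<dots> \<le> d" using r(3) d r0 by (simp add: field_simps)
    finally show "\<bar>x / r - y / r\<bar> \<le> d" .
  qed
  have blocks: "\<bar>B u - S / u\<bar> \<le> E2" if u: "u0 \<le> u" for u
  proof -
    have uh: "1 / (2 * l) \<le> u" using u u0h by linarith
    have uL: "2 * L \<le> u" using hl uh by linarith
    have up: "0 < u" using u u0p by linarith
    have inv: "1 / u \<le> 2 * l" using uh l up by (simp add: field_simps)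
    have "(1 / u)\<^sup>2 \<le> (2 * l)\<^sup>2" using inv up by (intro power_mono) auto
    hence inv2: "1 / u\<^sup>2 \<le> 4 * l\<^sup>2" by (simp add: power_divide power_mult_distrib)
    have "\<bar>B u - V L / L * (r * F) / (2 * u)\<bar>
        \<le> real (2 ^ n) * (21 * \<gamma>\<^sup>2 * L ^ 3 / u\<^sup>2 + 4 * \<gamma> * L\<^sup>2 * \<kappa> / u)"
      using sum_K_blocks[where n="2^n" and s=s, OF gm g1 L0 gk uL] unfolding B_def
      by (simp add: wg2 Fr)
    also have "\<dots> \<le> E2"
    proof -
      have "21 * \<gamma>\<^sup>2 * L ^ 3 / u\<^sup>2 \<le> 21 * \<gamma>\<^sup>2 * L ^ 3 * (4 * l\<^sup>2)"
        using mult_left_mono[OF inv2, of "21 * \<gamma>\<^sup>2 * L ^ 3"] L0 by simp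
      moreover have "4 * \<gamma> * L\<^sup>2 * \<kappa> / u \<le> 4 * \<gamma> * L\<^sup>2 * \<kappa> * (2 * l)"
        using mult_left_mono[OF inv, of "4 * \<gamma> * L\<^sup>2 * \<kappa>"] gamma_nonneg \<kappa>0 by simp
      ultimately show ?thesis unfolding E2_def by (simp add: mult_left_mono)
    qed
    finally show ?thesis by (simp add: S_def)
  qed
  have iu0: "1 / u0 \<le> l * (1 + 10 * \<epsilon>)"
  proof -
    have "\<epsilon> * \<epsilon> \<le> (1/10) * \<epsilon>" using \<epsilon> by (intro mult_right_mono) auto
    hence "1 \<le> (1 + 10 * \<epsilon>) * (1 - 5 * \<epsilon>)" by (simp add: algebra_simps)
    also have "\<dots> = (l * (1 + 10 * \<epsilon>)) * ((1 - 5 * \<epsilon>) / l)" using l by simp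
    also have "\<dots> \<le> (l * (1 + 10 * \<epsilon>)) * u0" using l \<epsilon> by (intro mult_left_mono u0_lower) auto
    finally show ?thesis using u0p by (simp add: field_simps)
  qed
  have iu1: "l * (1 - 5 * \<epsilon>) \<le> 1 / u1"
  proof -
    have u1p: "0 < u1" using u0u u0p by linarith
    have "u1 \<le> (1 + 5 * \<epsilon>) / l" using W by (simp add: u1_def add_divide_distrib)
    hence "l * (1 - 5 * \<epsilon>) * u1 \<le> l * (1 - 5 * \<epsilon>) * ((1 + 5 * \<epsilon>) / l)"
      using l \<epsilon> by (intro mult_left_mono) auto
    also have "\<dots> = 1 - 25 * (\<epsilon> * \<epsilon>)" using l by (simp add: field_simps)
    also have "\<dots> \<le> 1" by simp
    finally show ?thesis using u1p by (simp add: field_simps)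
  qed
  have "K g (1 / l) \<le> S * (1 / u0) + E2 + E1" using up blocks[OF order_refl] by (simp add: abs_le_iff)
  also have "S * (1 / u0) \<le> S * (l * (1 + 10 * \<epsilon>))" by (intro mult_left_mono iu0 S0)
  finally have ub: "K g (1 / l) - S * l \<le> 10 * \<epsilon> * (S * l) + E2 + E1" by (simp add: algebra_simps)
  have "S * (l * (1 - 5 * \<epsilon>)) \<le> S * (1 / u1)" by (intro mult_left_mono iu1 S0)
  also have "\<dots> \<le> K g (1 / l) + E2 + E1"
    using low blocks[of u1] u0u by (simp add: abs_le_iff)
  finally have "S * l - K g (1 / l) \<le> 5 * \<epsilon> * (S * l) + E2 + E1" by (simp add: algebra_simps)
  moreover have "0 \<le> \<epsilon> * (S * l)" using \<epsilon> S0 l by simp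
  ultimately have both: "\<bar>K g (1 / l) - S * l\<bar> \<le> 10 * \<epsilon> * (S * l) + E2 + E1"
    using ub by (simp add: abs_le_iff)
  have rl: "0 < r * l" using r0 l by simp
  have Nr: "2 ^ n / r \<le> 4 * a / L" using n(2) r0 L0 by (simp add: field_simps)
  have E1r: "E1 / (r * l) \<le> 72 * \<tau>\<^sup>2 * a / (\<epsilon> * L)"
  proof -
    have "1 / (2 ^ Suc j * v j) \<le> l / \<epsilon> * (1/2) * (2/3) ^ j" for j
    proof -
      have q: "0 < \<epsilon> / l * (3/4) ^ j" using \<epsilon> l by simp
      have "1 / (2 ^ Suc j * v j) \<le> 1 / (2 ^ Suc j * (\<epsilon> / l * (3/4) ^ j))"
      proof (rule frac_le)
        show "0 < 2 ^ Suc j * (\<epsilon> / l * (3/4) ^ j)" by (rule mult_pos_pos[OF _ q]) simp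
        show "2 ^ Suc j * (\<epsilon> / l * (3/4) ^ j) \<le> 2 ^ Suc j * v j"
          unfolding v_def by (intro mult_left_mono) auto
      qed simp_all
      also have "\<dots> = l / \<epsilon> * (1/2) * (1 / (2 * (3/4))) ^ j"
      proof -
        have "(4::real) ^ j = 2 ^ j * 2 ^ j" by (simp flip: power_mult_distrib)
        thus ?thesis by (simp add: power_divide power_mult_distrib)
      qed
      finally show ?thesis by simp
    qed
    hence "(\<Sum>j<n. 1 / (2 ^ Suc j * v j)) \<le> (\<Sum>j<n. l / \<epsilon> * (1/2) * (2/3) ^ j)" by (intro sum_mono)
    also have "\<dots> = l / \<epsilon> * (1/2) * (\<Sum>j<n. (2/3) ^ j)" by (simp add: sum_distrib_left)
    also have "\<dots> \<le> l / \<epsilon> * (1/2) * 3"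
      using sum_geometric_le[of "2/3" n] \<epsilon> l by (intro mult_left_mono) auto
    finally have se: "(\<Sum>j<n. 1 / (2 ^ Suc j * v j)) \<le> 3/2 * l / \<epsilon>" by simp
    have sn: "0 \<le> (\<Sum>j<n. 1 / (2 ^ Suc j * v j)) / l"
    proof -
      have "0 < v j" for j using v2[of j] by linarith
      thus ?thesis using l by (intro divide_nonneg_pos sum_nonneg) (auto intro!: mult_pos_pos less_imp_le)
    qed
    have "E1 / (r * l) = 12 * \<tau>\<^sup>2 * (2 ^ n / r) * ((\<Sum>j<n. 1 / (2 ^ Suc j * v j)) / l)"
      by (simp add: E1_def split_error_def)
    also have "\<dots> \<le> 12 * \<tau>\<^sup>2 * (4 * a / L) * ((3/2 * l / \<epsilon>) / l)"
      using Nr se sn l r0 a L0 by (intro mult_mono divide_right_mono) auto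
    also have "\<dots> = 72 * \<tau>\<^sup>2 * a / (\<epsilon> * L)" using l by (simp add: mult_ac)
    finally show ?thesis .
  qed
  have E2r: "E2 / (r * l) \<le> a * (336 * \<gamma>\<^sup>2 * L\<^sup>2 * l + 32 * \<gamma> * L * \<kappa>)"
  proof -
    have "E2 / (r * l) = (2 ^ n / r) * (84 * \<gamma>\<^sup>2 * L ^ 3 * l + 8 * \<gamma> * L\<^sup>2 * \<kappa>)"
      using l r0 unfolding E2_def by (simp add: field_simps power2_eq_square)
    also have "\<dots> \<le> (4 * a / L) * (84 * \<gamma>\<^sup>2 * L ^ 3 * l + 8 * \<gamma> * L\<^sup>2 * \<kappa>)"
      using Nr l L0 gamma_nonneg \<kappa>0 by (intro mult_right_mono) auto
    also have "\<dots> = a * (336 * \<gamma>\<^sup>2 * L\<^sup>2 * l + 32 * \<gamma> * L * \<kappa>)"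
      using L0 by (simp add: field_simps power2_eq_square power3_eq_cube)
    finally show ?thesis .
  qed
  have Sr: "S * l / (r * l) = V L / L * F / 2" using r0 l by (simp add: S_def)
  have lnK: "ln (LINT w|M. exp (l * time_integral g X w)) / (r * l\<^sup>2) = K g (1 / l) / (r * l)"
    by (simp add: Kl power2_eq_square)
  have "\<bar>ln (LINT w|M. exp (l * time_integral g X w)) / (r * l\<^sup>2) - V L / L * F / 2\<bar>
      = \<bar>K g (1 / l) - S * l\<bar> / (r * l)"
  proof -
    have "\<bar>p / (r * l) - q / (r * l)\<bar> = \<bar>p - q\<bar> / (r * l)" for p q
      using rl by (simp flip: diff_divide_distrib)
    thus ?thesis unfolding Sr[symmetric] lnK .
  qed
  also have "\<dots> \<le> (10 * \<epsilon> * (S * l) + E2 + E1) / (r * l)"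
    using rl by (intro divide_right_mono both) auto
  also have "\<dots> = 10 * \<epsilon> * (S * l / (r * l)) + E2 / (r * l) + E1 / (r * l)"
    by (simp add: add_divide_distrib)
  also have "\<dots> \<le> 5 * \<epsilon> * (V L / L) * F + 72 * \<tau>\<^sup>2 * a / (\<epsilon> * L)
        + a * (336 * \<gamma>\<^sup>2 * L\<^sup>2 * l + 32 * \<gamma> * L * \<kappa>)"
  proof -
    have half: "10 * \<epsilon> * (V L / L * F / 2) = 5 * \<epsilon> * (V L / L) * F" by simp
    have add: "x \<le> y \<Longrightarrow> z \<le> w \<Longrightarrow> c + z + x \<le> c + y + w" for x y z w c :: real by linarith
    show ?thesis unfolding Sr half by (rule add[OF E1r E2r])
  qed
  finally show "\<bar>ln (LINT w|M. exp (l * time_integral g X w)) / (r * l\<^sup>2) - V L / L * F / 2\<bar>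
      \<le> 5 * \<epsilon> * (V L / L) * F + 72 * \<tau>\<^sup>2 * a / (\<epsilon> * L)
        + a * (336 * \<gamma>\<^sup>2 * L\<^sup>2 * l + 32 * \<gamma> * L * \<kappa>)" .
qed

end


text \<open>The order of choices: first \<open>\<epsilon>\<close> (shift of the argument), then the block length \<open>L = 2^m\<close>
(cost of the cuts, distance of \<open>V L / L\<close> from \<open>\<sigma>\<^sup>2\<close>), and only then \<open>\<kappa>\<close>, \<open>R\<close> and \<open>\<delta>\<close>, which depend
on \<open>L\<close>. Each error gets at most a fifth of \<open>e\<close>.\<close>

lemma (in centred_coupled_process) moderate_deviations:
  assumes \<sigma>: "(\<lambda>m. V (2 ^ m) / 2 ^ m) \<longlonglongrightarrow> \<sigma>\<^sup>2"
    and f: "continuous_on UNIV f" "\<And>t. \<bar>f t\<bar> \<le> 1"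
    and a: "1 \<le> a" "\<And>t. a < \<bar>t\<bar> \<Longrightarrow> f t = 0" and e: "0 < e"
  shows "\<exists>R \<delta>. 0 < \<delta> \<and> (\<forall>r l. R \<le> r \<longrightarrow> 0 < l \<longrightarrow> l * ln r \<le> \<delta> \<longrightarrow>
    integrable M (\<lambda>w. exp (l * time_integral (\<lambda>t. f (t / r)) X w)) \<and>
    \<bar>ln (LINT w|M. exp (l * time_integral (\<lambda>t. f (t / r)) X w)) / (r * l\<^sup>2)
      - \<sigma>\<^sup>2 / 2 * (LINT t|lborel. (f t)\<^sup>2)\<bar> < e)"
proof -
  have fm: "f \<in> borel_measurable borel" using f(1) by (rule borel_measurable_continuous_onI)
  define F where "F = (LINT t|lborel. (f t)\<^sup>2)"
  have F0: "0 \<le> F" by (simp add: F_def)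
  define p where "p = 25 * (\<sigma>\<^sup>2 + 1) * (F + 1)"
  have p: "0 < p" using F0 by (auto simp: p_def intro!: mult_pos_pos add_nonneg_pos)
  define \<epsilon> where "\<epsilon> = min (1/10) (e / p)"
  have \<epsilon>: "0 < \<epsilon>" "\<epsilon> \<le> 1/10" unfolding \<epsilon>_def using e p by (simp, intro min.cobounded1)
  have \<epsilon>p: "\<epsilon> * p \<le> e" using p by (auto simp: \<epsilon>_def min_def field_simps)
  have lim1: "(\<lambda>m. \<bar>V (2 ^ m) / 2 ^ m - \<sigma>\<^sup>2\<bar> * F / 2) \<longlonglongrightarrow> \<bar>\<sigma>\<^sup>2 - \<sigma>\<^sup>2\<bar> * F / 2"
    by (intro tendsto_intros \<sigma>) auto
  have lim2: "(\<lambda>m. 72 * \<tau>\<^sup>2 * a / \<epsilon> * (1/2) ^ m) \<longlonglongrightarrow> 72 * \<tau>\<^sup>2 * a / \<epsilon> * 0"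
    by (intro tendsto_intros LIMSEQ_power_zero) auto
  have "\<forall>\<^sub>F m in sequentially. V (2 ^ m) / 2 ^ m < \<sigma>\<^sup>2 + 1
      \<and> \<bar>V (2 ^ m) / 2 ^ m - \<sigma>\<^sup>2\<bar> * F / 2 < e / 5 \<and> 72 * \<tau>\<^sup>2 * a / \<epsilon> * (1/2) ^ m < e / 5"
    using e by (intro eventually_conj order_tendstoD(2)[OF \<sigma>] order_tendstoD(2)[OF lim1] order_tendstoD(2)[OF lim2]) auto
  then obtain m where m: "V (2 ^ m) / 2 ^ m < \<sigma>\<^sup>2 + 1"
      "\<bar>V (2 ^ m) / 2 ^ m - \<sigma>\<^sup>2\<bar> * F / 2 < e / 5" "72 * \<tau>\<^sup>2 * a / \<epsilon> * (1/2) ^ m < e / 5"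
    by (auto simp: eventually_sequentially)
  define L :: real where "L = 2 ^ m"
  have L: "1 \<le> L" by (simp add: L_def)
  define s where "s = V L / L"
  have s0: "0 \<le> s" using V_nonneg[of L] L by (simp add: s_def)
  define q where "q = a * (336 * \<gamma>\<^sup>2 * L\<^sup>2) + 1"
  have q: "0 < q" using a L by (auto simp: q_def intro!: add_nonneg_pos mult_nonneg_nonneg)
  define b where "b = a * (32 * \<gamma> * L) + 1"
  have b: "0 < b" using a L gamma_nonneg by (auto simp: b_def intro!: add_nonneg_pos mult_nonneg_nonneg)
  define \<kappa> where "\<kappa> = e / (10 * b)"
  have \<kappa>: "0 < \<kappa>" using e b by (simp add: \<kappa>_def)
  have "uniformly_continuous_on {- a - 1 .. a + 1} f"
    using f(1) by (intro compact_uniformly_continuous continuous_on_subset[OF f(1)]) auto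
  then obtain d0 where d0: "0 < d0"
    "\<And>x y. x \<in> {- a - 1 .. a + 1} \<Longrightarrow> y \<in> {- a - 1 .. a + 1} \<Longrightarrow> dist y x < d0 \<Longrightarrow> dist (f y) (f x) < \<kappa>"
    unfolding uniformly_continuous_on_def using \<kappa> by metis
  define d where "d = min (d0 / 2) 1"
  have d: "0 < d" using d0 by (simp add: d_def)
  have mod: "\<bar>f x - f y\<bar> \<le> \<kappa>" if "\<bar>x - y\<bar> \<le> d" for x y
  proof (cases "\<bar>x\<bar> \<le> a + 1 \<and> \<bar>y\<bar> \<le> a + 1")
    case True
    have "\<bar>x - y\<bar> < d0" using that d0(1) by (simp add: d_def)
    hence "dist (f x) (f y) < \<kappa>" using True by (intro d0(2)) (auto simp: dist_real_def abs_le_iff)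
    thus ?thesis by (simp add: dist_real_def)
  next
    case False
    have "\<bar>x - y\<bar> \<le> 1" using that by (simp add: d_def)
    hence "a < \<bar>x\<bar>" "a < \<bar>y\<bar>" using False by linarith+
    thus ?thesis using a(2) \<kappa> by simp
  qed
  \<comment> \<open>R is at least 3 so that ln r is at least 1, and smallness of l * ln r implies that of l.\<close>
  define R where "R = Max {3, 4 * a, L, L / d}"
  define \<delta> where "\<delta> = Min {\<epsilon> / 6, 1 / (4 * L), e / (10 * q)}"
  have \<delta>: "0 < \<delta>" using \<epsilon> L e q by (simp add: \<delta>_def)
  have "integrable M (\<lambda>w. exp (l * time_integral (\<lambda>t. f (t / r)) X w)) \<and>
    \<bar>ln (LINT w|M. exp (l * time_integral (\<lambda>t. f (t / r)) X w)) / (r * l\<^sup>2) - \<sigma>\<^sup>2 / 2 * F\<bar> < e"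
    if r: "R \<le> r" and l: "0 < l" "l * ln r \<le> \<delta>" for r l
  proof -
    have r': "3 \<le> r" "4 * a \<le> r" "L \<le> r" "L / d \<le> r" using r by (auto simp: R_def)
    have "1 \<le> ln r"
    proof -
      have "exp 1 \<le> r" using e_less_272 r'(1) by linarith
      thus ?thesis using r'(1) by (subst ln_ge_iff) auto
    qed
    hence "l * 1 \<le> l * ln r" using l by (intro mult_left_mono) auto
    hence l\<delta>: "l \<le> \<delta>" using l by linarith
    have l1: "6 * (l * ln r) \<le> \<epsilon>" using l(2) by (simp add: \<delta>_def)
    have l2: "l * L \<le> 1/4"
    proof -
      have "l \<le> 1 / (4 * L)" using l\<delta> by (simp add: \<delta>_def)
      thus ?thesis using L by (simp add: field_simps)
    qed
    have l3: "l * q \<le> e / 10"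
    proof -
      have "l \<le> e / (10 * q)" using l\<delta> by (simp add: \<delta>_def)
      thus ?thesis using q by (simp add: field_simps)
    qed
    note est = level_estimate[OF fm f(2) a d mod L \<epsilon> r'(2-4) l(1) l1 l2]
    let ?Q = "ln (LINT w|M. exp (l * time_integral (\<lambda>t. f (t / r)) X w)) / (r * l\<^sup>2)"
    have main: "\<bar>?Q - s * F / 2\<bar> \<le> 5 * \<epsilon> * s * F + 72 * \<tau>\<^sup>2 * a / (\<epsilon> * L)
        + a * (336 * \<gamma>\<^sup>2 * L\<^sup>2 * l + 32 * \<gamma> * L * \<kappa>)"
      using est(2) by (simp add: F_def s_def)
    have t1: "5 * \<epsilon> * s * F \<le> e / 5"
    proof -
      have "s * F \<le> (\<sigma>\<^sup>2 + 1) * (F + 1)" using m(1) s0 F0 by (intro mult_mono) (auto simp: s_def L_def)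
      hence "5 * \<epsilon> * (s * F) \<le> 5 * \<epsilon> * ((\<sigma>\<^sup>2 + 1) * (F + 1))" using \<epsilon> by (intro mult_left_mono) auto
      also have "\<dots> = \<epsilon> * p / 5" by (simp add: p_def)
      finally show ?thesis using \<epsilon>p by simp
    qed
    have t2: "72 * \<tau>\<^sup>2 * a / (\<epsilon> * L) < e / 5"
      using m(3) by (simp add: L_def power_one_over)
    have "a * (336 * \<gamma>\<^sup>2 * L\<^sup>2 * l) \<le> l * q" using l by (simp add: q_def algebra_simps)
    hence t3: "a * (336 * \<gamma>\<^sup>2 * L\<^sup>2 * l) \<le> e / 10" using l3 by linarith
    have "a * (32 * \<gamma> * L * \<kappa>) \<le> b * \<kappa>" using \<kappa> by (simp add: b_def algebra_simps)
    hence t4: "a * (32 * \<gamma> * L * \<kappa>) \<le> e / 10" using b by (simp add: \<kappa>_def)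
    have "\<bar>s * F / 2 - \<sigma>\<^sup>2 / 2 * F\<bar> = \<bar>s - \<sigma>\<^sup>2\<bar> * F / 2"
    proof -
      have eq: "s * F / 2 - \<sigma>\<^sup>2 / 2 * F = (s - \<sigma>\<^sup>2) * (F / 2)" by (simp add: algebra_simps)
      show ?thesis unfolding eq using F0 by (simp add: abs_mult)
    qed
    hence t5: "\<bar>s * F / 2 - \<sigma>\<^sup>2 / 2 * F\<bar> < e / 5" using m(2) by (simp add: s_def L_def)
    have "a * (336 * \<gamma>\<^sup>2 * L\<^sup>2 * l + 32 * \<gamma> * L * \<kappa>) \<le> e / 5"
      using t3 t4 by (simp add: distrib_left)
    with main t1 t2 have "\<bar>?Q - s * F / 2\<bar> \<le> e / 5 + e / 5 + e / 5" by linarith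
    moreover have "\<bar>x - y\<bar> \<le> e / 5 + e / 5 + e / 5 \<Longrightarrow> \<bar>y - z\<bar> < e / 5 \<Longrightarrow> \<bar>x - z\<bar> < e" for x y z :: real
      using e by linarith
    ultimately have "\<bar>?Q - \<sigma>\<^sup>2 / 2 * F\<bar> < e" using t5 by blast
    thus ?thesis using est(1) by blast
  qed
  thus ?thesis using \<delta> unfolding F_def by blast
qed

text \<open>The estimate for \<open>\<bar>f\<bar> \<le> 1\<close> and positive \<open>\<lambda>\<close> is applied to \<open>f / B\<close> and \<open>- f / B\<close> with parameter
\<open>B \<bar>\<lambda>\<bar>\<close>, where \<open>B\<close> bounds \<open>\<bar>f\<bar>\<close>; both sides of the limit are quadratic in this scaling.\<close>

theorem theorem2:
  fixes M :: "'a measure" and X :: "real \<Rightarrow> 'a \<Rightarrow> real"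
  assumes "splittable TYPE('b) M X"
  shows "\<exists>\<sigma>::real. \<sigma> \<ge> 0 \<and>
    (\<forall>f :: real \<Rightarrow> real. continuous_on UNIV f \<longrightarrow> compact (closure {t. f t \<noteq> 0}) \<longrightarrow>
      (\<forall>\<epsilon>>0. \<exists>(R::real) (\<delta>::real). \<delta> > 0 \<and>
        (\<forall>r l :: real. r \<ge> R \<longrightarrow> l \<noteq> 0 \<longrightarrow> \<bar>l\<bar> * ln r \<le> \<delta> \<longrightarrow>
          integrable M (\<lambda>\<omega>. exp (l * (LINT t|lborel. f (t / r) * X t \<omega>))) \<and>
          \<bar>1 / (r * l\<^sup>2) * ln (LINT \<omega>|M. exp (l * (LINT t|lborel. f (t / r) * X t \<omega>)))
            - \<sigma>\<^sup>2 / 2 * (L2_norm f)\<^sup>2\<bar> < \<epsilon>)))"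
proof -
  from assms obtain N :: "'b measure" and X0 Xm Xp where
    X: "random_process M X" "stationary M X" and ex: "integrable M (\<lambda>w. exp \<bar>X 0 w\<bar>)"
    and mz: "(LINT w|M. X 0 w) = 0"
    and N: "random_process N X0" "random_process N Xm" "random_process N Xp"
      "independent_processes N Xm Xp" "identically_distributed M X N X0"
      "identically_distributed M X N Xm" "identically_distributed M X N Xp"
    and fin: "(\<integral>\<^sup>+w. exp_ennreal (coupling_deviation X0 Xm Xp w) \<partial>N) < \<infinity>"
    unfolding splittable_def coupling_deviation_def by blast
  obtain \<tau> where \<tau>: "(\<integral>\<^sup>+w. exp_ennreal (coupling_deviation X0 Xm Xp w) \<partial>N) \<le> ennreal \<tau>"
    using fin by (cases "\<integral>\<^sup>+w. exp_ennreal (coupling_deviation X0 Xm Xp w) \<partial>N") auto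
  have X0i: "integrable M (X 0)"
  proof (rule Bochner_Integration.integrable_bound[OF ex])
    have "\<bar>X 0 w\<bar> \<le> exp \<bar>X 0 w\<bar>" for w using exp_ge_add_one_self[of "\<bar>X 0 w\<bar>"] by linarith
    thus "AE w in M. norm (X 0 w) \<le> norm (exp \<bar>X 0 w\<bar>)" by simp
  qed (rule random_process_component[OF X(1)])
  interpret centred_coupled_process M X N X0 Xm Xp \<tau>
    by unfold_locales (fact X N X0i \<tau> ex mz)+
  obtain \<sigma> where \<sigma>: "0 \<le> \<sigma>" "(\<lambda>m. V (2 ^ m) / 2 ^ m) \<longlonglongrightarrow> \<sigma>\<^sup>2"
    using variance_rate_convergent by blast
  have "\<exists>(R::real) (\<delta>::real). \<delta> > 0 \<and>
        (\<forall>r l :: real. r \<ge> R \<longrightarrow> l \<noteq> 0 \<longrightarrow> \<bar>l\<bar> * ln r \<le> \<delta> \<longrightarrow>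
          integrable M (\<lambda>w. exp (l * (LINT t|lborel. f (t / r) * X t w))) \<and>
          \<bar>1 / (r * l\<^sup>2) * ln (LINT w|M. exp (l * (LINT t|lborel. f (t / r) * X t w)))
            - \<sigma>\<^sup>2 / 2 * (L2_norm f)\<^sup>2\<bar> < \<epsilon>)"
    if f: "continuous_on UNIV f" "compact (closure {t. f t \<noteq> 0})" and \<epsilon>: "0 < \<epsilon>"
    for f :: "real \<Rightarrow> real" and \<epsilon> :: real
  proof -
    have "bounded {t. f t \<noteq> 0}" using f(2) compact_imp_bounded bounded_subset closure_subset by metis
    then obtain a0 where a0: "\<And>t. f t \<noteq> 0 \<Longrightarrow> \<bar>t\<bar> \<le> a0" by (auto simp: bounded_iff)
    define a where "a = max a0 1"
    have a: "1 \<le> a" "\<And>t. a < \<bar>t\<bar> \<Longrightarrow> f t = 0" using a0 by (force simp: a_def)+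
    have "compact (f ` {-a..a})"
      by (intro compact_continuous_image continuous_on_subset[OF f(1)]) auto
    hence "\<exists>B0. \<forall>t\<in>{-a..a}. \<bar>f t\<bar> \<le> B0"
      using compact_imp_bounded[of "f ` {-a..a}"] by (simp add: bounded_iff)
    then obtain B0 where B0: "\<And>t. t \<in> {-a..a} \<Longrightarrow> \<bar>f t\<bar> \<le> B0" by blast
    define B where "B = max B0 1"
    have B: "0 < B" by (simp add: B_def)
    have fB: "\<bar>f t\<bar> \<le> B" for t
    proof (cases "a < \<bar>t\<bar>")
      case False
      hence "\<bar>f t\<bar> \<le> B0" by (intro B0) auto
      thus ?thesis by (simp add: B_def)
    qed (use a(2) B in simp)
    have cont: "continuous_on UNIV (\<lambda>t. c * f t / B)" for c using f(1) B by (intro continuous_intros) auto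
    have bd: "\<bar>c * f t / B\<bar> \<le> 1" if "\<bar>c\<bar> = 1" for c t using fB[of t] B that by (simp add: abs_mult)
    define good where "good c r l \<longleftrightarrow>
        integrable M (\<lambda>w. exp (l * time_integral (\<lambda>t. c * f (t / r) / B) X w)) \<and>
        \<bar>ln (LINT w|M. exp (l * time_integral (\<lambda>t. c * f (t / r) / B) X w)) / (r * l\<^sup>2)
          - \<sigma>\<^sup>2 / 2 * (LINT t|lborel. (c * f t / B)\<^sup>2)\<bar> < \<epsilon> / B\<^sup>2" for c r l
    have md: "\<exists>R \<delta>. 0 < \<delta> \<and> (\<forall>r l. R \<le> r \<longrightarrow> 0 < l \<longrightarrow> l * ln r \<le> \<delta> \<longrightarrow> good c r l)" if "\<bar>c\<bar> = 1" for c
      unfolding good_def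
      by (rule moderate_deviations[OF \<sigma>(2) cont bd[OF that] a(1)]) (use a(2) \<epsilon> B in auto)
    obtain R1 \<delta>1 where 1: "0 < \<delta>1" "\<And>r l. R1 \<le> r \<Longrightarrow> 0 < l \<Longrightarrow> l * ln r \<le> \<delta>1 \<Longrightarrow> good 1 r l"
      using md[of 1] by auto
    obtain R2 \<delta>2 where 2: "0 < \<delta>2" "\<And>r l. R2 \<le> r \<Longrightarrow> 0 < l \<Longrightarrow> l * ln r \<le> \<delta>2 \<Longrightarrow> good (-1) r l"
      using md[of "-1"] by auto
    show ?thesis
    proof (intro exI conjI allI impI)
      show "0 < min \<delta>1 \<delta>2 / B" using 1 2 B by simp
      fix r l :: real
      assume r: "max (max R1 R2) 1 \<le> r" and l: "l \<noteq> 0" and rl: "\<bar>l\<bar> * ln r \<le> min \<delta>1 \<delta>2 / B"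
      define c where "c = sgn l"
      have c: "\<bar>c\<bar> = 1" "c = 1 \<or> c = -1" "\<bar>l\<bar> * c = l" "c\<^sup>2 = 1" using l by (auto simp: c_def sgn_if)
      have Bl: "0 < B * \<bar>l\<bar>" using B l by simp
      have Blr: "B * \<bar>l\<bar> * ln r \<le> min \<delta>1 \<delta>2" using rl B by (simp add: field_simps)
      have ti: "B * \<bar>l\<bar> * time_integral (\<lambda>t. c * f (t / r) / B) X w = l * (LINT t|lborel. f (t / r) * X t w)" for w
      proof -
        have "time_integral (\<lambda>t. c * f (t / r) / B) X w = c / B * (LINT t|lborel. f (t / r) * X t w)"
          unfolding time_integral_def integral_mult_right_zero[symmetric] by (simp add: mult.assoc)
        hence "B * \<bar>l\<bar> * time_integral (\<lambda>t. c * f (t / r) / B) X w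
            = (\<bar>l\<bar> * c) * (LINT t|lborel. f (t / r) * X t w)" using B by simp
        thus ?thesis by (simp only: c(3))
      qed
      have sq: "(LINT t|lborel. (c * f t / B)\<^sup>2) = (L2_norm f)\<^sup>2 / B\<^sup>2"
        by (simp add: L2_norm_def power_divide power_mult_distrib c(4))
      have "good c r (B * \<bar>l\<bar>)"
        using c(2)
      proof
        assume "c = 1"
        thus ?thesis using 1(2)[OF _ Bl, of r] r Blr by simp
      next
        assume "c = -1"
        thus ?thesis using 2(2)[OF _ Bl, of r] r Blr by simp
      qed
      hence i: "integrable M (\<lambda>w. exp (l * (LINT t|lborel. f (t / r) * X t w)))"
        and est: "\<bar>ln (LINT w|M. exp (l * (LINT t|lborel. f (t / r) * X t w))) / (r * (B * \<bar>l\<bar>)\<^sup>2)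
          - \<sigma>\<^sup>2 / 2 * ((L2_norm f)\<^sup>2 / B\<^sup>2)\<bar> < \<epsilon> / B\<^sup>2"
        unfolding good_def ti sq by auto
      show "integrable M (\<lambda>w. exp (l * (LINT t|lborel. f (t / r) * X t w)))" by fact
      let ?Q = "ln (LINT w|M. exp (l * (LINT t|lborel. f (t / r) * X t w)))"
      have "?Q / (r * (B * \<bar>l\<bar>)\<^sup>2) - \<sigma>\<^sup>2 / 2 * ((L2_norm f)\<^sup>2 / B\<^sup>2)
          = (1 / (r * l\<^sup>2) * ?Q - \<sigma>\<^sup>2 / 2 * (L2_norm f)\<^sup>2) / B\<^sup>2"
        by (simp add: diff_divide_distrib power_mult_distrib mult_ac)
      hence "\<bar>1 / (r * l\<^sup>2) * ?Q - \<sigma>\<^sup>2 / 2 * (L2_norm f)\<^sup>2\<bar> / B\<^sup>2 < \<epsilon> / B\<^sup>2"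
        using est by (simp only: abs_divide) simp
      thus "\<bar>1 / (r * l\<^sup>2) * ?Q - \<sigma>\<^sup>2 / 2 * (L2_norm f)\<^sup>2\<bar> < \<epsilon>"
        using B by (simp add: divide_less_cancel)
    qed
  qed
  thus ?thesis using \<sigma>(1) by blast
qed

end
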